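(* The bilinear form $\mathcal{B}:\mathbb{U}\times\mathbb{V}\to\mathbb{R}$, $$\mathcal{B}(\widetilde u,v):=\int_0^T\left(\frac{1}{c^2}\langle\partial_{tt}\widetilde u,v\rangle+(\nabla\widetilde u,\nabla v)_{L^2(\Omega)}\right)\mathrm{d}t,$$ satisfies $$\inf_{\widetilde u\in\mathbb{U}\setminus\{0\}}\ \sup_{v\in\mathbb{V}\setminus\{0\}}\ \frac{\mathcal{B}(\widetilde u,v)}{\|\widetilde u\|_{\mathbb{U}}\,\|v\|_{\mathbb{V}}}=0.$$ Consequently, the weak formulation $\mathcal{L}u=f$ in $\mathbb{V}^*$ of the wave equation, with $\mathcal{L}:=\frac{1}{c^2}\partial_{tt}-\Delta:\mathbb{U}\to\mathbb{V}^*$, does not satisfy the equivalence $\|u\|_{\mathbb{U}}\eqsim\|f\|_{\mathbb{V}^*}$; that is, there are no constants $0<C_1\le C_2$ such that $C_1\|\mathcal{L}u\|_{\mathbb{V}^*}\le\|u\|_{\mathbb{U}}\le C_2\|\mathcal{L}u\|_{\mathbb{V}^*}$ for all $u\in\mathbb{U}$.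
   Context: $\Omega\subset\mathbb{R}^d$, $d\ge1$, is an open, bounded, connected set whose boundary is locally the graph of a Lipschitz function; $T>0$ and $c>0$. For a Banach space $\mathbb{X}$, $L^2(\mathbb{X})$ and $H^2(\mathbb{X})$ denote the Bochner spaces of $L^2$, respectively $H^2$, functions $[0,T]\to\mathbb{X}$. $H^1_0(\Omega)$ carries the norm $\|\nabla\cdot\|_{L^2(\Omega)}$, $H^{-1}(\Omega)$ is its dual with the dual norm, and $\langle\cdot,\cdot\rangle$ is the duality pairing of $H^{-1}(\Omega)$ and $H^1_0(\Omega)$. Trial space: $\mathbb{U}:=\{\widetilde u\in L^2(H^1_0(\Omega))\cap H^2(H^{-1}(\Omega))\mid\widetilde u(0)=0,\ \partial_t\widetilde u(0)=0\}$ with $\|\widetilde u\|_{\mathbb{U}}^2:=\|\widetilde u\|_{L^2(H^1_0)}^2+\frac{1}{c^4}\|\partial_{tt}\widetilde u\|_{L^2(H^{-1})}^2$. Test space: $\mathbb{V}:=L^2(H^1_0(\Omega))$ with $\|\cdot\|_{\mathbb{V}}:=\|\cdot\|_{L^2(H^1_0)}$. Data space: $\mathbb{V}^*:=L^2(H^{-1}(\Omega))$ with $\|\cdot\|_{\mathbb{V}^*}:=\|\cdot\|_{L^2(H^{-1})}$. The differential operators in $\mathcal{L}$ are understood in the weak sense, so that $\mathcal{B}(\widetilde u,v)=\langle\mathcal{L}\widetilde u,v\rangle_{\mathbb{V}^*\times\mathbb{V}}$. The problem $\mathcal{L}u=f$, $u\in\mathbb{U}$, is the weak form of $\frac{1}{c^2}\partial_{tt}u-\Delta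 u=f$ in $\Omega\times(0,T)$ with homogeneous Dirichlet boundary conditions and zero initial values. *)

theory Defs
  imports "HOL-Analysis.Analysis" "HOL-Library.Function_Algebras"
begin

text \<open>Elements of Sobolev spaces are represented by functions, and elements of their duals by
  functionals on functions.  The vector space operations are the pointwise ones.\<close>

instantiation "fun" :: (type, real_vector) real_vector
begin

definition scaleR_fun :: "real \<Rightarrow> ('a \<Rightarrow> 'b) \<Rightarrow> 'a \<Rightarrow> 'b" where
  "scaleR_fun r f = (\<lambda>x. r *\<^sub>R f x)"

instance
  by standard (simp_all add: scaleR_fun_def fun_eq_iff algebra_simps)

end

text \<open>Near each boundary point, in the Cartesian frame with distinguished axis \<open>e\<close>, the set is the
  part of a ball lying strictly on one side of the graph of a Lipschitz function of the
  remaining coordinates \<open>x - (x \<bullet> e) *\<^sub>R e\<close>.\<close>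

definition lipschitz_boundary :: "'a::euclidean_space set \<Rightarrow> bool" where
  "lipschitz_boundary \<Omega> \<longleftrightarrow>
     (\<forall>p \<in> frontier \<Omega>. \<exists>r>0. \<exists>e \<gamma> K.
        norm e = 1 \<and> K-lipschitz_on {y. y \<bullet> e = 0} \<gamma> \<and>
        \<Omega> \<inter> ball p r = {x \<in> ball p r. \<gamma> (x - (x \<bullet> e) *\<^sub>R e) < x \<bullet> e})"

definition lipschitz_domain :: "'a::euclidean_space set \<Rightarrow> bool" where
  "lipschitz_domain \<Omega> \<longleftrightarrow>
     open \<Omega> \<and> bounded \<Omega> \<and> connected \<Omega> \<and> \<Omega> \<noteq> {} \<and> lipschitz_boundary \<Omega>"

primrec iterated_partial ::
    "'a::euclidean_space list \<Rightarrow> ('a \<Rightarrow> real) \<Rightarrow> 'a \<Rightarrow> real" where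
  "iterated_partial [] f = f"
| "iterated_partial (e # es) f = (\<lambda>x. frechet_derivative (iterated_partial es f) (at x) e)"

definition smooth :: "('a::euclidean_space \<Rightarrow> real) \<Rightarrow> bool" where
  "smooth f \<longleftrightarrow>
     (\<forall>es. set es \<subseteq> Basis \<longrightarrow> (\<forall>x. iterated_partial es f differentiable (at x)))"

definition test_function :: "'a::euclidean_space set \<Rightarrow> ('a \<Rightarrow> real) \<Rightarrow> bool" where
  "test_function \<Omega> \<phi> \<longleftrightarrow>
     smooth \<phi> \<and> compact (closure {x. \<phi> x \<noteq> 0}) \<and> closure {x. \<phi> x \<noteq> 0} \<subseteq> \<Omega>"

text \<open>All spaces below are sets of representatives carrying a seminorm; the elements of the spaces
  in the usual sense are the classes modulo equality almost everywhere.  Values of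
  representatives outside \<open>\<Omega>\<close> are irrelevant.\<close>

definition square_integrable_on ::
    "('a::euclidean_space \<Rightarrow> 'b::euclidean_space) \<Rightarrow> 'a set \<Rightarrow> bool"
    (infix \<open>square'_integrable'_on\<close> 46) where
  "f square_integrable_on \<Omega> \<longleftrightarrow>
     f \<in> borel_measurable (lebesgue_on \<Omega>) \<and> integrable (lebesgue_on \<Omega>) (\<lambda>x. (norm (f x))\<^sup>2)"

definition is_weak_gradient ::
    "'a::euclidean_space set \<Rightarrow> ('a \<Rightarrow> real) \<Rightarrow> ('a \<Rightarrow> 'a) \<Rightarrow> bool" where
  "is_weak_gradient \<Omega> u g \<longleftrightarrow>
     (\<forall>\<phi>. test_function \<Omega> \<phi> \<longrightarrow> (\<forall>b\<in>Basis.
        (\<integral>x. u x * frechet_derivative \<phi> (at x) b \<partial>lebesgue_on \<Omega>)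
          = - (\<integral>x. (g x \<bullet> b) * \<phi> x \<partial>lebesgue_on \<Omega>)))"

definition H1 :: "'a::euclidean_space set \<Rightarrow> ('a \<Rightarrow> real) set" where
  "H1 \<Omega> = {u. u square_integrable_on \<Omega> \<and> (\<exists>g. g square_integrable_on \<Omega> \<and> is_weak_gradient \<Omega> u g)}"

text \<open>On \<open>H1 \<Omega>\<close> the weak gradient is determined up to equality almost everywhere.\<close>

definition weak_grad :: "'a::euclidean_space set \<Rightarrow> ('a \<Rightarrow> real) \<Rightarrow> 'a \<Rightarrow> 'a" where
  "weak_grad \<Omega> u = (SOME g. g square_integrable_on \<Omega> \<and> is_weak_gradient \<Omega> u g)"

definition grad_inner :: "'a::euclidean_space set \<Rightarrow> ('a \<Rightarrow> real) \<Rightarrow> ('a \<Rightarrow> real) \<Rightarrow> real" where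
  "grad_inner \<Omega> u v = (\<integral>x. weak_grad \<Omega> u x \<bullet> weak_grad \<Omega> v x \<partial>lebesgue_on \<Omega>)"

definition norm_H1 :: "'a::euclidean_space set \<Rightarrow> ('a \<Rightarrow> real) \<Rightarrow> real" where
  "norm_H1 \<Omega> u =
     sqrt ((\<integral>x. (u x)\<^sup>2 \<partial>lebesgue_on \<Omega>) + (\<integral>x. (norm (weak_grad \<Omega> u x))\<^sup>2 \<partial>lebesgue_on \<Omega>))"

definition H10 :: "'a::euclidean_space set \<Rightarrow> ('a \<Rightarrow> real) set" where
  "H10 \<Omega> = {u \<in> H1 \<Omega>. \<exists>\<phi>. (\<forall>n. test_function \<Omega> (\<phi> n)) \<and>
                             (\<lambda>n. norm_H1 \<Omega> (u - \<phi> n)) \<longlonglongrightarrow> 0}"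

definition norm_H10 :: "'a::euclidean_space set \<Rightarrow> ('a \<Rightarrow> real) \<Rightarrow> real" where
  "norm_H10 \<Omega> u = sqrt (\<integral>x. (norm (weak_grad \<Omega> u x))\<^sup>2 \<partial>lebesgue_on \<Omega>)"

text \<open>The dual of \<open>H10 \<Omega>\<close>; functionals agreeing on \<open>H10 \<Omega>\<close> represent the same element.  The
  duality pairing of \<open>l\<close> and \<open>v\<close> is the application \<open>l v\<close>.\<close>

definition Hm1 :: "'a::euclidean_space set \<Rightarrow> (('a \<Rightarrow> real) \<Rightarrow> real) set" where
  "Hm1 \<Omega> = {l. (\<forall>v\<in>H10 \<Omega>. \<forall>w\<in>H10 \<Omega>. l (v + w) = l v + l w) \<and>
                (\<forall>v\<in>H10 \<Omega>. \<forall>r. l (r *\<^sub>R v) = r * l v) \<and>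
                (\<exists>C. \<forall>v\<in>H10 \<Omega>. \<bar>l v\<bar> \<le> C * norm_H10 \<Omega> v)}"

definition norm_Hm1 :: "'a::euclidean_space set \<Rightarrow> (('a \<Rightarrow> real) \<Rightarrow> real) \<Rightarrow> real" where
  "norm_Hm1 \<Omega> l = (SUP v \<in> {v \<in> H10 \<Omega>. norm_H10 \<Omega> v \<le> 1}. \<bar>l v\<bar>)"

text \<open>The embedding of \<open>H10 \<Omega>\<close> into its dual through the inner product of \<open>L\<^sup>2\<close>.\<close>

definition L2_embed :: "'a::euclidean_space set \<Rightarrow> ('a \<Rightarrow> real) \<Rightarrow> ('a \<Rightarrow> real) \<Rightarrow> real" where
  "L2_embed \<Omega> u = (\<lambda>v. \<integral>x. u x * v x \<partial>lebesgue_on \<Omega>)"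

definition weak_laplacian ::
    "'a::euclidean_space set \<Rightarrow> ('a \<Rightarrow> real) \<Rightarrow> ('a \<Rightarrow> real) \<Rightarrow> real" where
  "weak_laplacian \<Omega> u = (\<lambda>v. - grad_inner \<Omega> u v)"

text \<open>The library's Bochner integral lives on types of class \<open>real_normed_vector\<close>.  The spaces above
  depend on the set \<open>\<Omega>\<close>, so its definition is repeated for a subspace \<open>X\<close> of a real vector space
  with a seminorm \<open>N\<close> on \<open>X\<close>.  Measurability is strong (Bochner) measurability, and integrals
  are determined up to elements of seminorm zero.\<close>

definition strongly_measurable ::
    "'t measure \<Rightarrow> 'x::real_vector set \<Rightarrow> ('x \<Rightarrow> real) \<Rightarrow> ('t \<Rightarrow> 'x) \<Rightarrow> bool" where
  "strongly_measurable M X N f \<longleftrightarrow>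
     f \<in> space M \<rightarrow> X \<and>
     (\<exists>s. (\<forall>i. simple_function M (s i) \<and> s i \<in> space M \<rightarrow> X) \<and>
          (AE t in M. (\<lambda>i. N (f t - s i t)) \<longlonglongrightarrow> 0))"

definition bochner_integral_in ::
    "'t measure \<Rightarrow> 'x::real_vector set \<Rightarrow> ('x \<Rightarrow> real) \<Rightarrow> ('t \<Rightarrow> 'x) \<Rightarrow> 'x \<Rightarrow> bool" where
  "bochner_integral_in M X N f y \<longleftrightarrow>
     strongly_measurable M X N f \<and> y \<in> X \<and>
     (\<exists>s. (\<forall>i. Bochner_Integration.simple_bochner_integrable M (s i) \<and> s i \<in> space M \<rightarrow> X) \<and>
          (\<lambda>i. \<integral>\<^sup>+t. ennreal (N (f t - s i t)) \<partial>M) \<longlonglongrightarrow> 0 \<and>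
          (\<lambda>i. N (Bochner_Integration.simple_bochner_integral M (s i) - y)) \<longlonglongrightarrow> 0)"

definition bochner_L2 ::
    "real \<Rightarrow> 'x::real_vector set \<Rightarrow> ('x \<Rightarrow> real) \<Rightarrow> (real \<Rightarrow> 'x) set" where
  "bochner_L2 T X N =
     {f. strongly_measurable (lebesgue_on {0..T}) X N f \<and>
         integrable (lebesgue_on {0..T}) (\<lambda>t. (N (f t))\<^sup>2)}"

definition norm_bochner_L2 :: "real \<Rightarrow> ('x \<Rightarrow> real) \<Rightarrow> (real \<Rightarrow> 'x) \<Rightarrow> real" where
  "norm_bochner_L2 T N f = sqrt (\<integral>t. (N (f t))\<^sup>2 \<partial>lebesgue_on {0..T})"

definition is_weak_time_deriv ::
    "real \<Rightarrow> 'x::real_vector set \<Rightarrow> ('x \<Rightarrow> real) \<Rightarrow> (real \<Rightarrow> 'x) \<Rightarrow> (real \<Rightarrow> 'x) \<Rightarrow> bool" where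
  "is_weak_time_deriv T X N f g \<longleftrightarrow>
     (\<forall>\<phi>. test_function {0<..<T} \<phi> \<longrightarrow>
        (\<exists>y. bochner_integral_in (lebesgue_on {0..T}) X N (\<lambda>t. deriv \<phi> t *\<^sub>R f t) y \<and>
             bochner_integral_in (lebesgue_on {0..T}) X N (\<lambda>t. - \<phi> t *\<^sub>R g t) y))"

definition bochner_H2 ::
    "real \<Rightarrow> 'x::real_vector set \<Rightarrow> ('x \<Rightarrow> real) \<Rightarrow> (real \<Rightarrow> 'x) set" where
  "bochner_H2 T X N =
     {f \<in> bochner_L2 T X N. \<exists>g \<in> bochner_L2 T X N. \<exists>h \<in> bochner_L2 T X N.
        is_weak_time_deriv T X N f g \<and> is_weak_time_deriv T X N g h}"

definition time_deriv ::
    "real \<Rightarrow> 'x::real_vector set \<Rightarrow> ('x \<Rightarrow> real) \<Rightarrow> (real \<Rightarrow> 'x) \<Rightarrow> real \<Rightarrow> 'x" where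
  "time_deriv T X N f = (SOME g. g \<in> bochner_L2 T X N \<and> is_weak_time_deriv T X N f g)"

text \<open>Point values at time \<open>0\<close> are those of the continuous representative.\<close>

definition has_initial_value ::
    "real \<Rightarrow> 'x::real_vector set \<Rightarrow> ('x \<Rightarrow> real) \<Rightarrow> (real \<Rightarrow> 'x) \<Rightarrow> 'x \<Rightarrow> bool" where
  "has_initial_value T X N f x \<longleftrightarrow>
     (\<exists>w \<in> {0..T} \<rightarrow> X.
        (\<forall>t\<in>{0..T}. ((\<lambda>s. N (w s - w t)) \<longlongrightarrow> 0) (at t within {0..T})) \<and>
        (AE t in lebesgue_on {0..T}. N (f t - w t) = 0) \<and> N (w 0 - x) = 0)"

definition dt :: "'a::euclidean_space set \<Rightarrow> real \<Rightarrow> (real \<Rightarrow> 'a \<Rightarrow> real)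
    \<Rightarrow> real \<Rightarrow> ('a \<Rightarrow> real) \<Rightarrow> real" where
  "dt \<Omega> T u = time_deriv T (Hm1 \<Omega>) (norm_Hm1 \<Omega>) (\<lambda>t. L2_embed \<Omega> (u t))"

definition dtt :: "'a::euclidean_space set \<Rightarrow> real \<Rightarrow> (real \<Rightarrow> 'a \<Rightarrow> real)
    \<Rightarrow> real \<Rightarrow> ('a \<Rightarrow> real) \<Rightarrow> real" where
  "dtt \<Omega> T u = time_deriv T (Hm1 \<Omega>) (norm_Hm1 \<Omega>) (dt \<Omega> T u)"

definition trial_space :: "'a::euclidean_space set \<Rightarrow> real \<Rightarrow> (real \<Rightarrow> 'a \<Rightarrow> real) set" where
  "trial_space \<Omega> T =
     {u \<in> bochner_L2 T (H10 \<Omega>) (norm_H10 \<Omega>).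
        (\<lambda>t. L2_embed \<Omega> (u t)) \<in> bochner_H2 T (Hm1 \<Omega>) (norm_Hm1 \<Omega>) \<and>
        has_initial_value T (Hm1 \<Omega>) (norm_Hm1 \<Omega>) (\<lambda>t. L2_embed \<Omega> (u t)) 0 \<and>
        has_initial_value T (Hm1 \<Omega>) (norm_Hm1 \<Omega>) (dt \<Omega> T u) 0}"

definition test_space :: "'a::euclidean_space set \<Rightarrow> real \<Rightarrow> (real \<Rightarrow> 'a \<Rightarrow> real) set" where
  "test_space \<Omega> T = bochner_L2 T (H10 \<Omega>) (norm_H10 \<Omega>)"

definition norm_test :: "'a::euclidean_space set \<Rightarrow> real \<Rightarrow> (real \<Rightarrow> 'a \<Rightarrow> real) \<Rightarrow> real" where
  "norm_test \<Omega> T v = norm_bochner_L2 T (norm_H10 \<Omega>) v"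

definition norm_data ::
    "'a::euclidean_space set \<Rightarrow> real \<Rightarrow> (real \<Rightarrow> ('a \<Rightarrow> real) \<Rightarrow> real) \<Rightarrow> real" where
  "norm_data \<Omega> T f = norm_bochner_L2 T (norm_Hm1 \<Omega>) f"

definition norm_trial ::
    "'a::euclidean_space set \<Rightarrow> real \<Rightarrow> real \<Rightarrow> (real \<Rightarrow> 'a \<Rightarrow> real) \<Rightarrow> real" where
  "norm_trial \<Omega> T c u =
     sqrt ((norm_bochner_L2 T (norm_H10 \<Omega>) u)\<^sup>2
           + 1 / c ^ 4 * (norm_bochner_L2 T (norm_Hm1 \<Omega>) (dtt \<Omega> T u))\<^sup>2)"

text \<open>Being the zero element of \<open>L\<^sup>2(H\<^sup>1\<^sub>0)\<close>.\<close>

definition ae_zero :: "'a::euclidean_space set \<Rightarrow> real \<Rightarrow> (real \<Rightarrow> 'a \<Rightarrow> real) \<Rightarrow> bool" where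
  "ae_zero \<Omega> T u \<longleftrightarrow> (AE t in lebesgue_on {0..T}. AE x in lebesgue_on \<Omega>. u t x = 0)"

definition wave_form ::
    "'a::euclidean_space set \<Rightarrow> real \<Rightarrow> real \<Rightarrow> (real \<Rightarrow> 'a \<Rightarrow> real) \<Rightarrow> (real \<Rightarrow> 'a \<Rightarrow> real) \<Rightarrow> real"
  where
  "wave_form \<Omega> T c u v =
     (\<integral>t. (1 / c\<^sup>2 * dtt \<Omega> T u t (v t) + grad_inner \<Omega> (u t) (v t)) \<partial>lebesgue_on {0..T})"

definition wave_operator ::
    "'a::euclidean_space set \<Rightarrow> real \<Rightarrow> real \<Rightarrow> (real \<Rightarrow> 'a \<Rightarrow> real)
      \<Rightarrow> real \<Rightarrow> ('a \<Rightarrow> real) \<Rightarrow> real" where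
  "wave_operator \<Omega> T c u = (\<lambda>t. (1 / c\<^sup>2) *\<^sub>R dtt \<Omega> T u t - weak_laplacian \<Omega> (u t))"

text \<open>The wave operator is understood in the weak sense: it represents the bilinear form.\<close>

lemma wave_form_eq_pairing:
  "wave_form \<Omega> T c u v = (\<integral>t. wave_operator \<Omega> T c u t (v t) \<partial>lebesgue_on {0..T})"
  by (simp add: wave_form_def wave_operator_def weak_laplacian_def scaleR_fun_def)

end

(* The form fails to be inf-sup stable because of resonance.  Take u(t,x) = w(t) phi(x) with
   w(t) = t sin(omega t), omega = c k, and phi(x) = psi(x) sin(k x.e + alpha) for a bump function psi.
   Since w'' + omega^2 w = 2 omega cos(omega t), the terms of order k^2 in L u cancel:
     <L u, v> = (2 k / c) cos(omega t) (phi, v) + w(t) ((grad phi, grad v) - k^2 (phi, v)).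
   What remains is an oscillating function of size k, whose H^-1 norm is bounded uniformly in k
   because the factor k is absorbed by one integration by parts.  On the other hand
   the norm of u in L^2(H^1_0) grows like k, for a phase alpha chosen by pigeonhole from
   sin^2 + cos^2 = 1. Hence ||L u|| / ||u|| tends to 0.  The infimum is not negative because v and -v
   are both admissible. *)

theory Submission
  imports Defs
begin

text \<open>The factor t is dictated by the initial conditions: \<open>sin (\<omega> * t)\<close>
  alone solves the homogeneous equation but has initial velocity omega, whereas
  \<open>t * sin (\<omega> * t)\<close> starts with value and velocity 0. Choosing omega T as a
  multiple of 2 pi makes the boundary terms in its norm explicit, and the norm stays bounded below
  as omega grows. In space, phi is only an approximate eigenfunction localised in a ball. Its defect
  contains one factor k, and the same integration by parts keeps it bounded in the dual. The phase
  is selected after k, so all constants have to be uniform in both.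

  The obstacle behind much of the length is that \<open>weak_grad\<close>, \<open>dt\<close> and
  \<open>dtt\<close> are chosen representatives. Explicit derivatives can be identified with them
  only up to null sets, by the fundamental lemma of the calculus of variations. For values in the
  dual a single null set has to work for all arguments v at once, since the pairing evaluates at a v
  that moves with time.\<close>

section \<open>Smooth functions\<close>

text \<open>Powers of 1/s are built in because differentiating exp (-1/s) produces them: up to
  linear combinations the family indexed by \<open>m\<close> is closed under differentiation, so one
  derivative formula covers all orders.\<close>

definition flat :: "nat \<Rightarrow> real \<Rightarrow> real" where
  "flat m s = (if s > 0 then exp (- (1 / s)) / s ^ m else 0)"

text \<open>With y = 1/s the right-hand limit is that of y^m / exp y at infinity; to the left of 0
  the function vanishes.\<close>

lemma flat_tendsto_0: "(flat m \<longlongrightarrow> 0) (at 0)"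
proof -
  have "((\<lambda>x. (inverse x) ^ m / exp (inverse x)) \<longlongrightarrow> (0::real)) (at_right 0)"
    by (rule filterlim_compose[OF tendsto_power_div_exp_0 filterlim_inverse_at_top_right])
  moreover have "\<forall>\<^sub>F x in at_right 0. (inverse x) ^ m / exp (inverse x) = flat m (x::real)"
    unfolding eventually_at_right_field
    by (intro exI[of _ 1]) (auto simp: flat_def field_simps exp_minus inverse_eq_divide)
  ultimately have "(flat m \<longlongrightarrow> 0) (at_right 0)"
    by (rule Lim_transform_eventually)
  moreover have "(flat m \<longlongrightarrow> 0) (at_left 0)"
    by (rule tendsto_eventually, unfold eventually_at_left_field)
       (intro exI[of _ "-1"], auto simp: flat_def)
  ultimately show ?thesis
    by (simp add: filterlim_split_at)
qed

lemma flat_has_derivative: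
  "(flat m has_real_derivative flat (m + 2) s - real m * flat (m + 1) s) (at s)"
proof (cases s "0 :: real" rule: linorder_cases)
  case less
  have "((\<lambda>_. 0) has_real_derivative 0) (at s)" by simp
  then have "(flat m has_real_derivative 0) (at s)"
    by (rule has_field_derivative_transform_within_open[of _ _ _ "{..<0}"])
       (use less in \<open>auto simp: flat_def\<close>)
  then show ?thesis using less by (simp add: flat_def)
next
  case equal
  \<comment> \<open>At 0 the difference quotient is itself a member of the family,
    \<open>flat (Suc m)\<close>, so its limit is already known.\<close>
  have "((\<lambda>h. flat m h / h) \<longlongrightarrow> 0) (at 0)"
    by (rule Lim_transform_eventually[OF flat_tendsto_0[of "Suc m"]])
       (auto simp: flat_def eventually_at_filter field_simps)
  then show ?thesis
    using equal by (simp add: DERIV_def flat_def)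
next
  case greater
  have "((\<lambda>s. exp (- (1 / s)) / s ^ m) has_real_derivative
      exp (- (1 / s)) / s ^ (m + 2) - real m * (exp (- (1 / s)) / s ^ (m + 1))) (at s)"
  proof (induction m)
    case 0
    show ?case
      using greater by (auto intro!: derivative_eq_intros simp: field_simps power2_eq_square)
  next
    case (Suc m)
    have eq: "(\<lambda>s::real. exp (- (1 / s)) / s ^ Suc m) = (\<lambda>s. exp (- (1 / s)) / s ^ m / s)"
      by (simp add: mult.commute)
    show ?case
      unfolding eq
      by (rule DERIV_cong[OF DERIV_divide[OF Suc DERIV_ident]])
         (use greater in \<open>simp_all add: divide_simps\<close>, simp add: algebra_simps)
  qed
  then have "((\<lambda>s. exp (- (1 / s)) / s ^ m) has_real_derivative
      flat (m + 2) s - real m * flat (m + 1) s) (at s)"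
    using greater by (simp add: flat_def)
  then show ?thesis
    by (rule has_field_derivative_transform_within_open[of _ _ _ "{0<..}"])
       (use greater in \<open>auto simp: flat_def\<close>)
qed

text \<open>A class of functions closed under partial derivatives, large enough to contain bump functions
  and plane waves.\<close>

inductive_set elem_smooth :: "('a::euclidean_space \<Rightarrow> real) set" where
  const: "(\<lambda>x. c) \<in> elem_smooth"
| inner: "(\<lambda>x. x \<bullet> b) \<in> elem_smooth"
| add: "f \<in> elem_smooth \<Longrightarrow> g \<in> elem_smooth \<Longrightarrow> (\<lambda>x. f x + g x) \<in> elem_smooth"
| mult: "f \<in> elem_smooth \<Longrightarrow> g \<in> elem_smooth \<Longrightarrow> (\<lambda>x. f x * g x) \<in> elem_smooth"
| flat: "f \<in> elem_smooth \<Longrightarrow> (\<lambda>x. flat m (f x)) \<in> elem_smooth"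
| cos: "f \<in> elem_smooth \<Longrightarrow> (\<lambda>x. cos (f x)) \<in> elem_smooth"

lemma elem_smooth_minus: "f \<in> elem_smooth \<Longrightarrow> (\<lambda>x. - f x) \<in> elem_smooth"
  using elem_smooth.mult[OF elem_smooth.const[of "-1"]] by simp

lemma elem_smooth_diff:
  "f \<in> elem_smooth \<Longrightarrow> g \<in> elem_smooth \<Longrightarrow> (\<lambda>x. f x - g x) \<in> elem_smooth"
  using elem_smooth.add[OF _ elem_smooth_minus] by simp

lemma elem_smooth_sin:
  assumes "f \<in> elem_smooth" shows "(\<lambda>x. sin (f x)) \<in> elem_smooth"
  using elem_smooth.cos[OF elem_smooth_diff[OF elem_smooth.const[of "pi / 2"] assms]]
  by (simp add: sin_cos_eq)

lemma elem_smooth_power: "f \<in> elem_smooth \<Longrightarrow> (\<lambda>x. f x ^ n) \<in> elem_smooth"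
  by (induction n) (simp_all add: elem_smooth.const elem_smooth.mult)

lemma elem_smooth_prod:
  "finite I \<Longrightarrow> (\<And>i. i \<in> I \<Longrightarrow> f i \<in> elem_smooth) \<Longrightarrow> (\<lambda>x. \<Prod>i\<in>I. f i x) \<in> elem_smooth"
  by (induction rule: finite_induct) (simp_all add: elem_smooth.const elem_smooth.mult)

lemma elem_smooth_sum:
  "finite I \<Longrightarrow> (\<And>i. i \<in> I \<Longrightarrow> f i \<in> elem_smooth) \<Longrightarrow> (\<lambda>x. \<Sum>i\<in>I. f i x) \<in> elem_smooth"
  by (induction rule: finite_induct) (simp_all add: elem_smooth.const elem_smooth.add)

lemma elem_smooth_norm_squared: "(\<lambda>x. (x - a) \<bullet> (x - a)) \<in> elem_smooth"
proof -
  have "(\<lambda>x. (x \<bullet> b - a \<bullet> b) * (x \<bullet> b - a \<bullet> b)) \<in> elem_smooth" for b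
    by (intro elem_smooth.mult elem_smooth_diff elem_smooth.inner elem_smooth.const)
  then have "(\<lambda>x. \<Sum>b\<in>Basis. (x \<bullet> b - a \<bullet> b) * (x \<bullet> b - a \<bullet> b)) \<in> elem_smooth"
    by (intro elem_smooth_sum finite_Basis)
  then show ?thesis
    by (subst euclidean_inner) (simp add: inner_diff_left)
qed

text \<open>Iterated partials ask for derivatives of derivatives, so the induction carries
  membership of every directional derivative along with differentiability. A free \<open>D\<close>
  fits the sum, product and chain rules directly; \<open>elem_smooth_partial\<close> later
  identifies it with \<open>frechet_derivative\<close>.\<close>

lemma elem_smooth_has_derivative:
  assumes "f \<in> elem_smooth"
  shows "\<exists>D. (\<forall>x. (f has_derivative D x) (at x)) \<and> (\<forall>b. (\<lambda>x. D x b) \<in> elem_smooth)"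
  using assms
proof induction
  case (const c)
  show ?case by (rule exI[of _ "\<lambda>_ _. 0"]) (auto intro: elem_smooth.const)
next
  case (inner b)
  show ?case by (rule exI[of _ "\<lambda>_ y. y \<bullet> b"])
     (auto intro!: elem_smooth.const derivative_eq_intros)
next
  case (add f g)
  then obtain D E where "\<forall>x. (f has_derivative D x) (at x)" "\<forall>b. (\<lambda>x. D x b) \<in> elem_smooth"
     "\<forall>x. (g has_derivative E x) (at x)" "\<forall>b. (\<lambda>x. E x b) \<in> elem_smooth" by blast
  then show ?case
    by (intro exI[of _ "\<lambda>x y. D x y + E x y"]) (auto intro: elem_smooth.add has_derivative_add)
next
  case (mult f g)
  then obtain D E where "\<forall>x. (f has_derivative D x) (at x)" "\<forall>b. (\<lambda>x. D x b) \<in> elem_smooth"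
     "\<forall>x. (g has_derivative E x) (at x)" "\<forall>b. (\<lambda>x. E x b) \<in> elem_smooth" by blast
  then show ?case using mult.hyps
    by (intro exI[of _ "\<lambda>x y. f x * E x y + D x y * g x"])
       (auto intro!: elem_smooth.add elem_smooth.mult has_derivative_mult)
next
  case (flat f m)
  then obtain D where D: "\<forall>x. (f has_derivative D x) (at x)" "\<forall>b. (\<lambda>x. D x b) \<in> elem_smooth"
    by blast
  have "((\<lambda>x. flat m (f x)) has_derivative
      (\<lambda>y. (flat (m + 2) (f x) - real m * flat (m + 1) (f x)) * D x y)) (at x)" for x
    using has_derivative_compose[OF D(1)[rule_format]
        flat_has_derivative[unfolded has_field_derivative_def]] .
  moreover have "(\<lambda>x. (flat (m + 2) (f x) - real m * flat (m + 1) (f x)) * D x b) \<in> elem_smooth" for b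
    using D(2) flat.hyps
    by (intro elem_smooth.mult elem_smooth_diff elem_smooth.flat elem_smooth.const) auto
  ultimately show ?case
    by (intro exI[of _ "\<lambda>x y. (flat (m + 2) (f x) - real m * flat (m + 1) (f x)) * D x y"]) blast
next
  case (cos f)
  then obtain D where D: "\<forall>x. (f has_derivative D x) (at x)" "\<forall>b. (\<lambda>x. D x b) \<in> elem_smooth"
    by blast
  have "((\<lambda>x. cos (f x)) has_derivative (\<lambda>y. D x y * - sin (f x))) (at x)" for x
    using has_derivative_cos[OF D(1)[rule_format]] by (simp add: mult.commute)
  moreover have "(\<lambda>x. D x b * - sin (f x)) \<in> elem_smooth" for b
    using D(2) cos.hyps
    by (intro elem_smooth.mult elem_smooth_minus elem_smooth_sin) auto
  ultimately show ?case
    by (intro exI[of _ "\<lambda>x y. D x y * - sin (f x)"]) blast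
qed

lemma elem_smooth_differentiable: "f \<in> elem_smooth \<Longrightarrow> f differentiable (at x)"
  using elem_smooth_has_derivative unfolding differentiable_def by blast

lemma elem_smooth_partial:
  assumes "f \<in> elem_smooth"
  shows "(\<lambda>x. frechet_derivative f (at x) b) \<in> elem_smooth"
proof -
  obtain D where D: "\<And>x. (f has_derivative D x) (at x)" "\<And>b. (\<lambda>x. D x b) \<in> elem_smooth"
    using elem_smooth_has_derivative[OF assms] by blast
  then have "frechet_derivative f (at x) = D x" for x
    using frechet_derivative_at by metis
  then show ?thesis using D by simp
qed

lemma smooth_elem_smooth: "f \<in> elem_smooth \<Longrightarrow> smooth f"
proof -
  assume f: "f \<in> elem_smooth"
  have "iterated_partial es f \<in> elem_smooth" for es
    by (induction es) (simp_all add: f elem_smooth_partial)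
  then show ?thesis
    by (simp add: smooth_def elem_smooth_differentiable)
qed

text \<open>The classical mollifier, exp (-1 / (r^2 - |x - a|^2)) inside the ball.
  \<open>flat 0\<close> supplies the value 0 outside, and the squared norm keeps it in
  \<open>elem_smooth\<close>.\<close>

definition bump :: "'a::euclidean_space \<Rightarrow> real \<Rightarrow> 'a \<Rightarrow> real" where
  "bump a r x = flat 0 (r\<^sup>2 - (x - a) \<bullet> (x - a))"

lemma bump_elem_smooth: "bump a r \<in> elem_smooth"
  unfolding bump_def
  by (intro elem_smooth.flat elem_smooth_diff elem_smooth_norm_squared elem_smooth.const)

lemma bump_nonneg: "0 \<le> bump a r x" and bump_le_1: "bump a r x \<le> 1"
  by (auto simp: bump_def flat_def)

lemma bump_pos_iff: "r > 0 \<Longrightarrow> 0 < bump a r x \<longleftrightarrow> x \<in> ball a r"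
  using norm_lt_square[of "x - a" r] by (simp add: bump_def flat_def dist_norm norm_minus_commute)

lemma smooth_partial:
  assumes "smooth f" "b \<in> Basis"
  shows "smooth (\<lambda>x. frechet_derivative f (at x) b)"
proof -
  \<comment> \<open>The head of the list is the outermost derivative, so the one taken first belongs
    at the end.\<close>
  have "iterated_partial es (\<lambda>x. frechet_derivative f (at x) b) = iterated_partial (es @ [b]) f" for es
    by (induction es) auto
  then show ?thesis using assms by (simp add: smooth_def)
qed

lemma smooth_differentiable: "smooth f \<Longrightarrow> f differentiable (at x)"
  unfolding smooth_def by (metis empty_set empty_subsetI iterated_partial.simps(1))

lemma smooth_scaleR:
  assumes "smooth f" shows "smooth (r *\<^sub>R f)"
proof -
  have *: "iterated_partial es (\<lambda>x. r * f x) = (\<lambda>x. r * iterated_partial es f x)"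
    if "set es \<subseteq> Basis" for es
    using that
  proof (induction es)
    case (Cons e es)
    then have "iterated_partial es f differentiable (at x)" for x
      using assms by (auto simp: smooth_def)
    then have "((\<lambda>x. r * iterated_partial es f x) has_derivative
        (\<lambda>y. r * frechet_derivative (iterated_partial es f) (at x) y)) (at x)" for x
      by (intro has_derivative_mult_right) (simp add: frechet_derivative_works)
    from frechet_derivative_at[OF this]
    have "frechet_derivative (\<lambda>x. r * iterated_partial es f x) (at x) e
        = r * frechet_derivative (iterated_partial es f) (at x) e" for x
      by metis
    moreover have "iterated_partial es (\<lambda>x. r * f x) = (\<lambda>x. r * iterated_partial es f x)"
      using Cons by simp
    ultimately show ?case by simp
  qed auto
  show ?thesis
    using assms by (auto simp: smooth_def scaleR_fun_def * intro!: differentiable_mult)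
qed

section \<open>Test functions\<close>

lemma test_function_differentiable: "test_function \<Omega> \<phi> \<Longrightarrow> \<phi> differentiable (at x)"
  by (simp add: test_function_def smooth_differentiable)

lemma test_function_has_derivative:
  "test_function \<Omega> \<phi> \<Longrightarrow> (\<phi> has_derivative frechet_derivative \<phi> (at x)) (at x)"
  using test_function_differentiable frechet_derivative_works by blast

lemma test_function_eq_0_outside_support: "x \<notin> closure {x. \<phi> x \<noteq> 0} \<Longrightarrow> \<phi> x = 0"
  using closure_subset[of "{x. \<phi> x \<noteq> 0}"] by auto

lemma test_function_eq_0: "test_function \<Omega> \<phi> \<Longrightarrow> x \<notin> \<Omega> \<Longrightarrow> \<phi> x = 0"
  using test_function_eq_0_outside_support[of x \<phi>] by (auto simp: test_function_def)

lemma test_function_continuous: "test_function \<Omega> \<phi> \<Longrightarrow> continuous_on S \<phi>"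
  by (meson continuous_at_imp_continuous_on has_derivative_continuous test_function_has_derivative)

text \<open>Any compact \<open>K\<close> outside which the function vanishes will do, so the support
  never has to be computed.\<close>

lemma test_functionI:
  assumes "smooth \<phi>" "compact K" "K \<subseteq> \<Omega>" "\<And>x. x \<notin> K \<Longrightarrow> \<phi> x = 0"
  shows "test_function \<Omega> \<phi>"
proof -
  have "closure {x. \<phi> x \<noteq> 0} \<subseteq> K"
    using assms by (intro closure_minimal) (auto intro: compact_imp_closed)
  moreover from this have "compact (closure {x. \<phi> x \<noteq> 0})"
    using assms(2) by (meson bounded_subset closed_closure compact_eq_bounded_closed)
  ultimately show ?thesis using assms by (auto simp: test_function_def)
qed

text \<open>The complement of the closed support is open, so there the function agrees with 0 near
  x.\<close>

lemma test_function_partial_support: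
  assumes "x \<notin> closure {x. \<phi> x \<noteq> 0}"
  shows "frechet_derivative \<phi> (at x) = (\<lambda>_. 0)"
proof -
  have "((\<lambda>_. 0) has_derivative (\<lambda>_. 0)) (at x)" by simp
  then have "(\<phi> has_derivative (\<lambda>_. 0)) (at x)"
  proof (rule has_derivative_transform_within_open[of _ _ _ _ "- closure {x. \<phi> x \<noteq> 0}"])
    show "0 = \<phi> y" if "y \<in> - closure {x. \<phi> x \<noteq> 0}" for y
      using test_function_eq_0_outside_support[of y \<phi>] that by (metis ComplD)
  qed (use assms in auto)
  then show ?thesis by (metis frechet_derivative_at)
qed

lemma test_function_partial:
  assumes "test_function \<Omega> \<phi>" "b \<in> Basis"
  shows "test_function \<Omega> (\<lambda>x. frechet_derivative \<phi> (at x) b)"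
proof (rule test_functionI)
  show "smooth (\<lambda>x. frechet_derivative \<phi> (at x) b)"
    using assms by (auto simp: test_function_def intro: smooth_partial)
  show "frechet_derivative \<phi> (at x) b = 0" if "x \<notin> closure {x. \<phi> x \<noteq> 0}" for x
    using test_function_partial_support[OF that] by simp
qed (use assms in \<open>auto simp: test_function_def\<close>)

lemma test_function_scaleR:
  assumes "test_function \<Omega> \<phi>" shows "test_function \<Omega> (r *\<^sub>R \<phi>)"
proof (rule test_functionI)
  show "smooth (r *\<^sub>R \<phi>)"
    using assms by (auto simp: test_function_def intro: smooth_scaleR)
  show "(r *\<^sub>R \<phi>) x = 0" if "x \<notin> closure {x. \<phi> x \<noteq> 0}" for x
    using test_function_eq_0_outside_support[OF that] by (simp add: scaleR_fun_def)
qed (use assms in \<open>auto simp: test_function_def\<close>)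

lemma test_function_bounded:
  assumes "test_function \<Omega> \<phi>"
  shows "\<exists>B\<ge>0. \<forall>x. \<bar>\<phi> x\<bar> \<le> B"
proof -
  let ?K = "closure {x. \<phi> x \<noteq> 0}"
  have "compact (\<phi> ` ?K)"
    using assms by (intro compact_continuous_image test_function_continuous) (auto simp: test_function_def)
  then obtain B where B: "\<And>x. x \<in> ?K \<Longrightarrow> \<bar>\<phi> x\<bar> \<le> B"
    by (meson bounded_real compact_imp_bounded imageI)
  have "\<bar>\<phi> x\<bar> \<le> max B 0" for x
  proof (cases "\<phi> x = 0")
    case False
    then have "x \<in> ?K" using test_function_eq_0_outside_support by blast
    from B[OF this] show ?thesis by simp
  qed auto
  then show ?thesis by (intro exI[of _ "max B 0"]) auto
qed

lemma test_function_borel: "test_function \<Omega> \<phi> \<Longrightarrow> \<phi> \<in> borel_measurable borel"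
  by (simp add: borel_measurable_continuous_onI test_function_continuous)

lemma test_function_mono: "test_function U \<phi> \<Longrightarrow> U \<subseteq> V \<Longrightarrow> test_function V \<phi>"
  by (auto simp: test_function_def)

section \<open>Approximation of indicators of open sets by test functions\<close>

text \<open>If the bumps \<open>\<beta>\<^sub>i\<close> are positive exactly on balls covering \<open>U\<close>, then
  \<open>1 - (\<Prod>i<n. 1 - \<beta>\<^sub>i)\<^sup>n\<close> converges to the indicator of \<open>U\<close>.\<close>

lemma indicator_open_approx:
  fixes U :: "'a::euclidean_space set"
  assumes "open U"
  shows "\<exists>f. (\<forall>n. test_function U (f n)) \<and> (\<forall>n x. f n x \<in> {0..1}) \<and>
             (\<forall>x. (\<lambda>n. f n x) \<longlonglongrightarrow> (indicator U x :: real))"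
proof (cases "U = {}")
  case True
  have "test_function U (\<lambda>_. 0)"
    by (rule test_functionI[of _ "{}"]) (auto intro: smooth_elem_smooth elem_smooth.const)
  then show ?thesis using True by (intro exI[of _ "\<lambda>_ _. 0"]) auto
next
  case False
  define P where "P = {(a, r). 0 < r \<and> cball a r \<subseteq> U}"
  define B where "B = (\<lambda>(a, r). ball a r :: 'a set)"
  have cover: "x \<in> \<Union>(B ` P)" if "x \<in> U" for x
  proof -
    obtain r where "r > 0" "cball x r \<subseteq> U"
      using \<open>x \<in> U\<close> assms open_contains_cball by blast
    then have "(x, r) \<in> P" "x \<in> B (x, r)" by (auto simp: P_def B_def)
    then show ?thesis by blast
  qed
  have "\<And>S. S \<in> B ` P \<Longrightarrow> open S" by (auto simp: B_def)
  \<comment> \<open>Lindelof leaves countably many balls, so that they can be listed as a sequence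
    \<open>q\<close>.\<close>
  then obtain F where F: "F \<subseteq> B ` P" "countable F" "\<Union>F = \<Union>(B ` P)"
    using Lindelof[of "B ` P"] by metis
  then obtain Q where Q: "countable Q" "Q \<subseteq> P" "F = B ` Q"
    using countable_subset_image[of F B P] by auto
  have U_Q: "U \<subseteq> \<Union>(B ` Q)" using cover F Q by auto
  then have "Q \<noteq> {}" using False by auto
  define q where "q = from_nat_into Q"
  have q: "range q = Q" using \<open>Q \<noteq> {}\<close> Q by (simp add: q_def range_from_nat_into)
  then have qP: "q i \<in> P" for i using Q by auto
  define \<beta> where "\<beta> i = bump (fst (q i)) (snd (q i))" for i
  have \<beta>01: "0 \<le> \<beta> i x" "\<beta> i x \<le> 1" for i x
    by (simp_all add: \<beta>_def bump_nonneg bump_le_1)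
  have \<beta>_pos: "0 < \<beta> i x \<longleftrightarrow> x \<in> B (q i)" for i x
    using qP[of i] by (auto simp: \<beta>_def P_def B_def bump_pos_iff split_beta)
  \<comment> \<open>The finite product keeps the support inside finitely many closed balls; the
    exponent \<open>n\<close> drives a value below 1 down to 0.\<close>
  define f where "f n x = 1 - (\<Prod>i<n. 1 - \<beta> i x) ^ n" for n x
  have p01: "0 \<le> (\<Prod>i<n. 1 - \<beta> i x)" "(\<Prod>i<n. 1 - \<beta> i x) \<le> 1" for n x
    using \<beta>01 by (auto intro: prod_nonneg prod_le_1)
  have "test_function U (f n)" for n
  proof (rule test_functionI)
    show "smooth (f n)"
      unfolding f_def \<beta>_def
      by (intro smooth_elem_smooth elem_smooth_diff elem_smooth_power elem_smooth_prod
          elem_smooth.const bump_elem_smooth) auto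
    show "compact (\<Union>i<n. cball (fst (q i)) (snd (q i)))"
      by (intro compact_UN) auto
    show "(\<Union>i<n. cball (fst (q i)) (snd (q i))) \<subseteq> U"
      using qP by (fastforce simp: P_def split_beta)
    show "f n x = 0" if "x \<notin> (\<Union>i<n. cball (fst (q i)) (snd (q i)))" for x
    proof -
      have "\<beta> i x = 0" if "i < n" for i
      proof -
        have "x \<notin> B (q i)" using \<open>x \<notin> _\<close> that by (fastforce simp: B_def split_beta)
        with \<beta>_pos[of i x] \<beta>01(1)[of i x] show ?thesis by simp
      qed
      then show ?thesis by (simp add: f_def)
    qed
  qed
  moreover have "f n x \<in> {0..1}" for n x
    using p01 by (simp add: f_def power_le_one)
  moreover have "(\<lambda>n. f n x) \<longlonglongrightarrow> indicator U x" for x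
  proof (cases "x \<in> U")
    case True
    then obtain j where j: "0 < \<beta> j x" using U_Q q \<beta>_pos by auto
    have "(\<lambda>n. (1 - \<beta> j x) ^ n) \<longlonglongrightarrow> 0"
      using j \<beta>01[of j x] by (intro LIMSEQ_realpow_zero) auto
    moreover have "\<forall>\<^sub>F n in sequentially. norm ((\<Prod>i<n. 1 - \<beta> i x) ^ n) \<le> (1 - \<beta> j x) ^ n"
      using eventually_gt_at_top[of j]
    proof eventually_elim
      case (elim n)
      \<comment> \<open>Once n exceeds j, the single factor with index j bounds the product; the
        remaining factors are at most 1.\<close>
      have "(\<Prod>i<n. 1 - \<beta> i x) = (1 - \<beta> j x) * (\<Prod>i\<in>{..<n} - {j}. 1 - \<beta> i x)"
        using elim by (intro prod.remove) auto
      also have "\<dots> \<le> (1 - \<beta> j x) * 1"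
        using \<beta>01 by (intro mult_left_mono prod_le_1) auto
      finally show ?case using p01 by (auto intro!: power_mono)
    qed
    ultimately have "(\<lambda>n. (\<Prod>i<n. 1 - \<beta> i x) ^ n) \<longlonglongrightarrow> 0"
      by (rule Lim_null_comparison[rotated])
    from tendsto_diff[OF tendsto_const[of 1] this] show ?thesis
      using True by (simp add: f_def)
  next
    case False
    have "\<beta> i x = 0" for i
    proof -
      have "x \<notin> B (q i)" using False qP[of i]
        by (auto simp: B_def P_def split_beta subset_iff)
      with \<beta>_pos[of i x] \<beta>01(1)[of i x] show ?thesis by simp
    qed
    then show ?thesis using False by (simp add: f_def)
  qed
  ultimately show ?thesis by blast
qed

section \<open>Fundamental lemma of the calculus of variations\<close>

context
  fixes S \<Omega> :: "'a::euclidean_space set" and g :: "'a \<Rightarrow> real"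
  assumes S: "S \<in> sets lebesgue" and \<Omega>: "open \<Omega>" "\<Omega> \<subseteq> S"
    and g: "integrable (lebesgue_on S) g"
    and ortho: "\<And>\<phi>. test_function \<Omega> \<phi> \<Longrightarrow> (\<integral>x. g x * \<phi> x \<partial>lebesgue_on S) = 0"
begin

text \<open>Test functions with values in [0, 1] converge to the indicator of U, so orthogonality
  passes to the limit with |g| as majorant.\<close>

private lemma ortho_open:
  assumes "open U" "U \<subseteq> \<Omega>"
  shows "(\<integral>x. g x * indicator U x \<partial>lebesgue_on S) = 0"
proof -
  obtain f where f: "\<And>n. test_function U (f n)" "\<And>n x. f n x \<in> {0..1}"
    "\<And>x. (\<lambda>n. f n x) \<longlonglongrightarrow> (indicator U x :: real)"
    using indicator_open_approx[OF assms(1)] by metis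
  have [measurable]: "f n \<in> borel_measurable (lebesgue_on S)" for n
    using test_function_borel[OF f(1)] by (intro measurable_restrict_space1 measurable_completion) simp
  have [measurable]: "U \<in> sets (lebesgue_on S)"
    using assms \<Omega> S by (auto simp: sets_restrict_space_iff)
  have [measurable]: "g \<in> borel_measurable (lebesgue_on S)" using g by simp
  have "(\<lambda>n. \<integral>x. g x * f n x \<partial>lebesgue_on S) \<longlonglongrightarrow> (\<integral>x. g x * indicator U x \<partial>lebesgue_on S)"
  proof (rule integral_dominated_convergence[where w = "\<lambda>x. norm (g x)"])
    show "AE x in lebesgue_on S. (\<lambda>n. g x * f n x) \<longlonglongrightarrow> g x * indicator U x"
      by (intro AE_I2 tendsto_mult f tendsto_const)
    have "\<bar>f n x\<bar> \<le> 1" for n x using f(2)[of n x] by auto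
    then show "AE x in lebesgue_on S. norm (g x * f n x) \<le> norm (g x)" for n
      by (auto simp: abs_mult intro!: mult_right_le_one_le)
  qed (use g in auto)
  moreover have "(\<integral>x. g x * f n x \<partial>lebesgue_on S) = 0" for n
    by (rule ortho[OF test_function_mono[OF f(1) assms(2)]])
  ultimately show ?thesis by (simp add: LIMSEQ_const_iff)
qed

text \<open>Outer regularity gives open sets that shrink to A up to a null set, so the open case
  passes to the limit.\<close>

private lemma ortho_measurable:
  assumes A: "A \<in> sets lebesgue" "A \<subseteq> \<Omega>"
  shows "(\<integral>x. g x * indicator A x \<partial>lebesgue_on S) = 0"
proof -
  have "\<exists>T. open T \<and> A \<subseteq> T \<and> T - A \<in> lmeasurable \<and> emeasure lebesgue (T - A) < ennreal (inverse (real (Suc n)))" for n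
    by (rule sets_lebesgue_outer_open[OF A(1), of "inverse (real (Suc n))"]) auto
  then obtain T where T: "\<And>n. open (T n)" "\<And>n. A \<subseteq> T n" "\<And>n. T n - A \<in> lmeasurable"
    "\<And>n. emeasure lebesgue (T n - A) < ennreal (inverse (real (Suc n)))" by metis
  \<comment> \<open>Finite intersections make the sequence decreasing, so a point that has left it
    stays out; cutting with \<open>\<Omega>\<close> makes \<open>ortho_open\<close>
    applicable.\<close>
  define V where "V n = \<Omega> \<inter> (\<Inter>i\<le>n. T i)" for n
  have V: "open (V n)" "V n \<subseteq> \<Omega>" "A \<subseteq> V n" for n
    using T \<Omega> A by (auto simp: V_def)
  define N where "N = (\<Inter>n. V n) - A"
  have N_null: "N \<in> null_sets lebesgue"
  proof (rule null_setsI)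
    show N: "N \<in> sets lebesgue"
      unfolding N_def using V A by (intro sets.Diff sets.countable_INT) auto
    have "emeasure lebesgue N \<le> ennreal (inverse (real (Suc n)))" for n
    proof -
      have "N \<subseteq> T n - A" by (auto simp: N_def V_def)
      then have "emeasure lebesgue N \<le> emeasure lebesgue (T n - A)"
        using T(3)[of n] by (intro emeasure_mono) (auto dest: fmeasurableD)
      then show ?thesis using T(4)[of n] by auto
    qed
    moreover have "(\<lambda>n. ennreal (inverse (real (Suc n)))) \<longlonglongrightarrow> ennreal 0"
      by (intro tendsto_ennrealI LIMSEQ_inverse_real_of_nat)
    ultimately have "emeasure lebesgue N \<le> ennreal 0"
      by (intro LIMSEQ_le_const[of _ _ "emeasure lebesgue N"]) auto
    then show "emeasure lebesgue N = 0" by simp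
  qed
  have [measurable]: "V n \<in> sets (lebesgue_on S)" "A \<in> sets (lebesgue_on S)" for n
    using V[of n] \<Omega> S A by (auto simp: sets_restrict_space_iff)
  have [measurable]: "g \<in> borel_measurable (lebesgue_on S)" using g by simp
  have "(\<lambda>n. \<integral>x. g x * indicator (V n) x \<partial>lebesgue_on S) \<longlonglongrightarrow> (\<integral>x. g x * indicator A x \<partial>lebesgue_on S)"
  proof (rule integral_dominated_convergence[where w = "\<lambda>x. norm (g x)"])
    have "AE x in lebesgue. x \<notin> N" by (rule AE_not_in[OF N_null])
    then have "AE x in lebesgue_on S. x \<notin> N"
      using S by (auto simp: AE_restrict_space_iff)
    then show "AE x in lebesgue_on S. (\<lambda>n. g x * indicator (V n) x) \<longlonglongrightarrow> g x * indicator A x"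
    proof eventually_elim
      case (elim x)
      show ?case
      proof (cases "x \<in> A")
        case True
        then show ?thesis using V(3) by (auto simp: indicator_def subset_iff)
      next
        case False
        then obtain m where "x \<notin> V m" using elim by (auto simp: N_def)
        then have "\<forall>\<^sub>F n in sequentially. g x * indicator A x = g x * indicator (V n) x"
          using False by (intro eventually_sequentiallyI[of m]) (auto simp: V_def indicator_def)
        then show ?thesis by (rule Lim_transform_eventually[OF tendsto_const])
      qed
    qed
    show "AE x in lebesgue_on S. norm (g x * indicator (V n) x) \<le> norm (g x)" for n
      by (auto simp: indicator_def)
  qed (use g in auto)
  then show ?thesis
    using ortho_open[OF V(1,2)] by (simp add: LIMSEQ_const_iff)
qed

text \<open>Testing with the sets where g is positive or negative gives nonnegative functions with
  integral 0. \<open>S\<close> and \<open>\<Omega>\<close> are kept apart for the time variable,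
  where integrals run over \<open>{0..T}\<close> but test functions live on
  \<open>{0<..<T}\<close>.\<close>

lemma fundamental_lemma_AE: "AE x in lebesgue_on S. x \<in> \<Omega> \<longrightarrow> g x = 0"
proof -
  have [measurable]: "g \<in> borel_measurable (lebesgue_on S)" using g by simp
  have \<Omega>_sets[measurable]: "\<Omega> \<in> sets (lebesgue_on S)"
    using \<Omega> S by (auto simp: sets_restrict_space_iff)
  have *: "AE x in lebesgue_on S. x \<in> \<Omega> \<longrightarrow> 0 < s * g x \<longrightarrow> False" if s: "s = 1 \<or> s = - 1" for s :: real
  proof -
    define A where "A = {x \<in> space (lebesgue_on S). x \<in> \<Omega> \<and> 0 < s * g x}"
    have A_on[measurable]: "A \<in> sets (lebesgue_on S)" unfolding A_def by measurable
    have A: "A \<in> sets lebesgue" "A \<subseteq> \<Omega>"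
      using A_on S by (auto simp: sets_restrict_space_iff A_def)
    have int: "integrable (lebesgue_on S) (\<lambda>x. s * (g x * indicator A x))"
      using integrable_mult_indicator[OF A_on g] by (auto simp: mult.commute)
    have "AE x in lebesgue_on S. s * (g x * indicator A x) = 0"
      using ortho_measurable[OF A]
      by (subst integral_nonneg_eq_0_iff_AE[OF int, symmetric]) (auto simp: A_def indicator_def)
    with AE_space show ?thesis
      by eventually_elim (use s in \<open>auto simp: A_def indicator_def\<close>)
  qed
  have "AE x in lebesgue_on S. x \<in> \<Omega> \<longrightarrow> 0 < 1 * g x \<longrightarrow> False"
    "AE x in lebesgue_on S. x \<in> \<Omega> \<longrightarrow> 0 < - 1 * g x \<longrightarrow> False"
    by (rule *; simp)+
  then show ?thesis by eventually_elim auto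
qed

end

section \<open>Square integrable functions\<close>

text \<open>An arbitrary measure is allowed so that the same estimates serve integrals over
  \<open>\<Omega>\<close> and over the time interval.\<close>

definition square_integrable :: "'x measure \<Rightarrow> ('x \<Rightarrow> 'b::euclidean_space) \<Rightarrow> bool" where
  "square_integrable M f \<longleftrightarrow> f \<in> borel_measurable M \<and> integrable M (\<lambda>x. (norm (f x))\<^sup>2)"

definition L2_norm :: "'x measure \<Rightarrow> ('x \<Rightarrow> 'b::euclidean_space) \<Rightarrow> real" where
  "L2_norm M f = sqrt (\<integral>x. (norm (f x))\<^sup>2 \<partial>M)"

lemma square_integrable_on_iff: "f square_integrable_on \<Omega> \<longleftrightarrow> square_integrable (lebesgue_on \<Omega>) f"
  by (simp add: square_integrable_on_def square_integrable_def)

lemma L2_norm_nonneg: "0 \<le> L2_norm M f"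
  by (simp add: L2_norm_def)

lemma L2_norm_squared: "(L2_norm M f)\<^sup>2 = (\<integral>x. (norm (f x))\<^sup>2 \<partial>M)"
  by (simp add: L2_norm_def)

lemma square_integrable_inner:
  assumes "square_integrable M f" "square_integrable M g"
  shows "integrable M (\<lambda>x. f x \<bullet> g x)"
proof (rule Bochner_Integration.integrable_bound)
  show "integrable M (\<lambda>x. (norm (f x))\<^sup>2 + (norm (g x))\<^sup>2)"
    using assms by (auto simp: square_integrable_def)
  show "(\<lambda>x. f x \<bullet> g x) \<in> borel_measurable M"
    using assms by (auto simp: square_integrable_def)
  have "\<bar>f x \<bullet> g x\<bar> \<le> (norm (f x))\<^sup>2 + (norm (g x))\<^sup>2" for x
  proof -
    have "\<bar>f x \<bullet> g x\<bar> \<le> norm (f x) * norm (g x)" by (rule Cauchy_Schwarz_ineq2)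
    also have "\<dots> \<le> (norm (f x))\<^sup>2 + (norm (g x))\<^sup>2"
      using sum_squares_bound[of "norm (f x)" "norm (g x)"]
        mult_nonneg_nonneg[OF norm_ge_zero[of "f x"] norm_ge_zero[of "g x"]] by linarith
    finally show ?thesis .
  qed
  then show "AE x in M. norm (f x \<bullet> g x) \<le> norm ((norm (f x))\<^sup>2 + (norm (g x))\<^sup>2)" by simp
qed

text \<open>For positive A and B the right-hand side is minimal at s = B / A, with value 2 A B. If A
  or B is 0, s is sent to infinity or to 0 instead.\<close>

lemma le_mult_if_le_scaled_squares:
  fixes X A B :: real
  assumes "A \<ge> 0" "B \<ge> 0" "\<And>s. s > 0 \<Longrightarrow> 2 * X \<le> s * A\<^sup>2 + B\<^sup>2 / s"
  shows "X \<le> A * B"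
proof (cases "A > 0 \<and> B > 0")
  case True
  then show ?thesis using assms(3)[of "B / A"] by (simp add: power2_eq_square)
next
  case False
  have "X \<le> e" if "e > 0" for e
  proof -
    consider "A = 0" | "B = 0" using False assms by linarith
    then show ?thesis
    proof cases
      case 1
      \<comment> \<open>The choice is a large s = B^2 / e + 1; the summand 1 keeps s positive when B
        = 0 as well.\<close>
      have "B\<^sup>2 / (B\<^sup>2 / e + 1) \<le> e"
        using that by (simp add: divide_simps add_nonneg_pos)
      moreover have "2 * X \<le> B\<^sup>2 / (B\<^sup>2 / e + 1)"
        using assms(3)[of "B\<^sup>2 / e + 1"] 1 that by (simp add: add_nonneg_pos)
      ultimately show ?thesis using that by linarith
    next
      case 2
      have "e / (A\<^sup>2 + 1) * A\<^sup>2 \<le> e"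
        using that by (simp add: divide_simps add_nonneg_pos)
      moreover have "2 * X \<le> e / (A\<^sup>2 + 1) * A\<^sup>2"
        using assms(3)[of "e / (A\<^sup>2 + 1)"] 2 that by (simp add: add_nonneg_pos)
      ultimately show ?thesis using that by linarith
    qed
  qed
  then have "X \<le> 0" by (rule field_le_epsilon[of X 0, simplified])
  then show ?thesis using assms by (meson mult_nonneg_nonneg order_trans)
qed

text \<open>The weighted inequality 2 |f| |g| <= r |f|^2 + |g|^2 / r is integrated for fixed r, and
  r is optimised only afterwards. The sign s yields the absolute value.\<close>

lemma L2_Cauchy_Schwarz:
  assumes f: "square_integrable M f" and g: "square_integrable M g"
  shows "\<bar>\<integral>x. f x \<bullet> g x \<partial>M\<bar> \<le> L2_norm M f * L2_norm M g"
proof -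
  have "s * (\<integral>x. f x \<bullet> g x \<partial>M) \<le> L2_norm M f * L2_norm M g" if s: "s = 1 \<or> s = - 1" for s
  proof (rule le_mult_if_le_scaled_squares)
    fix r :: real assume r: "r > 0"
    have "2 * (s * (\<integral>x. f x \<bullet> g x \<partial>M)) = (\<integral>x. 2 * s * (f x \<bullet> g x) \<partial>M)" by simp
    also have "\<dots> \<le> (\<integral>x. r * (norm (f x))\<^sup>2 + (norm (g x))\<^sup>2 / r \<partial>M)"
    proof (rule integral_mono)
      show "integrable M (\<lambda>x. 2 * s * (f x \<bullet> g x))"
        using square_integrable_inner[OF f g] by simp
      show "integrable M (\<lambda>x. r * (norm (f x))\<^sup>2 + (norm (g x))\<^sup>2 / r)"
        using f g by (auto simp: square_integrable_def)
      fix x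
      have "2 * s * (f x \<bullet> g x) \<le> 2 * (norm (f x) * norm (g x))"
        using s Cauchy_Schwarz_ineq2[of "f x" "g x"] by auto
      also have "\<dots> = 2 * (sqrt r * norm (f x)) * (norm (g x) / sqrt r)"
        using r by simp
      also have "\<dots> \<le> (sqrt r * norm (f x))\<^sup>2 + (norm (g x) / sqrt r)\<^sup>2"
        by (rule sum_squares_bound)
      also have "\<dots> = r * (norm (f x))\<^sup>2 + (norm (g x))\<^sup>2 / r"
        using r by (simp add: power_mult_distrib power_divide)
      finally show "2 * s * (f x \<bullet> g x) \<le> r * (norm (f x))\<^sup>2 + (norm (g x))\<^sup>2 / r" .
    qed
    also have "\<dots> = r * (L2_norm M f)\<^sup>2 + (L2_norm M g)\<^sup>2 / r"
      using f g by (simp add: square_integrable_def L2_norm_squared)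
    finally show "2 * (s * (\<integral>x. f x \<bullet> g x \<partial>M)) \<le> r * (L2_norm M f)\<^sup>2 + (L2_norm M g)\<^sup>2 / r" .
  qed (auto simp: L2_norm_nonneg)
  from this[of 1] this[of "-1"] show ?thesis by auto
qed

lemma square_integrable_bound:
  assumes "square_integrable M g" "f \<in> borel_measurable M" "\<And>x. x \<in> space M \<Longrightarrow> norm (f x) \<le> norm (g x)"
  shows "square_integrable M f"
  unfolding square_integrable_def
proof
  show "integrable M (\<lambda>x. (norm (f x))\<^sup>2)"
    by (rule Bochner_Integration.integrable_bound[of M "\<lambda>x. (norm (g x))\<^sup>2"])
       (use assms in \<open>auto simp: square_integrable_def intro!: power_mono\<close>)
qed fact

lemma L2_norm_mono:
  assumes "square_integrable M g" "square_integrable M f"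
    "\<And>x. x \<in> space M \<Longrightarrow> norm (f x) \<le> norm (g x)"
  shows "L2_norm M f \<le> L2_norm M g"
  unfolding L2_norm_def
  by (intro real_sqrt_le_mono integral_mono) (use assms in \<open>auto simp: square_integrable_def intro!: power_mono\<close>)

lemma square_integrable_scaleR:
  "square_integrable M f \<Longrightarrow> square_integrable M (\<lambda>x. r *\<^sub>R f x)"
  by (auto simp: square_integrable_def power_mult_distrib)

lemma L2_norm_scaleR: "L2_norm M (\<lambda>x. r *\<^sub>R f x) = \<bar>r\<bar> * L2_norm M f"
  by (simp add: L2_norm_def power_mult_distrib real_sqrt_mult)

lemma square_integrable_add:
  assumes "square_integrable M f" "square_integrable M g"
  shows "square_integrable M (\<lambda>x. f x + g x)"
  unfolding square_integrable_def
proof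
  show "integrable M (\<lambda>x. (norm (f x + g x))\<^sup>2)"
    unfolding power2_norm_eq_inner inner_add_left inner_add_right
    using square_integrable_inner[OF assms(1,1)] square_integrable_inner[OF assms]
      square_integrable_inner[OF assms(2,1)] square_integrable_inner[OF assms(2,2)]
    by (intro Bochner_Integration.integrable_add)
  show "(\<lambda>x. f x + g x) \<in> borel_measurable M"
    using assms by (auto simp: square_integrable_def)
qed

lemma L2_norm_add:
  assumes "square_integrable M f" "square_integrable M g"
  shows "L2_norm M (\<lambda>x. f x + g x) \<le> L2_norm M f + L2_norm M g"
proof (rule power2_le_imp_le)
  have i: "integrable M (\<lambda>x. f x \<bullet> f x)" "integrable M (\<lambda>x. g x \<bullet> g x)" "integrable M (\<lambda>x. f x \<bullet> g x)"
    using assms by (auto intro: square_integrable_inner)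
  have "(L2_norm M (\<lambda>x. f x + g x))\<^sup>2 = (\<integral>x. f x \<bullet> f x + 2 * (f x \<bullet> g x) + g x \<bullet> g x \<partial>M)"
    unfolding L2_norm_squared power2_norm_eq_inner
    by (simp add: inner_add_left inner_add_right inner_commute algebra_simps)
  also have "\<dots> = (L2_norm M f)\<^sup>2 + 2 * (\<integral>x. f x \<bullet> g x \<partial>M) + (L2_norm M g)\<^sup>2"
    unfolding L2_norm_squared power2_norm_eq_inner using i by simp
  also have "\<dots> \<le> (L2_norm M f + L2_norm M g)\<^sup>2"
    using L2_Cauchy_Schwarz[OF assms] by (simp add: power2_sum)
  finally show "(L2_norm M (\<lambda>x. f x + g x))\<^sup>2 \<le> (L2_norm M f + L2_norm M g)\<^sup>2" .
qed (simp add: L2_norm_nonneg)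

lemma L2_norm_cong_AE:
  assumes "AE x in M. f x = g x" "f \<in> borel_measurable M" "g \<in> borel_measurable M"
  shows "L2_norm M f = L2_norm M g"
  unfolding L2_norm_def using assms by (intro arg_cong[where f = sqrt] integral_cong_AE) auto

lemma square_integrable_inner_const:
  assumes "square_integrable M f" shows "square_integrable M (\<lambda>x. f x \<bullet> b)"
proof (rule square_integrable_bound)
  show "square_integrable M (\<lambda>x. norm b *\<^sub>R f x)" by (rule square_integrable_scaleR[OF assms])
  show "norm (f x \<bullet> b) \<le> norm (norm b *\<^sub>R f x)" for x
    using Cauchy_Schwarz_ineq2[of "f x" b] by (simp add: mult.commute)
qed (use assms in \<open>auto simp: square_integrable_def\<close>)

lemma square_integrable_integrable:
  assumes "finite_measure M" "square_integrable M f"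
  shows "integrable M f"
proof (rule Bochner_Integration.integrable_bound)
  interpret finite_measure M by fact
  show "integrable M (\<lambda>x. 1 + (norm (f x))\<^sup>2)"
    using assms by (auto simp: square_integrable_def)
  have "norm (f x) \<le> 1 + (norm (f x))\<^sup>2" for x
    using sum_squares_bound[of 1 "norm (f x)"] norm_ge_zero[of "f x"]
    unfolding power_one mult_1_right by linarith
  then show "AE x in M. norm (f x) \<le> norm (1 + (norm (f x))\<^sup>2)" by simp
qed (use assms in \<open>auto simp: square_integrable_def\<close>)

section \<open>Integrals of compactly supported functions and of their derivatives\<close>

lemma integrable_compact_support:
  fixes f :: "'a::euclidean_space \<Rightarrow> 'b::euclidean_space"
  assumes "continuous_on UNIV f" "compact K" "\<And>x. x \<notin> K \<Longrightarrow> f x = 0"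
  shows "integrable lborel f"
proof -
  have "integrable lborel (\<lambda>x. indicator K x *\<^sub>R f x)"
    using assms by (intro borel_integrable_compact) (auto intro: continuous_on_subset)
  also have "(\<lambda>x. indicator K x *\<^sub>R f x) = f"
    using assms(3) by (auto simp: indicator_def)
  finally show ?thesis .
qed

text \<open>Transfers integrals over \<open>\<Omega>\<close> to \<open>lborel\<close> on the whole
  space, where translation invariance is available.\<close>

lemma lebesgue_on_compact_support:
  fixes f :: "'a::euclidean_space \<Rightarrow> 'b::euclidean_space"
  assumes f: "continuous_on UNIV f" "compact K" "\<And>x. x \<notin> K \<Longrightarrow> f x = 0"
    and \<Omega>: "K \<subseteq> \<Omega>" "\<Omega> \<in> sets lebesgue"
  shows "integrable (lebesgue_on \<Omega>) f" "integral\<^sup>L (lebesgue_on \<Omega>) f = integral\<^sup>L lborel f"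
proof -
  have "f x = 0" if "x \<notin> \<Omega>" for x
    using f(3) \<Omega> that by blast
  then have eq: "(\<lambda>x. indicator \<Omega> x *\<^sub>R f x) = f"
    by (auto simp: indicator_def)
  have int: "integrable lborel f" by (rule integrable_compact_support[OF f])
  then have "integrable lebesgue f" by (rule integrable_completion[THEN iffD2, rotated]) (use int in auto)
  then show "integrable (lebesgue_on \<Omega>) f"
    using \<Omega> by (subst integrable_restrict_space) (auto simp: eq)
  show "integral\<^sup>L (lebesgue_on \<Omega>) f = integral\<^sup>L lborel f"
    using \<Omega> int by (subst integral_restrict_space) (auto simp: eq intro: integral_completion)
qed

text \<open>Differentiating \<open>h \<mapsto> \<integral> f (x + h b) dx\<close>, which is constant by translation invariance,
  under the integral.\<close>

lemma integral_partial_eq_0: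
  fixes f :: "'a::euclidean_space \<Rightarrow> real"
  assumes diff: "\<And>x. f differentiable (at x)"
    and cont: "continuous_on UNIV (\<lambda>x. frechet_derivative f (at x) b)"
    and K: "compact K" "\<And>x. x \<notin> K \<Longrightarrow> f x = 0"
  shows "(\<integral>x. frechet_derivative f (at x) b \<partial>lborel) = 0"
proof -
  let ?D = "\<lambda>x. frechet_derivative f (at x) b"
  have f_cont: "continuous_on UNIV f"
    using diff by (simp add: continuous_at_imp_continuous_on differentiable_imp_continuous_within)
  have [measurable]: "f \<in> borel_measurable borel" "?D \<in> borel_measurable borel"
    using f_cont cont by (simp_all add: borel_measurable_continuous_onI)
  have int: "integrable lborel f" by (rule integrable_compact_support[OF f_cont K])
  obtain R where R: "\<And>x. x \<in> K \<Longrightarrow> norm x \<le> R"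
    using compact_imp_bounded[OF K(1)] by (auto simp: bounded_iff)
  \<comment> \<open>The intermediate points lie within |b| of the ball of radius R + |b|, hence the
    radius R + 2 |b|.\<close>
  let ?L = "cball 0 (R + 2 * norm b) :: 'a set"
  have "compact (?D ` ?L)"
    using cont by (intro compact_continuous_image) (auto intro: continuous_on_subset)
  then obtain M where M: "\<And>x. x \<in> ?L \<Longrightarrow> \<bar>?D x\<bar> \<le> M"
    by (meson bounded_real compact_imp_bounded imageI)
  define h where "h n = inverse (real (Suc n))" for n
  have h: "0 < h n" "h n \<le> 1" for n by (auto simp: h_def divide_simps)
  have deriv: "((\<lambda>s. f (x + s *\<^sub>R b)) has_real_derivative ?D (x + s *\<^sub>R b)) (at s)" for x s
  proof -
    have "(f has_derivative frechet_derivative f (at (x + s *\<^sub>R b))) (at (x + s *\<^sub>R b))"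
      using diff frechet_derivative_works by blast
    then have "((\<lambda>s. f (x + s *\<^sub>R b)) has_derivative
        (\<lambda>r. frechet_derivative f (at (x + s *\<^sub>R b)) (r *\<^sub>R b))) (at s)"
      by (rule has_derivative_compose[rotated]) (auto intro!: derivative_eq_intros)
    then show ?thesis
      using linear_frechet_derivative[OF diff]
      by (simp add: has_field_derivative_def linear_scale mult_commute_abs)
  qed
  have "(\<lambda>n. \<integral>x. (f (x + h n *\<^sub>R b) - f x) / h n \<partial>lborel) \<longlonglongrightarrow> (\<integral>x. ?D x \<partial>lborel)"
  \<comment> \<open>On the ball of radius R + |b| the mean value theorem bounds the quotient by M.
    Outside it both x and the shifted point miss K, because the steps \<open>h n\<close> are at most
    1.\<close>
  proof (rule integral_dominated_convergence[where w = "\<lambda>x. indicator (cball 0 (R + norm b)) x *\<^sub>R M"])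
    have "integrable lborel (indicator (cball 0 (R + norm b) :: 'a set) :: 'a \<Rightarrow> real)"
      using emeasure_bounded_finite[OF bounded_cball[of "0 :: 'a" "R + norm b"]]
      by (intro integrable_real_indicator) auto
    then show "integrable lborel (\<lambda>x::'a. indicator (cball 0 (R + norm b)) x *\<^sub>R M)"
      by auto
    show "AE x in lborel. (\<lambda>n. (f (x + h n *\<^sub>R b) - f x) / h n) \<longlonglongrightarrow> ?D x"
    proof (rule AE_I2)
      fix x
      have "((\<lambda>r. (f (x + r *\<^sub>R b) - f x) / r) \<longlongrightarrow> ?D x) (at 0)"
        using deriv[of x 0] by (simp add: DERIV_def)
      moreover have "filterlim h (at 0) sequentially"
        unfolding filterlim_at h_def using LIMSEQ_inverse_real_of_nat by auto
      ultimately show "(\<lambda>n. (f (x + h n *\<^sub>R b) - f x) / h n) \<longlonglongrightarrow> ?D x"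
        by (rule filterlim_compose)
    qed
    show "AE x in lborel. norm ((f (x + h n *\<^sub>R b) - f x) / h n)
        \<le> indicator (cball 0 (R + norm b)) x *\<^sub>R M" for n
    proof (rule AE_I2)
      fix x
      have hb: "norm (r *\<^sub>R b) \<le> norm b" if "0 \<le> r" "r \<le> h n" for r
        using that h[of n] by (simp add: mult_left_le_one_le)
      show "norm ((f (x + h n *\<^sub>R b) - f x) / h n) \<le> indicator (cball 0 (R + norm b)) x *\<^sub>R M"
      proof (cases "norm x \<le> R + norm b")
        case True
        obtain z where z: "0 < z" "z < h n" "f (x + h n *\<^sub>R b) - f (x + 0 *\<^sub>R b) = (h n - 0) * ?D (x + z *\<^sub>R b)"
          using MVT2[OF h(1)[of n], of "\<lambda>s. f (x + s *\<^sub>R b)" "\<lambda>s. ?D (x + s *\<^sub>R b)"] deriv by blast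
        have "x + z *\<^sub>R b \<in> ?L"
          using hb[of z] z True norm_triangle_ineq[of x "z *\<^sub>R b"] by simp
        with z M[of "x + z *\<^sub>R b"] h[of n] True show ?thesis by simp
      next
        case False
        have "norm x \<le> norm (x + h n *\<^sub>R b) + norm (h n *\<^sub>R b)"
          using norm_triangle_ineq4[of "x + h n *\<^sub>R b" "h n *\<^sub>R b"] by simp
        moreover have "norm (h n *\<^sub>R b) \<le> norm b" using hb h(1)[of n] by simp
        ultimately have "R < norm (x + h n *\<^sub>R b)" using False by linarith
        moreover have "R < norm x" using False norm_ge_zero[of b] by linarith
        ultimately have "x \<notin> K" "x + h n *\<^sub>R b \<notin> K" using R by (meson not_le)+
        then show ?thesis using K False by simp
      qed
    qed
  qed auto
  moreover have "(\<integral>x. (f (x + h n *\<^sub>R b) - f x) / h n \<partial>lborel) = 0" for n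
  proof -
    have d: "lborel = distr lborel borel (\<lambda>x. h n *\<^sub>R b + x)" by (rule lborel_distr_plus[symmetric])
    have "integrable lborel (\<lambda>x. f (h n *\<^sub>R b + x))"
      using int by (subst (asm) d, subst (asm) integrable_distr_eq) auto
    moreover have "(\<integral>x. f (h n *\<^sub>R b + x) \<partial>lborel) = integral\<^sup>L lborel f"
      by (subst (2) d, subst integral_distr) auto
    ultimately show ?thesis using int by (simp add: add.commute)
  qed
  ultimately show ?thesis by (simp only: LIMSEQ_const_iff)
qed

lemma frechet_derivative_mult_at:
  fixes f g :: "'a::euclidean_space \<Rightarrow> real"
  assumes "f differentiable (at x)" "g differentiable (at x)"
  shows "frechet_derivative (\<lambda>x. f x * g x) (at x) =
    (\<lambda>y. f x * frechet_derivative g (at x) y + frechet_derivative f (at x) y * g x)"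
  using has_derivative_mult[OF assms[unfolded frechet_derivative_works]]
  by (rule frechet_derivative_at[symmetric])

section \<open>Sobolev spaces\<close>

definition grad :: "('a::euclidean_space \<Rightarrow> real) \<Rightarrow> 'a \<Rightarrow> 'a" where
  "grad \<phi> x = (\<Sum>b\<in>Basis. frechet_derivative \<phi> (at x) b *\<^sub>R b)"

lemma grad_inner_Basis: "b \<in> Basis \<Longrightarrow> grad \<phi> x \<bullet> b = frechet_derivative \<phi> (at x) b"
  by (simp add: grad_def inner_sum_left inner_Basis if_distrib cong: if_cong)

locale bounded_open =
  fixes \<Omega> :: "'a::euclidean_space set"
  assumes open_domain: "open \<Omega>" and bounded_domain: "bounded \<Omega>"
begin

abbreviation "M \<equiv> lebesgue_on \<Omega>"

lemma domain_sets: "\<Omega> \<in> sets lebesgue"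
  using open_domain by auto

lemma finite_measure_domain: "finite_measure M"
proof
  have "\<Omega> \<in> lmeasurable" using open_domain bounded_domain by (intro bounded_set_imp_lmeasurable) auto
  then show "emeasure M (space M) \<noteq> \<infinity>"
    using domain_sets by (auto simp: emeasure_restrict_space space_restrict_space fmeasurable_def)
qed

lemma test_function_measurable: "test_function \<Omega> \<phi> \<Longrightarrow> \<phi> \<in> borel_measurable M"
  by (intro measurable_restrict_space1 measurable_completion) (simp add: test_function_borel)

lemma continuous_measurable:
  fixes f :: "'a \<Rightarrow> 'b::euclidean_space"
  shows "continuous_on UNIV f \<Longrightarrow> f \<in> borel_measurable M"
  by (intro measurable_restrict_space1 measurable_completion) (simp add: borel_measurable_continuous_onI)

lemma bounded_square_integrable:
  assumes "f \<in> borel_measurable M" "\<And>x. x \<in> \<Omega> \<Longrightarrow> norm (f x) \<le> B"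
  shows "square_integrable M f"
proof -
  interpret finite_measure M by (rule finite_measure_domain)
  have "square_integrable M (\<lambda>_. B)" by (simp add: square_integrable_def)
  then show ?thesis
    by (rule square_integrable_bound)
       (use assms in \<open>auto simp: space_restrict_space intro: order_trans[OF _ abs_ge_self]\<close>)
qed

lemma test_function_square_integrable:
  assumes "test_function \<Omega> \<phi>" shows "square_integrable M \<phi>"
proof -
  obtain B where "\<And>x. \<bar>\<phi> x\<bar> \<le> B" using test_function_bounded[OF assms] by blast
  then show ?thesis
    by (intro bounded_square_integrable[of _ B] test_function_measurable assms) auto
qed

lemma continuous_grad: "test_function \<Omega> \<phi> \<Longrightarrow> continuous_on UNIV (grad \<phi>)"
  unfolding grad_def
  by (intro continuous_intros) (auto intro: test_function_continuous test_function_partial)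

lemma grad_square_integrable:
  assumes "test_function \<Omega> \<phi>" shows "square_integrable M (grad \<phi>)"
proof (rule square_integrable_def[THEN iffD2, OF conjI])
  show "grad \<phi> \<in> borel_measurable M" by (rule continuous_measurable[OF continuous_grad[OF assms]])
  have "continuous_on UNIV (\<lambda>x. (norm (grad \<phi> x))\<^sup>2)"
    by (intro continuous_intros continuous_grad assms)
  then show "integrable M (\<lambda>x. (norm (grad \<phi> x))\<^sup>2)"
  proof (rule lebesgue_on_compact_support)
    show "(norm (grad \<phi> x))\<^sup>2 = 0" if "x \<notin> closure {x. \<phi> x \<noteq> 0}" for x
      using test_function_partial_support[OF that] by (simp add: grad_def)
  qed (use assms domain_sets in \<open>auto simp: test_function_def\<close>)
qed

text \<open>The product inherits the compact support of \<phi>, so its partial derivative integrates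
  to 0; \<psi> may therefore be any differentiable function whose partial derivative along b is
  continuous.\<close>

lemma integral_by_parts:
  assumes \<phi>: "test_function \<Omega> \<phi>" and \<psi>: "\<And>x. \<psi> differentiable (at x)" and b: "b \<in> Basis"
    and \<psi>': "continuous_on UNIV (\<lambda>x. frechet_derivative \<psi> (at x) b)"
  shows "(\<integral>x. \<psi> x * frechet_derivative \<phi> (at x) b \<partial>M) = - (\<integral>x. frechet_derivative \<psi> (at x) b * \<phi> x \<partial>M)"
proof -
  let ?K = "closure {x. \<phi> x \<noteq> 0}"
  have K: "compact ?K" "?K \<subseteq> \<Omega>" using \<phi> by (auto simp: test_function_def)
  have \<phi>0: "\<phi> x = 0" "frechet_derivative \<phi> (at x) = (\<lambda>_. 0)" if "x \<notin> ?K" for x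
    using test_function_eq_0_outside_support[OF that] test_function_partial_support[OF that] by auto
  have \<psi>_cont: "continuous_on UNIV \<psi>"
    using \<psi> by (simp add: continuous_at_imp_continuous_on differentiable_imp_continuous_within)
  have c: "continuous_on UNIV \<phi>" "continuous_on UNIV (\<lambda>x. frechet_derivative \<phi> (at x) b)"
    using \<phi> b by (auto intro: test_function_continuous test_function_partial)
  have D: "frechet_derivative (\<lambda>x. \<psi> x * \<phi> x) (at x) b
      = \<psi> x * frechet_derivative \<phi> (at x) b + frechet_derivative \<psi> (at x) b * \<phi> x" for x
    using frechet_derivative_mult_at[OF \<psi>[of x] test_function_differentiable[OF \<phi>]] by metis
  have cD: "continuous_on UNIV (\<lambda>x. frechet_derivative (\<lambda>x. \<psi> x * \<phi> x) (at x) b)"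
    unfolding D by (intro continuous_intros c \<psi>_cont \<psi>')
  have "0 = (\<integral>x. frechet_derivative (\<lambda>x. \<psi> x * \<phi> x) (at x) b \<partial>lborel)"
  proof (rule integral_partial_eq_0[symmetric, OF _ cD K(1)])
    show "\<psi> x * \<phi> x = 0" if "x \<notin> ?K" for x using \<phi>0(1)[OF that] by (simp only: mult_zero_right)
  qed (rule differentiable_mult[OF \<psi> test_function_differentiable[OF \<phi>]])
  also have "\<dots> = (\<integral>x. frechet_derivative (\<lambda>x. \<psi> x * \<phi> x) (at x) b \<partial>M)"
  proof (rule lebesgue_on_compact_support(2)[symmetric, OF cD K(1) _ K(2) domain_sets])
    show "frechet_derivative (\<lambda>x. \<psi> x * \<phi> x) (at x) b = 0" if "x \<notin> ?K" for x
      by (simp only: D \<phi>0(1)[OF that] \<phi>0(2)[OF that] mult_zero_right add_0)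
  qed
  also have "\<dots> = (\<integral>x. \<psi> x * frechet_derivative \<phi> (at x) b \<partial>M)
      + (\<integral>x. frechet_derivative \<psi> (at x) b * \<phi> x \<partial>M)"
  proof -
    have "integrable M (\<lambda>x. \<psi> x * frechet_derivative \<phi> (at x) b)"
    proof (rule lebesgue_on_compact_support(1)[OF _ K(1) _ K(2) domain_sets])
      show "\<psi> x * frechet_derivative \<phi> (at x) b = 0" if "x \<notin> ?K" for x
        by (simp only: \<phi>0(2)[OF that] mult_zero_right)
    qed (intro continuous_intros c \<psi>_cont)
    moreover have "integrable M (\<lambda>x. frechet_derivative \<psi> (at x) b * \<phi> x)"
    proof (rule lebesgue_on_compact_support(1)[OF _ K(1) _ K(2) domain_sets])
      show "frechet_derivative \<psi> (at x) b * \<phi> x = 0" if "x \<notin> ?K" for x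
        by (simp only: \<phi>0(1)[OF that] mult_zero_right)
    qed (intro continuous_intros c \<psi>')
    ultimately show ?thesis unfolding D by (rule Bochner_Integration.integral_add)
  qed
  finally show ?thesis by simp
qed

lemma test_function_partial_continuous:
  "test_function \<Omega> \<phi> \<Longrightarrow> b \<in> Basis \<Longrightarrow> continuous_on S (\<lambda>x. frechet_derivative \<phi> (at x) b)"
  by (auto intro: test_function_continuous test_function_partial)

lemma test_function_weak_gradient:
  assumes "test_function \<Omega> \<phi>" shows "is_weak_gradient \<Omega> \<phi> (grad \<phi>)"
  unfolding is_weak_gradient_def
  using integral_by_parts[OF _ test_function_differentiable[OF assms]]
    test_function_partial_continuous[OF assms]
  by (auto simp: grad_inner_Basis)

text \<open>\<open>weak_grad\<close> is picked by a choice operator, so explicit gradients have to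
  be identified with it. The fundamental lemma is applied in each of the finitely many
  coordinates.\<close>

lemma weak_gradient_unique:
  assumes "is_weak_gradient \<Omega> u g" "is_weak_gradient \<Omega> u h"
    "square_integrable M g" "square_integrable M h"
  shows "AE x in M. g x = h x"
proof -
  have "AE x in M. \<forall>b\<in>Basis. g x \<bullet> b = h x \<bullet> b"
  proof (rule AE_finite_allI[OF finite_Basis])
    fix b :: 'a assume b: "b \<in> Basis"
    have sq: "square_integrable M (\<lambda>x. g x \<bullet> b)" "square_integrable M (\<lambda>x. h x \<bullet> b)"
      using assms square_integrable_inner_const by auto
    note int = this[THEN square_integrable_integrable[OF finite_measure_domain]]
    have "AE x in M. x \<in> \<Omega> \<longrightarrow> g x \<bullet> b - h x \<bullet> b = 0"
    proof (rule fundamental_lemma_AE[OF domain_sets open_domain order_refl])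
      show "integrable M (\<lambda>x. g x \<bullet> b - h x \<bullet> b)" using int by simp
      fix \<phi> assume \<phi>: "test_function \<Omega> \<phi>"
      have "(\<integral>x. (g x \<bullet> b) * \<phi> x \<partial>M) = (\<integral>x. (h x \<bullet> b) * \<phi> x \<partial>M)"
        using assms(1,2) b \<phi> unfolding is_weak_gradient_def by force
      moreover have "integrable M (\<lambda>x. (g x \<bullet> b) * \<phi> x)" "integrable M (\<lambda>x. (h x \<bullet> b) * \<phi> x)"
        using square_integrable_inner[OF sq(1) test_function_square_integrable[OF \<phi>]]
          square_integrable_inner[OF sq(2) test_function_square_integrable[OF \<phi>]] by auto
      ultimately show "(\<integral>x. (g x \<bullet> b - h x \<bullet> b) * \<phi> x \<partial>M) = 0"
        by (simp add: left_diff_distrib)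
    qed
    with AE_space show "AE x in M. g x \<bullet> b = h x \<bullet> b"
      by eventually_elim (auto simp: space_restrict_space)
  qed
  then show ?thesis
    by eventually_elim (auto intro: euclidean_eqI)
qed

lemma H1_weak_grad:
  assumes "u \<in> H1 \<Omega>"
  shows "square_integrable M u" "square_integrable M (weak_grad \<Omega> u)" "is_weak_gradient \<Omega> u (weak_grad \<Omega> u)"
proof -
  have "\<exists>g. g square_integrable_on \<Omega> \<and> is_weak_gradient \<Omega> u g"
    using assms by (simp add: H1_def)
  from someI_ex[OF this] show "square_integrable M (weak_grad \<Omega> u)" "is_weak_gradient \<Omega> u (weak_grad \<Omega> u)"
    by (simp_all add: weak_grad_def square_integrable_on_iff)
  show "square_integrable M u" using assms by (simp add: H1_def square_integrable_on_iff)
qed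

lemma H1I:
  assumes "square_integrable M u" "square_integrable M g" "is_weak_gradient \<Omega> u g"
  shows "u \<in> H1 \<Omega>" "AE x in M. weak_grad \<Omega> u x = g x"
proof -
  show H: "u \<in> H1 \<Omega>" using assms by (auto simp: H1_def square_integrable_on_iff)
  show "AE x in M. weak_grad \<Omega> u x = g x"
    by (rule weak_gradient_unique[OF H1_weak_grad(3)[OF H] assms(3) H1_weak_grad(2)[OF H] assms(2)])
qed

lemma is_weak_gradient_linear:
  assumes "u \<in> H1 \<Omega>" "v \<in> H1 \<Omega>"
  shows "is_weak_gradient \<Omega> (\<lambda>x. r * u x + s * v x) (\<lambda>x. r *\<^sub>R weak_grad \<Omega> u x + s *\<^sub>R weak_grad \<Omega> v x)"
  unfolding is_weak_gradient_def
proof (intro allI impI ballI)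
  fix \<phi> and b :: 'a assume \<phi>: "test_function \<Omega> \<phi>" and b: "b \<in> Basis"
  note u = H1_weak_grad[OF assms(1)] and v = H1_weak_grad[OF assms(2)]
  let ?d = "\<lambda>x. frechet_derivative \<phi> (at x) b"
  have d: "square_integrable M ?d" "square_integrable M \<phi>"
    using \<phi> b by (auto intro: test_function_square_integrable test_function_partial)
  have "integrable M (\<lambda>x. u x * ?d x)" "integrable M (\<lambda>x. v x * ?d x)"
    "integrable M (\<lambda>x. (weak_grad \<Omega> u x \<bullet> b) * \<phi> x)" "integrable M (\<lambda>x. (weak_grad \<Omega> v x \<bullet> b) * \<phi> x)"
    using square_integrable_inner[OF u(1) d(1)] square_integrable_inner[OF v(1) d(1)]
      square_integrable_inner[OF square_integrable_inner_const[OF u(2)] d(2)]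
      square_integrable_inner[OF square_integrable_inner_const[OF v(2)] d(2)] by auto
  moreover have "(\<integral>x. u x * ?d x \<partial>M) = - (\<integral>x. (weak_grad \<Omega> u x \<bullet> b) * \<phi> x \<partial>M)"
    "(\<integral>x. v x * ?d x \<partial>M) = - (\<integral>x. (weak_grad \<Omega> v x \<bullet> b) * \<phi> x \<partial>M)"
    using u(3) v(3) \<phi> b by (auto simp: is_weak_gradient_def)
  ultimately show "(\<integral>x. (r * u x + s * v x) * ?d x \<partial>M) =
      - (\<integral>x. ((r *\<^sub>R weak_grad \<Omega> u x + s *\<^sub>R weak_grad \<Omega> v x) \<bullet> b) * \<phi> x \<partial>M)"
    by (simp add: distrib_right inner_add_left mult.assoc)
qed

lemma H1_linear:
  assumes "u \<in> H1 \<Omega>" "v \<in> H1 \<Omega>"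
  shows "(\<lambda>x. r * u x + s * v x) \<in> H1 \<Omega>"
    and "AE x in M. weak_grad \<Omega> (\<lambda>x. r * u x + s * v x) x = r *\<^sub>R weak_grad \<Omega> u x + s *\<^sub>R weak_grad \<Omega> v x"
proof -
  note u = H1_weak_grad[OF assms(1)] and v = H1_weak_grad[OF assms(2)]
  have "square_integrable M (\<lambda>x. r *\<^sub>R u x + s *\<^sub>R v x)"
    "square_integrable M (\<lambda>x. r *\<^sub>R weak_grad \<Omega> u x + s *\<^sub>R weak_grad \<Omega> v x)"
    by (intro square_integrable_add square_integrable_scaleR u v)+
  from H1I[OF this(1)[simplified] this(2) is_weak_gradient_linear[OF assms]]
  show "(\<lambda>x. r * u x + s * v x) \<in> H1 \<Omega>"
    "AE x in M. weak_grad \<Omega> (\<lambda>x. r * u x + s * v x) x = r *\<^sub>R weak_grad \<Omega> u x + s *\<^sub>R weak_grad \<Omega> v x"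
    by auto
qed

lemma norm_H10_eq: "norm_H10 \<Omega> u = L2_norm M (weak_grad \<Omega> u)"
  by (simp add: norm_H10_def L2_norm_def)

lemma norm_H1_eq: "norm_H1 \<Omega> u = sqrt ((L2_norm M u)\<^sup>2 + (norm_H10 \<Omega> u)\<^sup>2)"
  by (simp add: norm_H1_def norm_H10_eq L2_norm_squared)

lemma norm_H10_nonneg: "0 \<le> norm_H10 \<Omega> u"
  by (simp add: norm_H10_eq L2_norm_nonneg)

lemma H1_scaleR:
  assumes "u \<in> H1 \<Omega>"
  shows "r *\<^sub>R u \<in> H1 \<Omega>" "AE x in M. weak_grad \<Omega> (r *\<^sub>R u) x = r *\<^sub>R weak_grad \<Omega> u x"
    "norm_H10 \<Omega> (r *\<^sub>R u) = \<bar>r\<bar> * norm_H10 \<Omega> u"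
proof -
  have eq: "r *\<^sub>R u = (\<lambda>x. r * u x + 0 * u x)" by (simp add: scaleR_fun_def)
  show H: "r *\<^sub>R u \<in> H1 \<Omega>" and ae: "AE x in M. weak_grad \<Omega> (r *\<^sub>R u) x = r *\<^sub>R weak_grad \<Omega> u x"
    using H1_linear[OF assms assms, of r 0] unfolding eq by auto
  have "norm_H10 \<Omega> (r *\<^sub>R u) = L2_norm M (\<lambda>x. r *\<^sub>R weak_grad \<Omega> u x)"
    unfolding norm_H10_eq using H1_weak_grad(2)[OF H] H1_weak_grad(2)[OF assms]
    by (intro L2_norm_cong_AE ae) (auto simp: square_integrable_def)
  then show "norm_H10 \<Omega> (r *\<^sub>R u) = \<bar>r\<bar> * norm_H10 \<Omega> u"
    by (simp add: L2_norm_scaleR norm_H10_eq)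
qed

lemma test_function_H1:
  assumes "test_function \<Omega> \<phi>"
  shows "\<phi> \<in> H1 \<Omega>" "AE x in M. weak_grad \<Omega> \<phi> x = grad \<phi> x"
  using H1I[OF test_function_square_integrable grad_square_integrable test_function_weak_gradient] assms
  by auto

lemma norm_H10_test_function:
  assumes "test_function \<Omega> \<phi>" shows "norm_H10 \<Omega> \<phi> = L2_norm M (grad \<phi>)"
  unfolding norm_H10_eq using test_function_H1[OF assms] H1_weak_grad(2) grad_square_integrable[OF assms]
  by (intro L2_norm_cong_AE) (auto simp: square_integrable_def)

lemma test_function_H10:
  assumes "test_function \<Omega> \<phi>" shows "\<phi> \<in> H10 \<Omega>"
proof -
  \<comment> \<open>\<open>weak_grad\<close> of the zero function is again a choice, known to be
    zero only almost everywhere; scaling by 0 yields its norm.\<close>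
  have "\<phi> - \<phi> = 0 *\<^sub>R \<phi>" by (simp add: fun_eq_iff scaleR_fun_def)
  then have "norm_H10 \<Omega> (\<phi> - \<phi>) = 0"
    using H1_scaleR(3)[OF test_function_H1(1)[OF assms], of 0] by simp
  then have "norm_H1 \<Omega> (\<phi> - \<phi>) = 0"
    by (simp add: norm_H1_eq L2_norm_def)
  then show ?thesis using assms test_function_H1(1)[OF assms]
    by (auto simp: H10_def intro!: exI[of _ "\<lambda>_. \<phi>"])
qed

lemma H10_H1: "v \<in> H10 \<Omega> \<Longrightarrow> v \<in> H1 \<Omega>"
  by (simp add: H10_def)

lemma H10_scaleR:
  assumes "v \<in> H10 \<Omega>" shows "r *\<^sub>R v \<in> H10 \<Omega>"
proof -
  obtain \<phi> where \<phi>: "\<And>n. test_function \<Omega> (\<phi> n)" "(\<lambda>n. norm_H1 \<Omega> (v - \<phi> n)) \<longlonglongrightarrow> 0"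
    using assms by (auto simp: H10_def)
  have "norm_H1 \<Omega> (r *\<^sub>R v - r *\<^sub>R \<phi> n) = \<bar>r\<bar> * norm_H1 \<Omega> (v - \<phi> n)" for n
  proof -
    have "v - \<phi> n \<in> H1 \<Omega>"
      using H1_linear(1)[OF H10_H1[OF assms] test_function_H1(1)[OF \<phi>(1)[of n]], of 1 "-1"]
      by (simp add: fun_diff_def)
    from H1_scaleR(3)[OF this, of r]
    have "norm_H10 \<Omega> (r *\<^sub>R (v - \<phi> n)) = \<bar>r\<bar> * norm_H10 \<Omega> (v - \<phi> n)" .
    moreover have "L2_norm M (r *\<^sub>R (v - \<phi> n)) = \<bar>r\<bar> * L2_norm M (v - \<phi> n)"
      unfolding scaleR_fun_def by (rule L2_norm_scaleR)
    ultimately have "norm_H1 \<Omega> (r *\<^sub>R (v - \<phi> n)) = sqrt (\<bar>r\<bar>\<^sup>2 * ((L2_norm M (v - \<phi> n))\<^sup>2 + (norm_H10 \<Omega> (v - \<phi> n))\<^sup>2))"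
      by (simp add: norm_H1_eq power_mult_distrib algebra_simps)
    then show ?thesis by (simp add: norm_H1_eq real_sqrt_mult scaleR_diff_right)
  qed
  then have "(\<lambda>n. norm_H1 \<Omega> (r *\<^sub>R v - r *\<^sub>R \<phi> n)) \<longlonglongrightarrow> 0"
    using tendsto_mult_left[OF \<phi>(2), of "\<bar>r\<bar>"] by simp
  then show ?thesis
    using H1_scaleR(1)[OF H10_H1[OF assms]] test_function_scaleR[OF \<phi>(1)]
    by (auto simp: H10_def intro!: exI[of _ "\<lambda>n. r *\<^sub>R \<phi> n"])
qed

section \<open>The Poincare inequality\<close>

text \<open>For a test function \<open>\<phi>\<close>, integrate the partial derivative of \<open>(x \<bullet> b) \<phi>\<^sup>2\<close>.\<close>

lemma Poincare_test_function:
  assumes \<phi>: "test_function \<Omega> \<phi>" and R: "R \<ge> 0" "\<And>x. x \<in> \<Omega> \<Longrightarrow> norm x \<le> R"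
  shows "L2_norm M \<phi> \<le> 2 * R * norm_H10 \<Omega> \<phi>"
proof -
  obtain b :: 'a where b: "b \<in> Basis" using nonempty_Basis by blast
  let ?d = "\<lambda>x. frechet_derivative \<phi> (at x) b"
  have "((\<lambda>x. (x \<bullet> b) * \<phi> x) has_derivative (\<lambda>y. (x \<bullet> b) * frechet_derivative \<phi> (at x) y + (y \<bullet> b) * \<phi> x)) (at x)" for x
    by (intro has_derivative_mult test_function_has_derivative[OF \<phi>]) (auto intro!: derivative_eq_intros)
  note D = this frechet_derivative_at[OF this, symmetric]
  have sq: "square_integrable M \<phi>" "square_integrable M ?d"
    using \<phi> b by (auto intro: test_function_square_integrable test_function_partial)
  have xb: "\<bar>x \<bullet> b\<bar> \<le> R" if "x \<in> \<Omega>" for x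
    using R(2)[OF that] Basis_le_norm[OF b, of x] by linarith
  have meas: "(\<lambda>x. x \<bullet> b) \<in> borel_measurable M"
    by (intro continuous_measurable continuous_intros)
  have sq_xd: "square_integrable M (\<lambda>x. (x \<bullet> b) * ?d x)"
  proof (rule square_integrable_bound)
    show "square_integrable M (\<lambda>x. R *\<^sub>R ?d x)" by (rule square_integrable_scaleR[OF sq(2)])
    show "norm ((x \<bullet> b) * ?d x) \<le> norm (R *\<^sub>R ?d x)" if "x \<in> space M" for x
      using xb[of x] that R(1) by (auto simp: space_restrict_space abs_mult intro!: mult_right_mono)
  qed (use sq meas in \<open>auto simp: square_integrable_def\<close>)
  \<comment> \<open>Both sides contain the same cross integral with opposite signs, so the integral
    of phi^2 is -2 times it; this is the 2 in \<open>2 * R\<close>.\<close>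
  have "(\<integral>x. ((x \<bullet> b) * \<phi> x) * ?d x \<partial>M) = - (\<integral>x. ((x \<bullet> b) * ?d x + \<phi> x) * \<phi> x \<partial>M)"
  proof -
    have D': "frechet_derivative (\<lambda>x. (x \<bullet> b) * \<phi> x) (at x) b = (x \<bullet> b) * ?d x + \<phi> x" for x
      using D(2)[of x] b by simp
    have "continuous_on UNIV (\<lambda>x. frechet_derivative (\<lambda>x. (x \<bullet> b) * \<phi> x) (at x) b)"
      unfolding D' by (intro continuous_intros test_function_partial_continuous
          test_function_continuous[OF \<phi>] \<phi> b)
    moreover have "(\<lambda>x. (x \<bullet> b) * \<phi> x) differentiable (at x)" for x
      using D(1) by (auto simp: differentiable_def)
    ultimately show ?thesis
      using integral_by_parts[OF \<phi> _ b, of "\<lambda>x. (x \<bullet> b) * \<phi> x"] by (simp only: D')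
  qed
  moreover have "integrable M (\<lambda>x. \<phi> x * ((x \<bullet> b) * ?d x))" "integrable M (\<lambda>x. \<phi> x * \<phi> x)"
    using square_integrable_inner[OF sq(1) sq_xd] square_integrable_inner[OF sq(1) sq(1)] by auto
  ultimately have "(\<integral>x. \<phi> x * \<phi> x \<partial>M) = - (2 * (\<integral>x. \<phi> x * ((x \<bullet> b) * ?d x) \<partial>M))"
    by (simp add: algebra_simps)
  then have "(L2_norm M \<phi>)\<^sup>2 \<le> 2 * \<bar>\<integral>x. \<phi> x \<bullet> ((x \<bullet> b) * ?d x) \<partial>M\<bar>"
    unfolding L2_norm_squared by (simp add: power2_eq_square)
  also have "\<dots> \<le> 2 * (L2_norm M \<phi> * L2_norm M (\<lambda>x. (x \<bullet> b) * ?d x))"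
    using L2_Cauchy_Schwarz[OF sq(1) sq_xd] by simp
  finally have 1: "(L2_norm M \<phi>)\<^sup>2 \<le> 2 * (L2_norm M \<phi> * L2_norm M (\<lambda>x. (x \<bullet> b) * ?d x))" .
  have "L2_norm M (\<lambda>x. (x \<bullet> b) * ?d x) \<le> L2_norm M (\<lambda>x. R *\<^sub>R grad \<phi> x)"
  proof (rule L2_norm_mono)
    show "norm ((x \<bullet> b) * ?d x) \<le> norm (R *\<^sub>R grad \<phi> x)" if "x \<in> space M" for x
      using xb[of x] that R(1) Basis_le_norm[OF b, of "grad \<phi> x"]
      by (auto simp: space_restrict_space abs_mult grad_inner_Basis[OF b] intro!: mult_mono)
  qed (use sq_xd grad_square_integrable[OF \<phi>] square_integrable_scaleR in auto)
  also have "\<dots> = R * norm_H10 \<Omega> \<phi>"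
    using R(1) by (simp add: L2_norm_scaleR norm_H10_test_function[OF \<phi>])
  finally have "L2_norm M \<phi> * L2_norm M (\<lambda>x. (x \<bullet> b) * ?d x) \<le> L2_norm M \<phi> * (R * norm_H10 \<Omega> \<phi>)"
    using L2_norm_nonneg[of M \<phi>] by (rule mult_left_mono)
  with 1 have "L2_norm M \<phi> * L2_norm M \<phi> \<le> L2_norm M \<phi> * (2 * R * norm_H10 \<Omega> \<phi>)"
    by (simp add: power2_eq_square algebra_simps)
  then show ?thesis
    using L2_norm_nonneg[of M \<phi>] R(1) norm_H10_nonneg[of \<phi>]
    by (cases "L2_norm M \<phi> = 0") auto
qed

text \<open>The constant for test functions survives the limit by which \<open>H10\<close> is
  defined.\<close>

lemma Poincare:
  obtains C where "C \<ge> 0" "\<And>v. v \<in> H10 \<Omega> \<Longrightarrow> L2_norm M v \<le> C * norm_H10 \<Omega> v"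
proof -
  obtain R where R: "R \<ge> 0" "\<And>x. x \<in> \<Omega> \<Longrightarrow> norm x \<le> R"
    using bounded_domain by (meson bounded_iff norm_ge_zero order_trans bounded_pos less_imp_le)
  have "L2_norm M v \<le> 2 * R * norm_H10 \<Omega> v" if v: "v \<in> H10 \<Omega>" for v
  proof -
    obtain \<phi> where \<phi>: "\<And>n. test_function \<Omega> (\<phi> n)" "(\<lambda>n. norm_H1 \<Omega> (v - \<phi> n)) \<longlonglongrightarrow> 0"
      using v by (auto simp: H10_def)
    \<comment> \<open>The difference v - phi n enters once in L2 and once, with factor 2 R, through
      the gradient.\<close>
    have "L2_norm M v \<le> 2 * R * norm_H10 \<Omega> v + (1 + 2 * R) * norm_H1 \<Omega> (v - \<phi> n)" for n
    proof -
      note vH = H10_H1[OF v] and fH = test_function_H1(1)[OF \<phi>(1)[of n]]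
      define w where "w = v - \<phi> n"
      have w: "w = (\<lambda>x. 1 * v x + -1 * \<phi> n x)" by (simp add: w_def fun_diff_def)
      note wl = H1_linear[OF vH fH, of 1 "-1", folded w]
      have wH: "w \<in> H1 \<Omega>" and wg: "AE x in M. weak_grad \<Omega> (\<phi> n) x = weak_grad \<Omega> v x + (-1) *\<^sub>R weak_grad \<Omega> w x"
        using wl by auto
      have le: "L2_norm M w \<le> norm_H1 \<Omega> w" "norm_H10 \<Omega> w \<le> norm_H1 \<Omega> w"
        unfolding norm_H1_eq by (simp_all add: real_le_rsqrt)
      have "norm_H10 \<Omega> (\<phi> n) = L2_norm M (\<lambda>x. weak_grad \<Omega> v x + (-1) *\<^sub>R weak_grad \<Omega> w x)"
        unfolding norm_H10_eq using H1_weak_grad(2)[OF vH] H1_weak_grad(2)[OF fH] H1_weak_grad(2)[OF wH]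
        by (intro L2_norm_cong_AE wg) (auto simp: square_integrable_def)
      also have "\<dots> \<le> L2_norm M (weak_grad \<Omega> v) + L2_norm M (\<lambda>x. (-1) *\<^sub>R weak_grad \<Omega> w x)"
        by (intro L2_norm_add square_integrable_scaleR H1_weak_grad vH wH)
      also have "\<dots> = norm_H10 \<Omega> v + norm_H10 \<Omega> w"
        unfolding L2_norm_scaleR norm_H10_eq by simp
      finally have 1: "norm_H10 \<Omega> (\<phi> n) \<le> norm_H10 \<Omega> v + norm_H1 \<Omega> w" using le by simp
      have "v = (\<lambda>x. \<phi> n x + w x)" by (simp add: w_def)
      then have "L2_norm M v \<le> L2_norm M (\<phi> n) + L2_norm M w"
        using L2_norm_add[OF H1_weak_grad(1)[OF fH] H1_weak_grad(1)[OF wH]] by simp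
      also have "\<dots> \<le> 2 * R * norm_H10 \<Omega> (\<phi> n) + norm_H1 \<Omega> w"
        using Poincare_test_function[OF \<phi>(1)[of n] R] le by simp
      also have "\<dots> \<le> 2 * R * (norm_H10 \<Omega> v + norm_H1 \<Omega> w) + norm_H1 \<Omega> w"
        using 1 R(1) by (intro add_right_mono mult_left_mono) auto
      finally show ?thesis by (simp add: w_def algebra_simps)
    qed
    moreover have "(\<lambda>n. 2 * R * norm_H10 \<Omega> v + (1 + 2 * R) * norm_H1 \<Omega> (v - \<phi> n)) \<longlonglongrightarrow>
        2 * R * norm_H10 \<Omega> v + (1 + 2 * R) * 0"
      by (intro tendsto_intros \<phi>)
    ultimately show ?thesis by (intro LIMSEQ_le_const[where a = "L2_norm M v"]) auto
  qed
  then show ?thesis using that[of "2 * R"] R by auto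
qed

end

section \<open>The dual space\<close>

context bounded_open
begin

lemma test_function_zero: "test_function \<Omega> 0"
  by (rule test_functionI[of _ "{}"]) (auto simp: zero_fun_def intro: smooth_elem_smooth elem_smooth.const)

text \<open>The supremum in \<open>norm_Hm1\<close> needs a nonempty index set.\<close>

lemma zero_in_unit_ball: "0 \<in> {v \<in> H10 \<Omega>. norm_H10 \<Omega> v \<le> 1}"
  using test_function_H10[OF test_function_zero] H1_scaleR(3)[OF test_function_H1(1)[OF test_function_zero], of 0]
  by simp

lemma norm_Hm1_le:
  assumes "K \<ge> 0" "\<And>v. v \<in> H10 \<Omega> \<Longrightarrow> \<bar>l v\<bar> \<le> K * norm_H10 \<Omega> v"
  shows "norm_Hm1 \<Omega> l \<le> K"
  unfolding norm_Hm1_def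
proof (rule cSUP_least)
  fix v assume "v \<in> {v \<in> H10 \<Omega>. norm_H10 \<Omega> v \<le> 1}"
  then show "\<bar>l v\<bar> \<le> K"
    using assms(2)[of v] mult_left_le[of "norm_H10 \<Omega> v" K] assms(1) by simp
qed (use zero_in_unit_ball in blast)

lemma Hm1I:
  assumes "\<And>v w. v \<in> H10 \<Omega> \<Longrightarrow> w \<in> H10 \<Omega> \<Longrightarrow> l (v + w) = l v + l w"
    "\<And>v r. v \<in> H10 \<Omega> \<Longrightarrow> l (r *\<^sub>R v) = r * l v" "\<And>v. v \<in> H10 \<Omega> \<Longrightarrow> \<bar>l v\<bar> \<le> C * norm_H10 \<Omega> v"
  shows "l \<in> Hm1 \<Omega>"
  using assms unfolding Hm1_def by blast

lemma Hm1_bdd_above: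
  assumes "l \<in> Hm1 \<Omega>"
  shows "bdd_above ((\<lambda>v. \<bar>l v\<bar>) ` {v \<in> H10 \<Omega>. norm_H10 \<Omega> v \<le> 1})"
proof -
  obtain C where C: "\<And>v. v \<in> H10 \<Omega> \<Longrightarrow> \<bar>l v\<bar> \<le> C * norm_H10 \<Omega> v"
    using assms unfolding Hm1_def by blast
  \<comment> \<open>\<open>Hm1\<close> admits a negative constant, hence |C|.\<close>
  have "\<bar>l v\<bar> \<le> \<bar>C\<bar>" if "v \<in> H10 \<Omega>" "norm_H10 \<Omega> v \<le> 1" for v
  proof -
    have "\<bar>l v\<bar> \<le> \<bar>C\<bar> * norm_H10 \<Omega> v"
      using C[OF that(1)] mult_right_mono[OF abs_ge_self[of C] norm_H10_nonneg[of v]] by linarith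
    then show ?thesis
      using mult_left_le[OF that(2), of "\<bar>C\<bar>"] by simp
  qed
  then show ?thesis by (intro bdd_aboveI2) auto
qed

lemma norm_Hm1_upper:
  assumes "l \<in> Hm1 \<Omega>" "v \<in> H10 \<Omega>" "norm_H10 \<Omega> v \<le> 1"
  shows "\<bar>l v\<bar> \<le> norm_Hm1 \<Omega> l"
  unfolding norm_Hm1_def using assms by (intro cSUP_upper Hm1_bdd_above) auto

lemma norm_Hm1_nonneg: "l \<in> Hm1 \<Omega> \<Longrightarrow> 0 \<le> norm_Hm1 \<Omega> l"
  using norm_Hm1_upper[of l 0] zero_in_unit_ball by force

lemma Hm1_scale: "l \<in> Hm1 \<Omega> \<Longrightarrow> v \<in> H10 \<Omega> \<Longrightarrow> l (r *\<^sub>R v) = r * l v"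
  by (simp add: Hm1_def)

lemma Hm1_bound:
  assumes "l \<in> Hm1 \<Omega>" "v \<in> H10 \<Omega>"
  shows "\<bar>l v\<bar> \<le> norm_Hm1 \<Omega> l * norm_H10 \<Omega> v"
proof (cases "norm_H10 \<Omega> v = 0")
  \<comment> \<open>Such a v cannot be normalised; the bound in \<open>Hm1\<close> gives l v = 0
    directly.\<close>
  case True
  then show ?thesis using assms by (fastforce simp: Hm1_def)
next
  case False
  then have pos: "norm_H10 \<Omega> v > 0" using norm_H10_nonneg[of v] by simp
  define r where "r = inverse (norm_H10 \<Omega> v)"
  have "norm_H10 \<Omega> (r *\<^sub>R v) = 1"
    using H1_scaleR(3)[OF H10_H1[OF assms(2)], of r] pos by (simp add: r_def)
  then have "\<bar>l (r *\<^sub>R v)\<bar> \<le> norm_Hm1 \<Omega> l"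
    using assms by (intro norm_Hm1_upper H10_scaleR) auto
  then have "\<bar>l v\<bar> / norm_H10 \<Omega> v \<le> norm_Hm1 \<Omega> l"
    using Hm1_scale[OF assms, of r] pos by (simp add: r_def abs_mult divide_inverse mult.commute)
  then show ?thesis using pos by (simp add: pos_divide_le_eq)
qed

lemma Hm1_add:
  assumes "l \<in> Hm1 \<Omega>" "m \<in> Hm1 \<Omega>" shows "l + m \<in> Hm1 \<Omega>"
proof (rule Hm1I)
  show "\<bar>(l + m) v\<bar> \<le> (norm_Hm1 \<Omega> l + norm_Hm1 \<Omega> m) * norm_H10 \<Omega> v" if "v \<in> H10 \<Omega>" for v
    using Hm1_bound[OF assms(1) that] Hm1_bound[OF assms(2) that] by (simp add: distrib_right)
qed (use assms in \<open>simp_all add: Hm1_def distrib_left\<close>)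

lemma Hm1_scaleR:
  assumes "l \<in> Hm1 \<Omega>" shows "r *\<^sub>R l \<in> Hm1 \<Omega>"
proof (rule Hm1I)
  show "\<bar>(r *\<^sub>R l) v\<bar> \<le> (\<bar>r\<bar> * norm_Hm1 \<Omega> l) * norm_H10 \<Omega> v" if "v \<in> H10 \<Omega>" for v
    using mult_left_mono[OF Hm1_bound[OF assms that], of "\<bar>r\<bar>"]
    by (simp add: scaleR_fun_def[of r l] abs_mult mult.assoc)
qed (use assms in \<open>simp_all add: Hm1_def scaleR_fun_def[of r l] distrib_left\<close>)

lemma subspace_Hm1: "subspace (Hm1 \<Omega>)"
  unfolding subspace_def by (auto simp: Hm1_add Hm1_scaleR) (auto simp: Hm1_def intro: exI[of _ 0])

lemma Hm1_diff: "l \<in> Hm1 \<Omega> \<Longrightarrow> m \<in> Hm1 \<Omega> \<Longrightarrow> l - m \<in> Hm1 \<Omega>"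
  by (rule subspace_diff[OF subspace_Hm1])

lemma norm_Hm1_triangle:
  assumes "l \<in> Hm1 \<Omega>" "m \<in> Hm1 \<Omega>"
  shows "norm_Hm1 \<Omega> (l + m) \<le> norm_Hm1 \<Omega> l + norm_Hm1 \<Omega> m"
proof (rule norm_Hm1_le)
  show "\<bar>(l + m) v\<bar> \<le> (norm_Hm1 \<Omega> l + norm_Hm1 \<Omega> m) * norm_H10 \<Omega> v" if "v \<in> H10 \<Omega>" for v
    using Hm1_bound[OF assms(1) that] Hm1_bound[OF assms(2) that] by (simp add: distrib_right)
qed (use assms norm_Hm1_nonneg in auto)

lemma norm_Hm1_scaleR:
  assumes "l \<in> Hm1 \<Omega>" shows "norm_Hm1 \<Omega> (r *\<^sub>R l) = \<bar>r\<bar> * norm_Hm1 \<Omega> l"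
proof -
  have le: "norm_Hm1 \<Omega> (s *\<^sub>R m) \<le> \<bar>s\<bar> * norm_Hm1 \<Omega> m" if "m \<in> Hm1 \<Omega>" for s m
  proof (rule norm_Hm1_le)
    show "\<bar>(s *\<^sub>R m) v\<bar> \<le> (\<bar>s\<bar> * norm_Hm1 \<Omega> m) * norm_H10 \<Omega> v" if v: "v \<in> H10 \<Omega>" for v
      using mult_left_mono[OF Hm1_bound[OF \<open>m \<in> _\<close> v], of "\<bar>s\<bar>"]
      by (simp add: scaleR_fun_def abs_mult mult.assoc)
  qed (use norm_Hm1_nonneg[OF that] in auto)
  show ?thesis
  proof (cases "r = 0")
    case True
    then show ?thesis
      using le[OF assms, of 0] norm_Hm1_nonneg[OF Hm1_scaleR[OF assms, of 0]] by simp
  next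
    case False
    then have "norm_Hm1 \<Omega> l \<le> \<bar>inverse r\<bar> * norm_Hm1 \<Omega> (r *\<^sub>R l)"
      using le[OF Hm1_scaleR[OF assms, of r], of "inverse r"] by simp
    then have "\<bar>r\<bar> * norm_Hm1 \<Omega> l \<le> norm_Hm1 \<Omega> (r *\<^sub>R l)"
      using False by (simp add: divide_simps mult.commute)
    then show ?thesis using le[OF assms, of r] by simp
  qed
qed

lemma norm_Hm1_diff_zero_eq:
  assumes "l \<in> Hm1 \<Omega>" "m \<in> Hm1 \<Omega>" "norm_Hm1 \<Omega> (l - m) = 0" "v \<in> H10 \<Omega>"
  shows "l v = m v"
  using Hm1_bound[OF Hm1_diff[OF assms(1,2)] assms(4)] assms(3) by simp

text \<open>Here k may lie outside \<open>Hm1\<close>, so the triangle inequality does not apply; l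
  and m agree on \<open>H10\<close>, hence the two suprema agree term by term.
  \<open>bochner_integral_in_cong\<close> asks for exactly this generality.\<close>

lemma norm_Hm1_diff_cong:
  assumes "l \<in> Hm1 \<Omega>" "m \<in> Hm1 \<Omega>" "norm_Hm1 \<Omega> (l - m) = 0"
  shows "norm_Hm1 \<Omega> (l - k) = norm_Hm1 \<Omega> (m - k)"
  unfolding norm_Hm1_def using norm_Hm1_diff_zero_eq[OF assms] by (intro SUP_cong) auto

text \<open>Supplies the nearly extremal arguments from which uniqueness of weak time derivatives
  builds a countable family.\<close>

lemma norm_Hm1_approx:
  assumes "l \<in> Hm1 \<Omega>" "e > 0"
  shows "\<exists>v. v \<in> H10 \<Omega> \<and> norm_H10 \<Omega> v \<le> 1 \<and> norm_Hm1 \<Omega> l \<le> \<bar>l v\<bar> + e"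
proof (rule ccontr)
  assume "\<not> ?thesis"
  then have "\<bar>l v\<bar> \<le> norm_Hm1 \<Omega> l - e" if "v \<in> {v \<in> H10 \<Omega>. norm_H10 \<Omega> v \<le> 1}" for v
    using that by force
  then have "norm_Hm1 \<Omega> l \<le> norm_Hm1 \<Omega> l - e"
    using zero_in_unit_ball
    by (subst norm_Hm1_def) (rule cSUP_least, blast, blast)
  then show False using assms(2) by simp
qed

text \<open>Cauchy-Schwarz bounds the pairing in L2 norms; Poincare turns the norm of v into its
  gradient norm.\<close>

lemma L2_embed_Hm1:
  assumes "square_integrable M u" shows "L2_embed \<Omega> u \<in> Hm1 \<Omega>"
proof -
  obtain C where C: "C \<ge> 0" "\<And>v. v \<in> H10 \<Omega> \<Longrightarrow> L2_norm M v \<le> C * norm_H10 \<Omega> v"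
    using Poincare by blast
  have int: "integrable M (\<lambda>x. u x * v x)" if "v \<in> H10 \<Omega>" for v
    using square_integrable_inner[OF assms H1_weak_grad(1)[OF H10_H1[OF that]]] by simp
  show ?thesis
  proof (rule Hm1I)
    fix v assume v: "v \<in> H10 \<Omega>"
    have "\<bar>L2_embed \<Omega> u v\<bar> \<le> L2_norm M u * L2_norm M v"
      using L2_Cauchy_Schwarz[OF assms H1_weak_grad(1)[OF H10_H1[OF v]]] by (simp add: L2_embed_def)
    also have "\<dots> \<le> L2_norm M u * (C * norm_H10 \<Omega> v)"
      by (intro mult_left_mono C v L2_norm_nonneg)
    finally show "\<bar>L2_embed \<Omega> u v\<bar> \<le> (L2_norm M u * C) * norm_H10 \<Omega> v" by (simp add: mult.assoc)
  qed (use int in \<open>simp_all add: L2_embed_def scaleR_fun_def distrib_left mult.left_commute\<close>)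
qed

lemma L2_embed_scaleR: "L2_embed \<Omega> (r *\<^sub>R u) = r *\<^sub>R L2_embed \<Omega> u"
  by (simp add: L2_embed_def scaleR_fun_def fun_eq_iff mult.assoc)

lemma grad_inner_eq:
  assumes "u \<in> H1 \<Omega>" "v \<in> H1 \<Omega>"
    and "AE x in M. weak_grad \<Omega> u x = g x" "AE x in M. weak_grad \<Omega> v x = h x"
    "square_integrable M g" "square_integrable M h"
  shows "grad_inner \<Omega> u v = (\<integral>x. g x \<bullet> h x \<partial>M)"
  unfolding grad_inner_def
proof (rule integral_cong_AE)
  show "AE x in M. weak_grad \<Omega> u x \<bullet> weak_grad \<Omega> v x = g x \<bullet> h x"
    using assms(3,4) by eventually_elim simp
qed (use H1_weak_grad(2)[OF assms(1)] H1_weak_grad(2)[OF assms(2)] assms(5,6)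
      in \<open>auto simp: square_integrable_def\<close>)

lemma grad_inner_scaleR_left:
  assumes "u \<in> H1 \<Omega>" "v \<in> H1 \<Omega>"
  shows "grad_inner \<Omega> (r *\<^sub>R u) v = r * grad_inner \<Omega> u v"
  by (subst grad_inner_eq[OF H1_scaleR(1)[OF assms(1)] assms(2) H1_scaleR(2)[OF assms(1)] AE_I2[OF refl]])
     (simp_all add: grad_inner_def square_integrable_scaleR H1_weak_grad assms)

lemma grad_inner_commute: "grad_inner \<Omega> u v = grad_inner \<Omega> v u"
  by (simp add: grad_inner_def inner_commute)

end

section \<open>Bochner spaces and weak time derivatives\<close>

text \<open>On the line spanned by x the seminorm is c times the absolute value, so vector-valued
  questions become scalar. Conditions on that line alone let one lemma serve both \<open>H10\<close>
  and \<open>Hm1\<close>.\<close>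

lemma strongly_measurable_tensor:
  assumes "h \<in> borel_measurable M" and X: "\<And>r. r *\<^sub>R x \<in> X" and N: "\<And>r. N (r *\<^sub>R x) = \<bar>r\<bar> * c"
  shows "strongly_measurable M X N (\<lambda>t. h t *\<^sub>R x)"
proof -
  obtain s where s: "\<And>i. simple_function M (s i)" "\<And>t. t \<in> space M \<Longrightarrow> (\<lambda>i. s i t) \<longlonglongrightarrow> h t"
    using borel_measurable_implies_sequence_metric[OF assms(1), of 0] by blast
  have "(\<lambda>i. N (h t *\<^sub>R x - s i t *\<^sub>R x)) \<longlonglongrightarrow> 0" if "t \<in> space M" for t
  proof -
    have "(\<lambda>i. \<bar>h t - s i t\<bar> * c) \<longlonglongrightarrow> \<bar>h t - h t\<bar> * c"
      by (intro tendsto_intros s that)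
    then show ?thesis by (simp add: N flip: scaleR_diff_left)
  qed
  then show ?thesis
    unfolding strongly_measurable_def using X s(1)
    by (intro conjI exI[of _ "\<lambda>i t. s i t *\<^sub>R x"]) (auto intro: simple_function_compose1)
qed

lemma bochner_L2_tensor:
  assumes "square_integrable (lebesgue_on {0..T}) h"
    and X: "\<And>r. r *\<^sub>R x \<in> X" and N: "\<And>r. N (r *\<^sub>R x) = \<bar>r\<bar> * c"
  shows "(\<lambda>t. h t *\<^sub>R x) \<in> bochner_L2 T X N"
    and "c \<ge> 0 \<Longrightarrow> norm_bochner_L2 T N (\<lambda>t. h t *\<^sub>R x) = L2_norm (lebesgue_on {0..T}) h * c"
proof -
  have "integrable (lebesgue_on {0..T}) (\<lambda>t. (N (h t *\<^sub>R x))\<^sup>2)"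
    using assms(1) by (simp add: N power_mult_distrib square_integrable_def)
  then show "(\<lambda>t. h t *\<^sub>R x) \<in> bochner_L2 T X N"
    using assms by (auto simp: bochner_L2_def square_integrable_def intro: strongly_measurable_tensor)
  show "norm_bochner_L2 T N (\<lambda>t. h t *\<^sub>R x) = L2_norm (lebesgue_on {0..T}) h * c" if "c \<ge> 0"
    using that by (simp add: norm_bochner_L2_def L2_norm_def N power_mult_distrib real_sqrt_mult)
qed

text \<open>The simple functions approximating the scalar h, multiplied by x, approximate the
  vector-valued function; both limits pick up the factor c.\<close>

lemma bochner_integral_tensor:
  assumes h: "integrable M h" and X: "\<And>r. r *\<^sub>R x \<in> X" and N: "\<And>r. N (r *\<^sub>R x) = \<bar>r\<bar> * c"
  shows "bochner_integral_in M X N (\<lambda>t. h t *\<^sub>R x) ((\<integral>t. h t \<partial>M) *\<^sub>R x)"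
proof -
  obtain s where s: "\<And>i. Bochner_Integration.simple_bochner_integrable M (s i)"
    "(\<lambda>i. \<integral>\<^sup>+t. norm (h t - s i t) \<partial>M) \<longlonglongrightarrow> 0"
    "(\<lambda>i. Bochner_Integration.simple_bochner_integral M (s i)) \<longlonglongrightarrow> (\<integral>t. h t \<partial>M)"
    using has_bochner_integral_integrable[OF h] unfolding has_bochner_integral.simps by blast
  have [measurable]: "h \<in> borel_measurable M" using h by simp
  have [measurable]: "s i \<in> borel_measurable M" for i
    using s(1)[of i] by (auto elim: simple_bochner_integrable.cases intro: borel_measurable_simple_function)
  have si: "Bochner_Integration.simple_bochner_integrable M (\<lambda>t. s i t *\<^sub>R x)" for i
    by (rule simple_bochner_integrable_compose2[of "\<lambda>a _. a *\<^sub>R x", OF _ s(1) s(1)]) simp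
  have "linear (\<lambda>r. r *\<^sub>R x)" by (rule linearI) (simp_all add: scaleR_left_distrib)
  then have int_s: "Bochner_Integration.simple_bochner_integral M (\<lambda>t. s i t *\<^sub>R x)
      = Bochner_Integration.simple_bochner_integral M (s i) *\<^sub>R x" for i
    by (rule simple_bochner_integral_linear) (rule s)
  have "(\<integral>\<^sup>+t. ennreal (N (h t *\<^sub>R x - s i t *\<^sub>R x)) \<partial>M) = ennreal c * (\<integral>\<^sup>+t. norm (h t - s i t) \<partial>M)" for i
  proof -
    have "(\<integral>\<^sup>+t. ennreal (N (h t *\<^sub>R x - s i t *\<^sub>R x)) \<partial>M) = (\<integral>\<^sup>+t. ennreal c * norm (h t - s i t) \<partial>M)"
      by (simp add: N ennreal_mult' mult.commute[of "ennreal c"] flip: scaleR_diff_left)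
    also have "\<dots> = ennreal c * (\<integral>\<^sup>+t. norm (h t - s i t) \<partial>M)"
      by (rule nn_integral_cmult) measurable
    finally show ?thesis .
  qed
  then have "(\<lambda>i. \<integral>\<^sup>+t. ennreal (N (h t *\<^sub>R x - s i t *\<^sub>R x)) \<partial>M) \<longlonglongrightarrow> 0"
    using ennreal_tendsto_cmult[OF _ s(2), of "ennreal c"] by simp
  moreover have "(\<lambda>i. N (Bochner_Integration.simple_bochner_integral M (s i) *\<^sub>R x - (\<integral>t. h t \<partial>M) *\<^sub>R x)) \<longlonglongrightarrow> 0"
  proof -
    have "(\<lambda>i. \<bar>Bochner_Integration.simple_bochner_integral M (s i) - (\<integral>t. h t \<partial>M)\<bar> * c)
        \<longlonglongrightarrow> \<bar>(\<integral>t. h t \<partial>M) - (\<integral>t. h t \<partial>M)\<bar> * c"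
      by (intro tendsto_intros s(3))
    then show ?thesis by (simp add: N flip: scaleR_diff_left)
  qed
  ultimately show ?thesis
    unfolding bochner_integral_in_def using X si int_s strongly_measurable_tensor[of h M x X N, OF _ X N]
    by (intro conjI exI[of _ "\<lambda>i t. s i t *\<^sub>R x"]) auto
qed

lemma bochner_integral_in_cong:
  assumes "bochner_integral_in M X N f y" "g \<in> space M \<rightarrow> X"
    and AE: "AE t in M. \<forall>z. N (f t - z) = N (g t - z)"
  shows "bochner_integral_in M X N g y"
proof -
  obtain s where s: "\<And>i. simple_function M (s i)" "\<And>i. s i \<in> space M \<rightarrow> X"
    "AE t in M. (\<lambda>i. N (f t - s i t)) \<longlonglongrightarrow> 0"
    using assms(1) unfolding bochner_integral_in_def strongly_measurable_def by blast
  have "AE t in M. (\<lambda>i. N (g t - s i t)) \<longlonglongrightarrow> 0"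
    using s(3) AE by eventually_elim simp
  then have "strongly_measurable M X N g"
    unfolding strongly_measurable_def using s assms(2) by blast
  moreover have "(\<integral>\<^sup>+t. ennreal (N (f t - s t)) \<partial>M) = (\<integral>\<^sup>+t. ennreal (N (g t - s t)) \<partial>M)" for s
    by (rule nn_integral_cong_AE) (use AE in eventually_elim, simp)
  ultimately show ?thesis
    using assms(1) unfolding bochner_integral_in_def by simp
qed

text \<open>Lebesgue measure is complete; extension by 0 reduces the claim to the whole
  space.\<close>

lemma borel_measurable_lebesgue_on_AE:
  fixes f g :: "'a::euclidean_space \<Rightarrow> real"
  assumes "f \<in> borel_measurable (lebesgue_on S)" "AE x in lebesgue_on S. f x = g x" "S \<in> sets lebesgue"
  shows "g \<in> borel_measurable (lebesgue_on S)"
proof -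
  have "(\<lambda>x. if x \<in> S then f x else 0) \<in> borel_measurable lebesgue"
    using assms(1,3) borel_measurable_if by blast
  moreover have "AE x in lebesgue. (if x \<in> S then f x else 0) = (if x \<in> S then g x else 0)"
  proof -
    have "AE x in lebesgue. x \<in> S \<longrightarrow> f x = g x"
      using assms(2,3) by (simp add: AE_restrict_space_iff)
    then show ?thesis by eventually_elim auto
  qed
  ultimately have "(\<lambda>x. if x \<in> S then g x else 0) \<in> borel_measurable lebesgue"
    by (rule borel_measurable_AE)
  then show ?thesis using assms(3) borel_measurable_if by blast
qed

lemma strongly_measurable_space: "strongly_measurable M X N f \<Longrightarrow> t \<in> space M \<Longrightarrow> f t \<in> X"
  by (auto simp: strongly_measurable_def)

lemma bochner_L2_mem: "f \<in> bochner_L2 T X N \<Longrightarrow> t \<in> {0..T} \<Longrightarrow> f t \<in> X"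
  by (auto simp: bochner_L2_def strongly_measurable_def space_restrict_space)

lemma finite_measure_Icc: "finite_measure (lebesgue_on {0..T :: real})"
  by standard (simp add: emeasure_restrict_space space_restrict_space emeasure_lborel_Icc_eq)

section \<open>Evaluation of dual-valued functions and uniqueness of weak time derivatives\<close>

context bounded_open
begin

text \<open>Evaluation at v is bounded by the seminorm, so almost everywhere \<open>F t v\<close> is
  the limit of the evaluated simple functions. Completeness absorbs the exceptional null
  set.\<close>

lemma strongly_measurable_eval:
  fixes T :: real
  assumes F: "strongly_measurable (lebesgue_on {0..T}) (Hm1 \<Omega>) (norm_Hm1 \<Omega>) F" and v: "v \<in> H10 \<Omega>"
  shows "(\<lambda>t. F t v) \<in> borel_measurable (lebesgue_on {0..T})"
proof -
  let ?I = "lebesgue_on {0..T}"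
  obtain s where s: "\<And>i. simple_function ?I (s i)" "\<And>i. s i \<in> space ?I \<rightarrow> Hm1 \<Omega>"
    "AE t in ?I. (\<lambda>i. norm_Hm1 \<Omega> (F t - s i t)) \<longlonglongrightarrow> 0"
    using F unfolding strongly_measurable_def by blast
  have [measurable]: "(\<lambda>t. s i t v) \<in> borel_measurable ?I" for i
    by (rule borel_measurable_simple_function[OF simple_function_compose1[OF s(1)]])
  have ae: "AE t in ?I. lim (\<lambda>i. s i t v) = F t v"
    using s(3) AE_space
  proof eventually_elim
    case (elim t)
    have "(\<lambda>i. s i t v - F t v) \<longlonglongrightarrow> 0"
    proof (rule Lim_null_comparison)
      show "\<forall>\<^sub>F i in sequentially. norm (s i t v - F t v) \<le> norm_Hm1 \<Omega> (F t - s i t) * norm_H10 \<Omega> v"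
      proof (rule always_eventually, rule allI)
        fix i
        have "F t - s i t \<in> Hm1 \<Omega>"
          using elim(2) s(2)[of i] strongly_measurable_space[OF F] by (intro Hm1_diff) auto
        from Hm1_bound[OF this v] show "norm (s i t v - F t v) \<le> norm_Hm1 \<Omega> (F t - s i t) * norm_H10 \<Omega> v"
          by (simp add: abs_minus_commute)
      qed
      show "(\<lambda>i. norm_Hm1 \<Omega> (F t - s i t) * norm_H10 \<Omega> v) \<longlonglongrightarrow> 0"
        using tendsto_mult_right[OF elim(1), of "norm_H10 \<Omega> v"] by simp
    qed
    then show ?case by (intro limI) (simp add: LIM_zero_iff)
  qed
  have "(\<lambda>t. lim (\<lambda>i. s i t v)) \<in> borel_measurable ?I" by measurable
  from borel_measurable_lebesgue_on_AE[OF this ae] show ?thesis by simp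
qed

text \<open>Evaluation at v is linear on simple functions and bounded in the seminorm, so it
  commutes with the integral. This replaces a dual-valued integral by an ordinary scalar
  one.\<close>

lemma bochner_integral_eval:
  fixes T :: real
  assumes F: "bochner_integral_in (lebesgue_on {0..T}) (Hm1 \<Omega>) (norm_Hm1 \<Omega>) F y"
    and v: "v \<in> H10 \<Omega>" "norm_H10 \<Omega> v \<le> 1"
  shows "(\<integral>t. F t v \<partial>lebesgue_on {0..T}) = y v"
proof -
  let ?I = "lebesgue_on {0..T}"
  obtain s where s: "\<And>i. Bochner_Integration.simple_bochner_integrable ?I (s i)" "\<And>i. s i \<in> space ?I \<rightarrow> Hm1 \<Omega>"
    "(\<lambda>i. \<integral>\<^sup>+t. ennreal (norm_Hm1 \<Omega> (F t - s i t)) \<partial>?I) \<longlonglongrightarrow> 0"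
    "(\<lambda>i. norm_Hm1 \<Omega> (Bochner_Integration.simple_bochner_integral ?I (s i) - y)) \<longlonglongrightarrow> 0"
    and Fm: "strongly_measurable ?I (Hm1 \<Omega>) (norm_Hm1 \<Omega>) F" and y: "y \<in> Hm1 \<Omega>"
  proof -
    have "strongly_measurable ?I (Hm1 \<Omega>) (norm_Hm1 \<Omega>) F" "y \<in> Hm1 \<Omega>"
      using F by (simp_all only: bochner_integral_in_def)
    moreover obtain s where "(\<forall>i. Bochner_Integration.simple_bochner_integrable ?I (s i) \<and> s i \<in> space ?I \<rightarrow> Hm1 \<Omega>) \<and>
      (\<lambda>i. \<integral>\<^sup>+t. ennreal (norm_Hm1 \<Omega> (F t - s i t)) \<partial>?I) \<longlonglongrightarrow> 0 \<and>
      (\<lambda>i. norm_Hm1 \<Omega> (Bochner_Integration.simple_bochner_integral ?I (s i) - y)) \<longlonglongrightarrow> 0"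
      using F by (auto simp only: bochner_integral_in_def)
    ultimately show ?thesis by (intro that[of s]) simp_all
  qed
  let ?S = "\<lambda>i. Bochner_Integration.simple_bochner_integral ?I (s i)"
  have S: "?S i \<in> Hm1 \<Omega>" for i
    unfolding simple_bochner_integral_def using s(2)[of i]
    by (intro subspace_sum[OF subspace_Hm1] Hm1_scaleR) auto
  have lin: "linear (\<lambda>l. l v :: real)"
    by (rule linearI) (simp_all add: scaleR_fun_def)
  have "has_bochner_integral ?I (\<lambda>t. F t v) (y v)"
  proof (rule has_bochner_integral.intros)
    show "(\<lambda>t. F t v) \<in> borel_measurable ?I" by (rule strongly_measurable_eval[OF Fm v(1)])
    show "Bochner_Integration.simple_bochner_integrable ?I (\<lambda>t. s i t v)" for i
      by (rule simple_bochner_integrable_compose2[of "\<lambda>a _. a v", OF _ s(1) s(1)]) simp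
    show "(\<lambda>i. \<integral>\<^sup>+t. norm (F t v - s i t v) \<partial>?I) \<longlonglongrightarrow> 0"
    proof (rule tendsto_sandwich[OF _ _ tendsto_const])
      have "\<bar>F t v - s i t v\<bar> \<le> norm_Hm1 \<Omega> (F t - s i t)" if "t \<in> space ?I" for t i
      proof -
        have "F t - s i t \<in> Hm1 \<Omega>"
          using that s(2)[of i] strongly_measurable_space[OF Fm] by (intro Hm1_diff) auto
        from norm_Hm1_upper[OF this v] show ?thesis by simp
      qed
      then have "(\<integral>\<^sup>+t. norm (F t v - s i t v) \<partial>?I) \<le> (\<integral>\<^sup>+t. ennreal (norm_Hm1 \<Omega> (F t - s i t)) \<partial>?I)" for i
        by (intro nn_integral_mono) (simp add: ennreal_leI)
      then show "\<forall>\<^sub>F i in sequentially. (\<integral>\<^sup>+t. norm (F t v - s i t v) \<partial>?I)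
          \<le> (\<integral>\<^sup>+t. ennreal (norm_Hm1 \<Omega> (F t - s i t)) \<partial>?I)" by simp
    qed (simp_all add: s(3))
    have "(\<lambda>i. ?S i v - y v) \<longlonglongrightarrow> 0"
    proof (rule Lim_null_comparison)
      show "\<forall>\<^sub>F i in sequentially. norm (?S i v - y v) \<le> norm_Hm1 \<Omega> (?S i - y) * norm_H10 \<Omega> v"
        using Hm1_bound[OF Hm1_diff[OF S y] v(1)] by simp
      show "(\<lambda>i. norm_Hm1 \<Omega> (?S i - y) * norm_H10 \<Omega> v) \<longlonglongrightarrow> 0"
        using tendsto_mult_right[OF s(4), of "norm_H10 \<Omega> v"] by simp
    qed
    moreover have "Bochner_Integration.simple_bochner_integral ?I (\<lambda>t. s i t v) = ?S i v" for i
      by (rule simple_bochner_integral_linear[OF lin s(1)])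
    ultimately show "(\<lambda>i. Bochner_Integration.simple_bochner_integral ?I (\<lambda>t. s i t v)) \<longlonglongrightarrow> y v"
      by (simp add: LIM_zero_iff)
  qed
  then show ?thesis by (rule has_bochner_integral_integral_eq)
qed

lemma bochner_L2_eval:
  assumes g: "g \<in> bochner_L2 T (Hm1 \<Omega>) (norm_Hm1 \<Omega>)" and v: "v \<in> H10 \<Omega>"
  shows "square_integrable (lebesgue_on {0..T}) (\<lambda>t. g t v)"
  unfolding square_integrable_def
proof
  show meas: "(\<lambda>t. g t v) \<in> borel_measurable (lebesgue_on {0..T})"
    using g v by (intro strongly_measurable_eval) (auto simp: bochner_L2_def)
  show "integrable (lebesgue_on {0..T}) (\<lambda>t. (norm (g t v))\<^sup>2)"
  proof (rule Bochner_Integration.integrable_bound)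
    show "integrable (lebesgue_on {0..T}) (\<lambda>t. (norm_H10 \<Omega> v)\<^sup>2 * (norm_Hm1 \<Omega> (g t))\<^sup>2)"
      using g by (simp add: bochner_L2_def)
    show "(\<lambda>t. (norm (g t v))\<^sup>2) \<in> borel_measurable (lebesgue_on {0..T})" using meas by measurable
    have "(norm (g t v))\<^sup>2 \<le> (norm_H10 \<Omega> v)\<^sup>2 * (norm_Hm1 \<Omega> (g t))\<^sup>2" if "t \<in> {0..T}" for t
      using power_mono[OF Hm1_bound[OF bochner_L2_mem[OF g that] v], of 2]
      by (simp add: power_mult_distrib mult.commute)
    then show "AE t in lebesgue_on {0..T}. norm ((norm (g t v))\<^sup>2) \<le> norm ((norm_H10 \<Omega> v)\<^sup>2 * (norm_Hm1 \<Omega> (g t))\<^sup>2)"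
      by (intro AE_I2) (simp add: space_restrict_space)
  qed
qed

text \<open>Evaluation at a fixed \<open>v\<close> reduces to the scalar fundamental lemma; the exceptional null sets are
  then controlled by countably many \<open>v\<close>, which nearly attain the norms of the values of
  approximating simple functions.\<close>

lemma weak_time_deriv_unique:
  assumes g: "g \<in> bochner_L2 T (Hm1 \<Omega>) (norm_Hm1 \<Omega>)" "is_weak_time_deriv T (Hm1 \<Omega>) (norm_Hm1 \<Omega>) f g"
    and h: "h \<in> bochner_L2 T (Hm1 \<Omega>) (norm_Hm1 \<Omega>)" "is_weak_time_deriv T (Hm1 \<Omega>) (norm_Hm1 \<Omega>) f h"
  shows "AE t in lebesgue_on {0..T}. norm_Hm1 \<Omega> (g t - h t) = 0"
proof -
  let ?I = "lebesgue_on {0..T}"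
  \<comment> \<open>Test functions on the open interval say nothing about its endpoints, which form
    a null set.\<close>
  have ends: "AE t in ?I. t \<noteq> 0 \<and> t \<noteq> T"
  proof -
    have "AE t in lebesgue. t \<notin> {0, T}" by (rule AE_not_in) (auto intro: null_sets_completionI)
    then show ?thesis by (simp add: AE_restrict_space_iff) (auto elim: eventually_mono)
  qed
  have eval: "AE t in ?I. g t v = h t v" if v: "v \<in> H10 \<Omega>" "norm_H10 \<Omega> v \<le> 1" for v
  proof -
    note int = bochner_L2_eval[OF g(1) v(1)] bochner_L2_eval[OF h(1) v(1)]
    have "AE t in ?I. t \<in> {0<..<T} \<longrightarrow> g t v - h t v = 0"
    proof (rule fundamental_lemma_AE)
      show "integrable ?I (\<lambda>t. g t v - h t v)"
        using int[THEN square_integrable_integrable[OF finite_measure_Icc]] by simp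
      fix \<psi> assume \<psi>: "test_function {0<..<T} \<psi>"
      obtain y where y: "bochner_integral_in ?I (Hm1 \<Omega>) (norm_Hm1 \<Omega>) (\<lambda>t. deriv \<psi> t *\<^sub>R f t) y"
          "bochner_integral_in ?I (Hm1 \<Omega>) (norm_Hm1 \<Omega>) (\<lambda>t. - \<psi> t *\<^sub>R g t) y"
        using g(2) \<psi> unfolding is_weak_time_deriv_def by blast
      obtain z where z: "bochner_integral_in ?I (Hm1 \<Omega>) (norm_Hm1 \<Omega>) (\<lambda>t. deriv \<psi> t *\<^sub>R f t) z"
          "bochner_integral_in ?I (Hm1 \<Omega>) (norm_Hm1 \<Omega>) (\<lambda>t. - \<psi> t *\<^sub>R h t) z"
        using h(2) \<psi> unfolding is_weak_time_deriv_def by blast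
      \<comment> \<open>Both are integrals of \<open>deriv \<psi> t *\<^sub>R f t\<close>; such
        integrals are determined only up to seminorm 0, but their values at v coincide.\<close>
      have "y v = z v" using bochner_integral_eval[OF y(1) v] bochner_integral_eval[OF z(1) v] by simp
      then have "(\<integral>t. g t v * \<psi> t \<partial>?I) = (\<integral>t. h t v * \<psi> t \<partial>?I)"
        using bochner_integral_eval[OF y(2) v] bochner_integral_eval[OF z(2) v]
        by (simp add: scaleR_fun_def mult.commute)
      moreover have "square_integrable ?I \<psi>"
      proof -
        have "\<psi> \<in> borel_measurable ?I"
          by (intro measurable_restrict_space1 measurable_completion) (simp add: test_function_borel[OF \<psi>])
        moreover have "continuous_on {0..T} (\<lambda>t. (norm (\<psi> t))\<^sup>2)"
          by (intro continuous_intros test_function_continuous[OF \<psi>])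
        ultimately show ?thesis by (simp add: square_integrable_def continuous_imp_integrable_real)
      qed
      note square_integrable_inner[OF int(1) this] square_integrable_inner[OF int(2) this]
      ultimately show "(\<integral>t. (g t v - h t v) * \<psi> t \<partial>?I) = 0"
        by (simp add: left_diff_distrib)
    qed auto
    with ends AE_space show ?thesis
      by eventually_elim (auto simp: space_restrict_space)
  qed
  obtain s where s: "\<And>i. simple_function ?I (s i)" "\<And>i. s i \<in> space ?I \<rightarrow> Hm1 \<Omega>"
    "AE t in ?I. (\<lambda>i. norm_Hm1 \<Omega> (g t - s i t)) \<longlonglongrightarrow> 0"
    using g(1) unfolding bochner_L2_def strongly_measurable_def by blast
  obtain r where r: "\<And>i. simple_function ?I (r i)" "\<And>i. r i \<in> space ?I \<rightarrow> Hm1 \<Omega>"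
    "AE t in ?I. (\<lambda>i. norm_Hm1 \<Omega> (h t - r i t)) \<longlonglongrightarrow> 0"
    using h(1) unfolding bochner_L2_def strongly_measurable_def by blast
  \<comment> \<open>Each simple function has finite range, so the differences of approximating
    values form a countable set.\<close>
  define D where "D = (\<Union>i. (\<lambda>t. s i t - r i t) ` space ?I)"
  have "finite ((\<lambda>t. s i t - r i t) ` space ?I)" for i
    using simple_function_compose2[OF s(1) r(1), of "(-)"] by (rule simple_functionD)
  then have D: "countable D" unfolding D_def by (intro countable_UN) (auto intro: countable_finite)
  have "D \<subseteq> Hm1 \<Omega>" using s(2) r(2) by (auto simp: D_def intro!: Hm1_diff)
  then have "\<exists>v. v \<in> H10 \<Omega> \<and> norm_H10 \<Omega> v \<le> 1 \<and> norm_Hm1 \<Omega> d \<le> \<bar>d v\<bar> + inverse (real (Suc n))"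
    if "d \<in> D" for d n using that by (intro norm_Hm1_approx) auto
  then obtain V where V: "\<And>d n. d \<in> D \<Longrightarrow> V d n \<in> H10 \<Omega>" "\<And>d n. d \<in> D \<Longrightarrow> norm_H10 \<Omega> (V d n) \<le> 1"
    "\<And>d n. d \<in> D \<Longrightarrow> norm_Hm1 \<Omega> d \<le> \<bar>d (V d n)\<bar> + inverse (real (Suc n))" by metis
  have "AE t in ?I. \<forall>(d, n)\<in>D \<times> UNIV. g t (V d n) = h t (V d n)"
    by (rule AE_ball_countable') (use D V eval in auto)
  with s(3) r(3) AE_space show ?thesis
  proof eventually_elim
    case (elim t)
    then have mem: "g t \<in> Hm1 \<Omega>" "h t \<in> Hm1 \<Omega>" "\<And>i. s i t \<in> Hm1 \<Omega>" "\<And>i. r i t \<in> Hm1 \<Omega>"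
      using bochner_L2_mem[OF g(1)] bochner_L2_mem[OF h(1)] s(2)[THEN funcset_mem] r(2)[THEN funcset_mem]
      by (auto simp: space_restrict_space)
    \<comment> \<open>Split g t - h t = e + d with e the approximation error. The sum vanishes at
      \<open>V d i\<close>, where d nearly attains its norm, so the norm of d exceeds that of e by
      at most 1 / (i + 1). This explains the factor 2.\<close>
    have "norm_Hm1 \<Omega> (g t - h t) \<le> 2 * (norm_Hm1 \<Omega> (g t - s i t) + norm_Hm1 \<Omega> (h t - r i t)) + inverse (real (Suc i))" for i
    proof -
      define d where "d = s i t - r i t"
      have dD: "d \<in> D" using elim(3) unfolding D_def d_def by blast
      have dH: "d \<in> Hm1 \<Omega>" by (simp add: d_def Hm1_diff mem)
      define e where "e = (g t - s i t) + (-1) *\<^sub>R (h t - r i t)"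
      have eH: "e \<in> Hm1 \<Omega>" by (simp only: e_def Hm1_add Hm1_scaleR Hm1_diff mem)
      have e: "norm_Hm1 \<Omega> e \<le> norm_Hm1 \<Omega> (g t - s i t) + norm_Hm1 \<Omega> (h t - r i t)"
        using norm_Hm1_triangle[OF Hm1_diff[OF mem(1) mem(3)] Hm1_scaleR[OF Hm1_diff[OF mem(2) mem(4)], of "-1"]]
          norm_Hm1_scaleR[OF Hm1_diff[OF mem(2) mem(4)], of "-1"] by (simp add: e_def)
      have gh: "g t - h t = e + d" by (simp add: e_def d_def)
      have "e (V d i) + d (V d i) = 0"
        using elim(4) dD gh by (auto simp: fun_eq_iff dest!: bspec[of _ _ "(d, i)"]) (metis diff_self)
      then have "\<bar>d (V d i)\<bar> = \<bar>e (V d i)\<bar>" by linarith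
      also have "\<dots> \<le> norm_Hm1 \<Omega> e" by (rule norm_Hm1_upper[OF eH V(1,2)[OF dD]])
      finally have "norm_Hm1 \<Omega> d \<le> norm_Hm1 \<Omega> e + inverse (real (Suc i))"
        using V(3)[OF dD, of i] by linarith
      then have "norm_Hm1 \<Omega> e + norm_Hm1 \<Omega> d \<le> 2 * norm_Hm1 \<Omega> e + inverse (real (Suc i))"
        by simp
      also have "\<dots> \<le> 2 * (norm_Hm1 \<Omega> (g t - s i t) + norm_Hm1 \<Omega> (h t - r i t)) + inverse (real (Suc i))"
        using e by simp
      finally show ?thesis using order_trans[OF norm_Hm1_triangle[OF eH dH]] gh by simp
    qed
    moreover have "(\<lambda>i. 2 * (norm_Hm1 \<Omega> (g t - s i t) + norm_Hm1 \<Omega> (h t - r i t)) + inverse (real (Suc i)))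
        \<longlonglongrightarrow> 2 * (0 + 0) + 0"
      by (intro tendsto_intros elim LIMSEQ_inverse_real_of_nat)
    ultimately have "norm_Hm1 \<Omega> (g t - h t) \<le> 0"
      by (intro LIMSEQ_le_const[where a = "norm_Hm1 \<Omega> (g t - h t)"]) auto
    then show ?case using norm_Hm1_nonneg[OF Hm1_diff[OF mem(1,2)]] by simp
  qed
qed

text \<open>\<open>dtt\<close> differentiates the chosen representative \<open>dt\<close>, while
  computations differentiate an explicit function. The two differ by seminorm 0 at almost every
  time, and this must not matter.\<close>

lemma weak_time_deriv_cong:
  assumes f: "is_weak_time_deriv T (Hm1 \<Omega>) (norm_Hm1 \<Omega>) f h"
    and fg: "f \<in> {0..T} \<rightarrow> Hm1 \<Omega>" "g \<in> {0..T} \<rightarrow> Hm1 \<Omega>" "AE t in lebesgue_on {0..T}. norm_Hm1 \<Omega> (f t - g t) = 0"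
  shows "is_weak_time_deriv T (Hm1 \<Omega>) (norm_Hm1 \<Omega>) g h"
  unfolding is_weak_time_deriv_def
proof (intro allI impI)
  let ?I = "lebesgue_on {0..T}"
  fix \<psi> assume \<psi>: "test_function {0<..<T} \<psi>"
  obtain y where y: "bochner_integral_in ?I (Hm1 \<Omega>) (norm_Hm1 \<Omega>) (\<lambda>t. deriv \<psi> t *\<^sub>R f t) y"
      "bochner_integral_in ?I (Hm1 \<Omega>) (norm_Hm1 \<Omega>) (\<lambda>t. - \<psi> t *\<^sub>R h t) y"
    using f \<psi> unfolding is_weak_time_deriv_def by blast
  have "bochner_integral_in ?I (Hm1 \<Omega>) (norm_Hm1 \<Omega>) (\<lambda>t. deriv \<psi> t *\<^sub>R g t) y"
  proof (rule bochner_integral_in_cong[OF y(1)])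
    show "(\<lambda>t. deriv \<psi> t *\<^sub>R g t) \<in> space ?I \<rightarrow> Hm1 \<Omega>"
      using fg by (auto simp: space_restrict_space intro!: Hm1_scaleR)
    show "AE t in ?I. \<forall>z. norm_Hm1 \<Omega> (deriv \<psi> t *\<^sub>R f t - z) = norm_Hm1 \<Omega> (deriv \<psi> t *\<^sub>R g t - z)"
      using fg(3) AE_space
    proof eventually_elim
      case (elim t)
      then have mem: "f t \<in> Hm1 \<Omega>" "g t \<in> Hm1 \<Omega>" using fg by (auto simp: space_restrict_space)
      have "norm_Hm1 \<Omega> (deriv \<psi> t *\<^sub>R f t - deriv \<psi> t *\<^sub>R g t) = 0"
        using norm_Hm1_scaleR[OF Hm1_diff[OF mem], of "deriv \<psi> t"] elim(1)
        by (simp add: scaleR_diff_right)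
      then show ?case using norm_Hm1_diff_cong Hm1_scaleR mem by blast
    qed
  qed
  with y show "\<exists>y. bochner_integral_in ?I (Hm1 \<Omega>) (norm_Hm1 \<Omega>) (\<lambda>t. deriv \<psi> t *\<^sub>R g t) y \<and>
      bochner_integral_in ?I (Hm1 \<Omega>) (norm_Hm1 \<Omega>) (\<lambda>t. - \<psi> t *\<^sub>R h t) y"
    by blast
qed

lemma time_deriv:
  assumes "g \<in> bochner_L2 T (Hm1 \<Omega>) (norm_Hm1 \<Omega>)" "is_weak_time_deriv T (Hm1 \<Omega>) (norm_Hm1 \<Omega>) f g"
  shows "time_deriv T (Hm1 \<Omega>) (norm_Hm1 \<Omega>) f \<in> bochner_L2 T (Hm1 \<Omega>) (norm_Hm1 \<Omega>)"
    and "AE t in lebesgue_on {0..T}. norm_Hm1 \<Omega> (g t - time_deriv T (Hm1 \<Omega>) (norm_Hm1 \<Omega>) f t) = 0"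
proof -
  have "\<exists>g. g \<in> bochner_L2 T (Hm1 \<Omega>) (norm_Hm1 \<Omega>) \<and> is_weak_time_deriv T (Hm1 \<Omega>) (norm_Hm1 \<Omega>) f g"
    using assms by blast
  from someI_ex[OF this, folded time_deriv_def]
  show "time_deriv T (Hm1 \<Omega>) (norm_Hm1 \<Omega>) f \<in> bochner_L2 T (Hm1 \<Omega>) (norm_Hm1 \<Omega>)"
    and "AE t in lebesgue_on {0..T}. norm_Hm1 \<Omega> (g t - time_deriv T (Hm1 \<Omega>) (norm_Hm1 \<Omega>) f t) = 0"
    using weak_time_deriv_unique[OF assms] by blast+
qed

lemma dt_dtt:
  assumes "g \<in> bochner_L2 T (Hm1 \<Omega>) (norm_Hm1 \<Omega>)" "h \<in> bochner_L2 T (Hm1 \<Omega>) (norm_Hm1 \<Omega>)"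
    "is_weak_time_deriv T (Hm1 \<Omega>) (norm_Hm1 \<Omega>) (\<lambda>t. L2_embed \<Omega> (u t)) g"
    "is_weak_time_deriv T (Hm1 \<Omega>) (norm_Hm1 \<Omega>) g h"
  shows "AE t in lebesgue_on {0..T}. norm_Hm1 \<Omega> (g t - dt \<Omega> T u t) = 0"
    and "dt \<Omega> T u \<in> bochner_L2 T (Hm1 \<Omega>) (norm_Hm1 \<Omega>)"
    and "dtt \<Omega> T u \<in> bochner_L2 T (Hm1 \<Omega>) (norm_Hm1 \<Omega>)"
    and "AE t in lebesgue_on {0..T}. norm_Hm1 \<Omega> (h t - dtt \<Omega> T u t) = 0"
proof -
  show dt: "AE t in lebesgue_on {0..T}. norm_Hm1 \<Omega> (g t - dt \<Omega> T u t) = 0"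
    and dt2: "dt \<Omega> T u \<in> bochner_L2 T (Hm1 \<Omega>) (norm_Hm1 \<Omega>)"
    using time_deriv[OF assms(1,3)] by (auto simp: dt_def)
  have "is_weak_time_deriv T (Hm1 \<Omega>) (norm_Hm1 \<Omega>) (dt \<Omega> T u) h"
    by (rule weak_time_deriv_cong[OF assms(4) _ _ dt])
       (use bochner_L2_mem[OF assms(1)] bochner_L2_mem[OF dt2] in auto)
  from time_deriv[OF assms(2) this]
  show "dtt \<Omega> T u \<in> bochner_L2 T (Hm1 \<Omega>) (norm_Hm1 \<Omega>)"
    and "AE t in lebesgue_on {0..T}. norm_Hm1 \<Omega> (h t - dtt \<Omega> T u t) = 0"
    by (auto simp: dtt_def)
qed

lemma trial_space_dtt:
  assumes "u \<in> trial_space \<Omega> T" "t \<in> {0..T}" shows "dtt \<Omega> T u t \<in> Hm1 \<Omega>"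
proof -
  obtain g h where "g \<in> bochner_L2 T (Hm1 \<Omega>) (norm_Hm1 \<Omega>)" "h \<in> bochner_L2 T (Hm1 \<Omega>) (norm_Hm1 \<Omega>)"
    "is_weak_time_deriv T (Hm1 \<Omega>) (norm_Hm1 \<Omega>) (\<lambda>t. L2_embed \<Omega> (u t)) g"
    "is_weak_time_deriv T (Hm1 \<Omega>) (norm_Hm1 \<Omega>) g h"
    using assms(1) by (auto simp: trial_space_def bochner_H2_def)
  from bochner_L2_mem[OF dt_dtt(3)[OF this] assms(2)] show ?thesis .
qed

end

text \<open>Fundamental theorem of calculus for the product of \<psi> and w; the boundary terms
  vanish because \<psi> is 0 at both endpoints.\<close>

lemma test_function_IBP:
  fixes w w' :: "real \<Rightarrow> real"
  assumes \<psi>: "test_function {0<..<T} \<psi>" and w: "\<And>t. (w has_real_derivative w' t) (at t)" "continuous_on UNIV w'"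
    and T: "T > 0"
  shows "(\<integral>t. deriv \<psi> t * w t \<partial>lebesgue_on {0..T}) = (\<integral>t. - \<psi> t * w' t \<partial>lebesgue_on {0..T})"
    and "integrable (lebesgue_on {0..T}) (\<lambda>t. deriv \<psi> t * w t)"
    and "integrable (lebesgue_on {0..T}) (\<lambda>t. - \<psi> t * w' t)"
proof -
  let ?I = "lebesgue_on {0..T}"
  have \<psi>': "(\<psi> has_real_derivative deriv \<psi> t) (at t)" for t
    using test_function_differentiable[OF \<psi>] real_differentiableE DERIV_imp_deriv by metis
  have "deriv \<psi> t = frechet_derivative \<psi> (at t) 1" for t
    using frechet_derivative_at[OF \<psi>'[of t, unfolded has_field_derivative_def]] by (metis mult.right_neutral)
  then have c\<psi>': "continuous_on S (deriv \<psi>)" for S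
    using test_function_continuous[OF test_function_partial[OF \<psi>, of 1]] by simp
  have cw: "continuous_on S w" for S
    using w(1) by (meson DERIV_continuous continuous_at_imp_continuous_on)
  have cw': "continuous_on S w'" for S using w(2) by (rule continuous_on_subset) auto
  note c = cw cw' c\<psi>' test_function_continuous[OF \<psi>]
  show i1: "integrable ?I (\<lambda>t. deriv \<psi> t * w t)" and i2: "integrable ?I (\<lambda>t. - \<psi> t * w' t)"
    by (intro continuous_imp_integrable_real continuous_intros c)+
  have "((\<lambda>t. deriv \<psi> t * w t - (- \<psi> t * w' t)) has_integral \<psi> T * w T - \<psi> 0 * w 0) {0..T}"
  proof (rule fundamental_theorem_of_calculus)
    show "((\<lambda>t. \<psi> t * w t) has_vector_derivative deriv \<psi> t * w t - (- \<psi> t * w' t)) (at t within {0..T})" for t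
      using DERIV_mult[OF \<psi>' w(1), of t]
      by (auto simp: has_real_derivative_iff_has_vector_derivative add.commute mult.commute
          intro: has_vector_derivative_at_within)
  qed (use T in simp)
  moreover have "\<psi> T = 0" "\<psi> 0 = 0" using test_function_eq_0[OF \<psi>] by auto
  ultimately have "integral {0..T} (\<lambda>t. deriv \<psi> t * w t - (- \<psi> t * w' t)) = 0"
    by (simp add: integral_unique)
  moreover have "integral\<^sup>L ?I (\<lambda>t. deriv \<psi> t * w t - (- \<psi> t * w' t)) = integral {0..T} (\<lambda>t. deriv \<psi> t * w t - (- \<psi> t * w' t))"
    by (rule lebesgue_integral_eq_integral[OF Bochner_Integration.integrable_diff[OF i1 i2]]) simp
  ultimately show "(\<integral>t. deriv \<psi> t * w t \<partial>?I) = (\<integral>t. - \<psi> t * w' t \<partial>?I)"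
    using Bochner_Integration.integral_diff[OF i1 i2] by simp
qed

lemma continuous_square_integrable_Icc:
  assumes "continuous_on UNIV (w :: real \<Rightarrow> real)"
  shows "square_integrable (lebesgue_on {0..T}) w"
  unfolding square_integrable_def
proof
  show "w \<in> borel_measurable (lebesgue_on {0..T})"
    by (intro measurable_restrict_space1 measurable_completion) (simp add: borel_measurable_continuous_onI assms)
  show "integrable (lebesgue_on {0..T}) (\<lambda>t. (norm (w t))\<^sup>2)"
    using assms by (intro continuous_imp_integrable_real continuous_intros) (auto intro: continuous_on_subset)
qed

section \<open>Separated functions in the trial space\<close>

text \<open>The conditions on w at 0 become the two initial conditions of the trial space. In the
  dual, the values of the embedded function stay on the line spanned by \<open>l\<close>, so its
  time derivatives are those of the scalar w.\<close>

locale separated = bounded_open \<Omega> for \<Omega> :: "'a::euclidean_space set" +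
  fixes T :: real and w w' w'' :: "real \<Rightarrow> real" and \<phi> :: "'a \<Rightarrow> real"
  assumes T: "T > 0" and \<phi>: "test_function \<Omega> \<phi>"
    and w: "\<And>t. (w has_real_derivative w' t) (at t)" "\<And>t. (w' has_real_derivative w'' t) (at t)"
    and w''_continuous: "continuous_on UNIV w''" and w0: "w 0 = 0" "w' 0 = 0"
begin

definition l where "l = L2_embed \<Omega> \<phi>"

lemma l_Hm1: "r *\<^sub>R l \<in> Hm1 \<Omega>" and norm_l: "norm_Hm1 \<Omega> (r *\<^sub>R l) = \<bar>r\<bar> * norm_Hm1 \<Omega> l"
  unfolding l_def
  by (simp_all add: Hm1_scaleR norm_Hm1_scaleR L2_embed_Hm1 test_function_square_integrable \<phi>)

lemma w_continuous: "continuous_on S w" "continuous_on S w'"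
  using w by (meson DERIV_continuous continuous_at_imp_continuous_on)+

lemma weak_time_deriv_tensor:
  assumes "\<And>t. (h has_real_derivative h' t) (at t)" "continuous_on UNIV h'"
  shows "is_weak_time_deriv T (Hm1 \<Omega>) (norm_Hm1 \<Omega>) (\<lambda>t. h t *\<^sub>R l) (\<lambda>t. h' t *\<^sub>R l)"
  unfolding is_weak_time_deriv_def
proof (intro allI impI)
  fix \<psi> assume \<psi>: "test_function {0<..<T} \<psi>"
  note ibp = test_function_IBP[OF \<psi> assms T]
  show "\<exists>y. bochner_integral_in (lebesgue_on {0..T}) (Hm1 \<Omega>) (norm_Hm1 \<Omega>) (\<lambda>t. deriv \<psi> t *\<^sub>R h t *\<^sub>R l) y \<and>
      bochner_integral_in (lebesgue_on {0..T}) (Hm1 \<Omega>) (norm_Hm1 \<Omega>) (\<lambda>t. - \<psi> t *\<^sub>R h' t *\<^sub>R l) y"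
    using bochner_integral_tensor[OF ibp(2), of l "Hm1 \<Omega>" "norm_Hm1 \<Omega>", OF l_Hm1 norm_l]
      bochner_integral_tensor[OF ibp(3), of l "Hm1 \<Omega>" "norm_Hm1 \<Omega>", OF l_Hm1 norm_l]
    unfolding ibp(1) scaleR_scaleR by blast
qed

text \<open>\<open>h t *\<^sub>R l\<close> serves as the continuous representative. Equality almost
  everywhere is all that is known when f is \<open>dt\<close>.\<close>

lemma initial_value_tensor:
  assumes "continuous_on UNIV h" "h 0 = 0" "AE t in lebesgue_on {0..T}. norm_Hm1 \<Omega> (f t - h t *\<^sub>R l) = 0"
  shows "has_initial_value T (Hm1 \<Omega>) (norm_Hm1 \<Omega>) f 0"
  unfolding has_initial_value_def
proof (intro bexI[of _ "\<lambda>t. h t *\<^sub>R l"] conjI ballI)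
  fix t assume "t \<in> {0..T}"
  have "((\<lambda>s. \<bar>h s - h t\<bar> * norm_Hm1 \<Omega> l) \<longlongrightarrow> \<bar>h t - h t\<bar> * norm_Hm1 \<Omega> l) (at t within {0..T})"
    using assms(1) by (intro tendsto_intros) (auto simp: continuous_on_def intro: tendsto_within_subset)
  then show "((\<lambda>s. norm_Hm1 \<Omega> (h s *\<^sub>R l - h t *\<^sub>R l)) \<longlongrightarrow> 0) (at t within {0..T})"
    by (simp add: norm_l flip: scaleR_diff_left)
next
  show "norm_Hm1 \<Omega> (h 0 *\<^sub>R l - 0) = 0"
    using norm_l[of 0] assms(2) by simp
qed (use assms l_Hm1 in auto)

lemma tensor_L2:
  "continuous_on UNIV h \<Longrightarrow> (\<lambda>t. h t *\<^sub>R l) \<in> bochner_L2 T (Hm1 \<Omega>) (norm_Hm1 \<Omega>)"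
  by (rule bochner_L2_tensor(1)[of T h l "Hm1 \<Omega>" "norm_Hm1 \<Omega>", OF _ l_Hm1 norm_l])
     (rule continuous_square_integrable_Icc)

lemma embed_eq: "L2_embed \<Omega> (w t *\<^sub>R \<phi>) = w t *\<^sub>R l"
  by (simp add: l_def L2_embed_scaleR)

lemma dt_dtt_tensor:
  "AE t in lebesgue_on {0..T}. norm_Hm1 \<Omega> (w' t *\<^sub>R l - dt \<Omega> T (\<lambda>t. w t *\<^sub>R \<phi>) t) = 0"
  "dt \<Omega> T (\<lambda>t. w t *\<^sub>R \<phi>) \<in> bochner_L2 T (Hm1 \<Omega>) (norm_Hm1 \<Omega>)"
  "dtt \<Omega> T (\<lambda>t. w t *\<^sub>R \<phi>) \<in> bochner_L2 T (Hm1 \<Omega>) (norm_Hm1 \<Omega>)"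
  "AE t in lebesgue_on {0..T}. norm_Hm1 \<Omega> (w'' t *\<^sub>R l - dtt \<Omega> T (\<lambda>t. w t *\<^sub>R \<phi>) t) = 0"
  by (rule dt_dtt[OF tensor_L2[OF w_continuous(2)] tensor_L2[OF w''_continuous],
      of "\<lambda>t. w t *\<^sub>R \<phi>", unfolded embed_eq,
      OF weak_time_deriv_tensor[OF w(1) w_continuous(2)] weak_time_deriv_tensor[OF w(2) w''_continuous]])+

lemma tensor_H10_L2: "(\<lambda>t. w t *\<^sub>R \<phi>) \<in> bochner_L2 T (H10 \<Omega>) (norm_H10 \<Omega>)"
  and norm_tensor_H10_L2: "norm_bochner_L2 T (norm_H10 \<Omega>) (\<lambda>t. w t *\<^sub>R \<phi>)
    = L2_norm (lebesgue_on {0..T}) w * norm_H10 \<Omega> \<phi>"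
  using bochner_L2_tensor[OF continuous_square_integrable_Icc[OF w_continuous(1)], of \<phi> "H10 \<Omega>" "norm_H10 \<Omega>",
      OF H10_scaleR[OF test_function_H10[OF \<phi>]] H1_scaleR(3)[OF test_function_H1(1)[OF \<phi>]]]
    norm_H10_nonneg by auto

lemma tensor_trial_space: "(\<lambda>t. w t *\<^sub>R \<phi>) \<in> trial_space \<Omega> T"
proof -
  have mem: "dt \<Omega> T (\<lambda>t. w t *\<^sub>R \<phi>) t \<in> Hm1 \<Omega>" if "t \<in> {0..T}" for t
    by (rule bochner_L2_mem[OF dt_dtt_tensor(2) that])
  have "(\<lambda>t. w t *\<^sub>R l) \<in> bochner_H2 T (Hm1 \<Omega>) (norm_Hm1 \<Omega>)"
    unfolding bochner_H2_def
    using tensor_L2[OF w_continuous(1)] tensor_L2[OF w_continuous(2)] tensor_L2[OF w''_continuous]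
      weak_time_deriv_tensor[OF w(1) w_continuous(2)] weak_time_deriv_tensor[OF w(2) w''_continuous]
    by blast
  moreover have "has_initial_value T (Hm1 \<Omega>) (norm_Hm1 \<Omega>) (\<lambda>t. w t *\<^sub>R l) 0"
    using norm_l[of 0] by (intro initial_value_tensor[OF w_continuous(1) w0(1)]) simp
  moreover have "has_initial_value T (Hm1 \<Omega>) (norm_Hm1 \<Omega>) (dt \<Omega> T (\<lambda>t. w t *\<^sub>R \<phi>)) 0"
  proof (rule initial_value_tensor[OF w_continuous(2) w0(2)])
    show "AE t in lebesgue_on {0..T}. norm_Hm1 \<Omega> (dt \<Omega> T (\<lambda>t. w t *\<^sub>R \<phi>) t - w' t *\<^sub>R l) = 0"
      using dt_dtt_tensor(1) AE_space
    proof eventually_elim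
      case (elim t)
      then show ?case
        using norm_Hm1_scaleR[OF Hm1_diff[OF l_Hm1[of "w' t"] mem[of t]], of "-1"]
        by (simp add: space_restrict_space)
    qed
  qed
  ultimately show ?thesis
    using tensor_H10_L2 by (simp add: trial_space_def embed_eq)
qed

text \<open>The quantifier over v stands inside the almost-everywhere statement because the pairing
  evaluates at \<open>v t\<close>, which varies with t. Equality in the seminorm delivers all v at
  once.\<close>

lemma dtt_tensor_eq:
  "AE t in lebesgue_on {0..T}. \<forall>v\<in>H10 \<Omega>. dtt \<Omega> T (\<lambda>t. w t *\<^sub>R \<phi>) t v = w'' t * l v"
  using dt_dtt_tensor(4) AE_space
proof eventually_elim
  case (elim t)
  then have "dtt \<Omega> T (\<lambda>t. w t *\<^sub>R \<phi>) t \<in> Hm1 \<Omega>"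
    using bochner_L2_mem[OF dt_dtt_tensor(3)] by (simp add: space_restrict_space)
  from norm_Hm1_diff_zero_eq[OF l_Hm1 this elim(1)] show ?case
    by (simp add: scaleR_fun_def)
qed

end

section \<open>Oscillating test functions\<close>

lemma test_function_mult_elem_smooth:
  assumes "test_function \<Omega> f" "f \<in> elem_smooth" "g \<in> elem_smooth"
  shows "test_function \<Omega> (\<lambda>x. f x * g x)"
proof (rule test_functionI)
  show "smooth (\<lambda>x. f x * g x)" by (intro smooth_elem_smooth elem_smooth.mult assms)
  show "f x * g x = 0" if "x \<notin> closure {x. f x \<noteq> 0}" for x
    using test_function_eq_0_outside_support[OF that] by (simp only: mult_zero_left)
qed (use assms(1) in \<open>auto simp: test_function_def\<close>)

lemma elem_smooth_phase: "(\<lambda>x. k * (x \<bullet> e) + \<alpha>) \<in> elem_smooth"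
  by (intro elem_smooth.add elem_smooth.mult elem_smooth.const elem_smooth.inner)

lemma frechet_derivative_wave:
  fixes f :: "'a::euclidean_space \<Rightarrow> real"
  assumes "f differentiable (at x)"
  shows "frechet_derivative (\<lambda>x. f x * sin (k * (x \<bullet> e) + \<alpha>)) (at x) b =
      frechet_derivative f (at x) b * sin (k * (x \<bullet> e) + \<alpha>) + f x * (k * (b \<bullet> e) * cos (k * (x \<bullet> e) + \<alpha>))"
    and "frechet_derivative (\<lambda>x. f x * cos (k * (x \<bullet> e) + \<alpha>)) (at x) b =
      frechet_derivative f (at x) b * cos (k * (x \<bullet> e) + \<alpha>) - f x * (k * (b \<bullet> e) * sin (k * (x \<bullet> e) + \<alpha>))"
proof -
  have f: "(f has_derivative frechet_derivative f (at x)) (at x)"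
    using assms frechet_derivative_works by blast
  have ph: "((\<lambda>x. k * (x \<bullet> e) + \<alpha>) has_derivative (\<lambda>b. k * (b \<bullet> e))) (at x)"
    by (auto intro!: derivative_eq_intros)
  have "((\<lambda>x. f x * sin (k * (x \<bullet> e) + \<alpha>)) has_derivative (\<lambda>b. frechet_derivative f (at x) b * sin (k * (x \<bullet> e) + \<alpha>)
      + f x * (k * (b \<bullet> e) * cos (k * (x \<bullet> e) + \<alpha>)))) (at x)"
  proof -
    have "((\<lambda>x. sin (k * (x \<bullet> e) + \<alpha>)) has_derivative (\<lambda>b. k * (b \<bullet> e) * cos (k * (x \<bullet> e) + \<alpha>))) (at x)"
      by (rule has_derivative_sin[OF ph])
    from has_derivative_mult[OF f this] show ?thesis by (subst add.commute)
  qed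
  from fun_cong[OF frechet_derivative_at[OF this, symmetric], of b]
  show "frechet_derivative (\<lambda>x. f x * sin (k * (x \<bullet> e) + \<alpha>)) (at x) b =
      frechet_derivative f (at x) b * sin (k * (x \<bullet> e) + \<alpha>) + f x * (k * (b \<bullet> e) * cos (k * (x \<bullet> e) + \<alpha>))"
    .
  have "((\<lambda>x. f x * cos (k * (x \<bullet> e) + \<alpha>)) has_derivative (\<lambda>b. frechet_derivative f (at x) b * cos (k * (x \<bullet> e) + \<alpha>)
      - f x * (k * (b \<bullet> e) * sin (k * (x \<bullet> e) + \<alpha>)))) (at x)"
  proof -
    have "((\<lambda>x. cos (k * (x \<bullet> e) + \<alpha>)) has_derivative (\<lambda>b. k * (b \<bullet> e) * - sin (k * (x \<bullet> e) + \<alpha>))) (at x)"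
      by (rule has_derivative_cos[OF ph])
    from has_derivative_mult[OF f this] show ?thesis by simp
  qed
  from fun_cong[OF frechet_derivative_at[OF this, symmetric], of b]
  show "frechet_derivative (\<lambda>x. f x * cos (k * (x \<bullet> e) + \<alpha>)) (at x) b =
      frechet_derivative f (at x) b * cos (k * (x \<bullet> e) + \<alpha>) - f x * (k * (b \<bullet> e) * sin (k * (x \<bullet> e) + \<alpha>))"
    .
qed

context bounded_open
begin

lemma H10_test_product:
  assumes "v \<in> H10 \<Omega>" "test_function \<Omega> f"
  shows "integrable M (\<lambda>x. f x * v x)" "\<bar>\<integral>x. f x * v x \<partial>M\<bar> \<le> L2_norm M f * L2_norm M v"
  using square_integrable_inner[OF test_function_square_integrable[OF assms(2)] H1_weak_grad(1)[OF H10_H1[OF assms(1)]]]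
    L2_Cauchy_Schwarz[OF test_function_square_integrable[OF assms(2)] H1_weak_grad(1)[OF H10_H1[OF assms(1)]]]
  by simp_all

lemma H10_test_partial:
  assumes v: "v \<in> H10 \<Omega>" and f: "test_function \<Omega> f" and b: "b \<in> Basis"
  shows "(\<integral>x. frechet_derivative f (at x) b * v x \<partial>M) = - (\<integral>x. f x * (weak_grad \<Omega> v x \<bullet> b) \<partial>M)"
  using H1_weak_grad(3)[OF H10_H1[OF v]] f b by (simp add: is_weak_gradient_def mult.commute)

lemma H10_test_grad_product:
  assumes v: "v \<in> H10 \<Omega>" and f: "test_function \<Omega> f" and b: "b \<in> Basis"
  shows "integrable M (\<lambda>x. f x * (weak_grad \<Omega> v x \<bullet> b))"
    "\<bar>\<integral>x. f x * (weak_grad \<Omega> v x \<bullet> b) \<partial>M\<bar> \<le> L2_norm M f * norm_H10 \<Omega> v"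
proof -
  note g = H1_weak_grad(2)[OF H10_H1[OF v]]
  note gb = square_integrable_inner_const[OF g, of b]
  note f' = test_function_square_integrable[OF f]
  show "integrable M (\<lambda>x. f x * (weak_grad \<Omega> v x \<bullet> b))"
    using square_integrable_inner[OF f' gb] by simp
  have "\<bar>\<integral>x. f x * (weak_grad \<Omega> v x \<bullet> b) \<partial>M\<bar> \<le> L2_norm M f * L2_norm M (\<lambda>x. weak_grad \<Omega> v x \<bullet> b)"
    using L2_Cauchy_Schwarz[OF f' gb] by simp
  also have "L2_norm M (\<lambda>x. weak_grad \<Omega> v x \<bullet> b) \<le> norm_H10 \<Omega> v"
    unfolding norm_H10_eq by (rule L2_norm_mono[OF g gb]) (simp add: Basis_le_norm[OF b])
  finally show "\<bar>\<integral>x. f x * (weak_grad \<Omega> v x \<bullet> b) \<partial>M\<bar> \<le> L2_norm M f * norm_H10 \<Omega> v"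
    using L2_norm_nonneg[of M f] by (simp add: mult_left_mono)
qed

lemma L2_norm_damped:
  fixes f :: "'a \<Rightarrow> 'b::euclidean_space"
  assumes "square_integrable M f" "continuous_on UNIV g" "\<And>x. \<bar>g x\<bar> \<le> 1"
  shows "square_integrable M (\<lambda>x. g x *\<^sub>R f x)" "L2_norm M (\<lambda>x. g x *\<^sub>R f x) \<le> L2_norm M f"
proof -
  have [measurable]: "g \<in> borel_measurable M" by (rule continuous_measurable[OF assms(2)])
  have le: "norm (g x *\<^sub>R f x) \<le> norm (f x)" for x
    using mult_right_mono[OF assms(3), of "norm (f x)" x] by simp
  show "square_integrable M (\<lambda>x. g x *\<^sub>R f x)"
    by (rule square_integrable_bound[OF assms(1) _ le]) (use assms(1) in \<open>auto simp: square_integrable_def\<close>)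
  then show "L2_norm M (\<lambda>x. g x *\<^sub>R f x) \<le> L2_norm M f"
    by (rule L2_norm_mono[OF assms(1) _ le])
qed

text \<open>The factor \<open>k\<close> is absorbed by writing \<open>k sin (k \<xi> + \<alpha>)\<close> as the derivative of \<open>- cos (k \<xi> + \<alpha>)\<close>
  and moving it to the other factors.\<close>

lemma oscillation_bound:
  assumes f: "test_function \<Omega> f" "f \<in> elem_smooth" and e: "e \<in> Basis"
  obtains C where "C \<ge> 0"
    "\<And>k \<alpha> v. v \<in> H10 \<Omega> \<Longrightarrow> \<bar>\<integral>x. k * (f x * sin (k * (x \<bullet> e) + \<alpha>)) * v x \<partial>M\<bar> \<le> C * norm_H10 \<Omega> v"
proof -
  obtain P where P: "P \<ge> 0" "\<And>v. v \<in> H10 \<Omega> \<Longrightarrow> L2_norm M v \<le> P * norm_H10 \<Omega> v"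
    using Poincare by blast
  let ?f' = "\<lambda>x. frechet_derivative f (at x) e"
  have f': "test_function \<Omega> ?f'" "?f' \<in> elem_smooth"
    using test_function_partial[OF f(1) e] elem_smooth_partial[OF f(2)] by auto
  \<comment> \<open>One term for each factor that can receive the derivative: f, where Poincare then
    bounds v, or v itself. Neither term contains k or \<alpha>.\<close>
  define C where "C = L2_norm M ?f' * P + L2_norm M f"
  have "\<bar>\<integral>x. k * (f x * sin (k * (x \<bullet> e) + \<alpha>)) * v x \<partial>M\<bar> \<le> C * norm_H10 \<Omega> v" if v: "v \<in> H10 \<Omega>" for k \<alpha> v
  proof -
    let ?c = "\<lambda>x. cos (k * (x \<bullet> e) + \<alpha>)" and ?s = "\<lambda>x. sin (k * (x \<bullet> e) + \<alpha>)"
    have cs: "?c \<in> elem_smooth" "?s \<in> elem_smooth"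
      by (intro elem_smooth.cos elem_smooth_sin elem_smooth_phase)+
    have c: "continuous_on UNIV ?c" by (intro continuous_intros)
    have t: "test_function \<Omega> (\<lambda>x. f x * ?c x)" "test_function \<Omega> (\<lambda>x. f x * ?s x)" "test_function \<Omega> (\<lambda>x. ?f' x * ?c x)"
      by (intro test_function_mult_elem_smooth f f' cs)+
    \<comment> \<open>Differentiating the cosine along the basis vector e brings out exactly the
      factor k, since e has length 1.\<close>
    have "(\<integral>x. ?f' x * ?c x * v x - k * (f x * ?s x * v x) \<partial>M) = - (\<integral>x. (f x * ?c x) * (weak_grad \<Omega> v x \<bullet> e) \<partial>M)"
      using H10_test_partial[OF v t(1) e]
      by (simp add: frechet_derivative_wave(2)[OF test_function_differentiable[OF f(1)]] inner_Basis e
          left_diff_distrib mult.assoc mult.left_commute)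
    then have "(\<integral>x. k * (f x * ?s x) * v x \<partial>M) = (\<integral>x. ?f' x * ?c x * v x \<partial>M) + (\<integral>x. (f x * ?c x) * (weak_grad \<Omega> v x \<bullet> e) \<partial>M)"
      using H10_test_product(1)[OF v t(3)] H10_test_product(1)[OF v t(2)] by (simp add: mult.assoc)
    moreover have "\<bar>\<integral>x. ?f' x * ?c x * v x \<partial>M\<bar> \<le> L2_norm M ?f' * (P * norm_H10 \<Omega> v)"
    proof -
      have "L2_norm M (\<lambda>x. ?f' x * ?c x) \<le> L2_norm M ?f'"
        using L2_norm_damped(2)[OF test_function_square_integrable[OF f'(1)] c] by (simp add: mult.commute)
      then show ?thesis
        using H10_test_product(2)[OF v t(3)] mult_mono[OF _ P(2)[OF v]] L2_norm_nonneg by (meson order_trans)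
    qed
    moreover have "\<bar>\<integral>x. (f x * ?c x) * (weak_grad \<Omega> v x \<bullet> e) \<partial>M\<bar> \<le> L2_norm M f * norm_H10 \<Omega> v"
    proof -
      have "L2_norm M (\<lambda>x. f x * ?c x) \<le> L2_norm M f"
        using L2_norm_damped(2)[OF test_function_square_integrable[OF f(1)] c] by (simp add: mult.commute)
      then show ?thesis
        using H10_test_grad_product(2)[OF v t(1) e] mult_right_mono[OF _ norm_H10_nonneg] by (meson order_trans)
    qed
    ultimately show ?thesis by (simp add: C_def distrib_right mult.assoc)
  qed
  moreover have "C \<ge> 0" using P(1) by (simp add: C_def L2_norm_nonneg)
  ultimately show thesis using that by blast
qed

text \<open>A continuous function that vanishes almost everywhere on an open set vanishes there
  identically.\<close>

lemma L2_norm_test_function_pos: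
  fixes f :: "'a \<Rightarrow> real"
  assumes f: "test_function \<Omega> f" and a: "f a \<noteq> 0" "a \<in> \<Omega>"
  shows "L2_norm M f > 0"
proof (rule ccontr)
  assume "\<not> ?thesis"
  then have "(\<integral>x. (norm (f x))\<^sup>2 \<partial>M) = 0"
    using L2_norm_nonneg[of M f] L2_norm_squared[of M f] by simp
  then have "AE x in M. (norm (f x))\<^sup>2 = 0"
    using test_function_square_integrable[OF f]
    by (subst (asm) integral_nonneg_eq_0_iff_AE) (auto simp: square_integrable_def)
  then have "AE x in lebesgue. x \<in> \<Omega> \<longrightarrow> x \<in> f -` {0}"
    using domain_sets by (simp add: AE_restrict_space_iff)
  moreover have "closed (f -` {0})"
    by (rule closed_vimage[OF closed_singleton test_function_continuous[OF f]])
  ultimately have "a \<in> f -` {0}"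
    using mem_closed_if_AE_lebesgue_open[OF open_domain] a(2) by blast
  with a(1) show False by simp
qed

text \<open>These are approximate eigenfunctions for the eigenvalue k^2. The bounds say that k phi
  and the defect (grad phi, grad v) - k^2 (phi, v) stay bounded in the dual while the gradient norm
  grows at least linearly in k. One constant C serves all three estimates.\<close>

lemma modulated_test_functions:
  assumes "\<Omega> \<noteq> {}"
  obtains a C where "a > 0" "C \<ge> 0"
    "\<And>k. k \<ge> 0 \<Longrightarrow> \<exists>\<phi>. test_function \<Omega> \<phi> \<and> a * k - C \<le> norm_H10 \<Omega> \<phi> \<and>
       (\<forall>v\<in>H10 \<Omega>. \<bar>k * L2_embed \<Omega> \<phi> v\<bar> \<le> C * norm_H10 \<Omega> v \<and>
          \<bar>grad_inner \<Omega> \<phi> v - k\<^sup>2 * L2_embed \<Omega> \<phi> v\<bar> \<le> C * norm_H10 \<Omega> v)"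
proof -
  obtain p where p: "p \<in> \<Omega>" using assms by blast
  then obtain r where r: "r > 0" "cball p r \<subseteq> \<Omega>" using open_domain open_contains_cball by blast
  obtain e :: 'a where e: "e \<in> Basis" using nonempty_Basis by blast
  define f where "f = bump p r"
  have fe: "f \<in> elem_smooth" by (simp add: f_def bump_elem_smooth)
  have f: "test_function \<Omega> f"
  proof (rule test_functionI[of _ "cball p r"])
    show "f x = 0" if "x \<notin> cball p r" for x
      using bump_pos_iff[OF r(1), of p x] bump_nonneg[of p r x] that by (simp add: f_def)
  qed (use r fe in \<open>auto intro: smooth_elem_smooth\<close>)
  have f_pos: "L2_norm M f > 0"
    using bump_pos_iff[OF r(1), of p p] r(1) p by (intro L2_norm_test_function_pos[OF f, of p]) (auto simp: f_def)
  let ?f' = "\<lambda>x. frechet_derivative f (at x) e"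
  have f': "test_function \<Omega> ?f'" "?f' \<in> elem_smooth"
    using test_function_partial[OF f e] elem_smooth_partial[OF fe] by auto
  obtain C1 where C1: "C1 \<ge> 0"
    "\<And>k \<alpha> v. v \<in> H10 \<Omega> \<Longrightarrow> \<bar>\<integral>x. k * (f x * sin (k * (x \<bullet> e) + \<alpha>)) * v x \<partial>M\<bar> \<le> C1 * norm_H10 \<Omega> v"
    using oscillation_bound[OF f fe e] by blast
  \<comment> \<open>The defect contains k times the derivative of f times a cosine, so the
    oscillation bound is needed for that derivative too.\<close>
  obtain C2 where C2: "C2 \<ge> 0"
    "\<And>k \<alpha> v. v \<in> H10 \<Omega> \<Longrightarrow> \<bar>\<integral>x. k * (?f' x * sin (k * (x \<bullet> e) + \<alpha>)) * v x \<partial>M\<bar> \<le> C2 * norm_H10 \<Omega> v"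
    using oscillation_bound[OF f' e] by blast
  define G where "G = L2_norm M (grad f)"
  have G: "G \<ge> 0" by (simp add: G_def L2_norm_nonneg)
  define C where "C = C1 + C2 + G"
  show thesis
  proof (rule that[of "L2_norm M f / 2" C])
    fix k :: real assume k: "k \<ge> 0"
    \<comment> \<open>If the phases 0 and -pi/2 both failed, two squared norms that add up to the
      squared norm of f would each be below a quarter of it. The phase may depend on k, because C1
      and C2 are uniform in it.\<close>
    have "\<exists>\<alpha>. L2_norm M f / 2 \<le> L2_norm M (\<lambda>x. cos (k * (x \<bullet> e) + \<alpha>) *\<^sub>R f x)"
    proof (rule ccontr)
      let ?g = "\<lambda>\<alpha> x. cos (k * (x \<bullet> e) + \<alpha>) *\<^sub>R f x"
      assume "\<not> ?thesis"
      then have less: "(L2_norm M (?g \<alpha>))\<^sup>2 < (L2_norm M f / 2)\<^sup>2" for \<alpha>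
        by (intro power_strict_mono) (auto simp: L2_norm_nonneg not_le)
      have sq: "square_integrable M (?g \<alpha>)" for \<alpha>
        by (intro L2_norm_damped(1) test_function_square_integrable f continuous_intros) auto
      have "(norm (f x))\<^sup>2 = (norm (?g 0 x))\<^sup>2 + (norm (?g (- (pi / 2)) x))\<^sup>2" for x
      proof -
        have "cos (k * (x \<bullet> e) + - (pi / 2)) = sin (k * (x \<bullet> e))"
          by (simp add: cos_diff flip: diff_conv_add_uminus)
        then show ?thesis by (simp add: power_mult_distrib flip: distrib_right)
      qed
      then have "(L2_norm M f)\<^sup>2 = (L2_norm M (?g 0))\<^sup>2 + (L2_norm M (?g (- (pi / 2))))\<^sup>2"
        using sq[of 0] sq[of "- (pi / 2)"] by (simp only: L2_norm_squared square_integrable_def Bochner_Integration.integral_add)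
      then have "(L2_norm M f)\<^sup>2 < 2 * (L2_norm M f / 2)\<^sup>2"
        using less[of 0] less[of "- (pi / 2)"] by linarith
      with zero_less_power[OF f_pos, of 2] show False
        by (simp add: power_divide)
    qed
    then obtain \<alpha> where \<alpha>: "L2_norm M f / 2 \<le> L2_norm M (\<lambda>x. cos (k * (x \<bullet> e) + \<alpha>) *\<^sub>R f x)" by blast
    let ?c = "\<lambda>x. cos (k * (x \<bullet> e) + \<alpha>)" and ?s = "\<lambda>x. sin (k * (x \<bullet> e) + \<alpha>)"
    have cs: "?c \<in> elem_smooth" "?s \<in> elem_smooth"
      by (intro elem_smooth.cos elem_smooth_sin elem_smooth_phase)+
    have cont: "continuous_on UNIV ?c" "continuous_on UNIV ?s" by (intro continuous_intros)+
    define \<phi> where "\<phi> x = f x * ?s x" for x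
    have \<phi>: "test_function \<Omega> \<phi>" and fc: "test_function \<Omega> (\<lambda>x. f x * ?c x)" and f'c: "test_function \<Omega> (\<lambda>x. ?f' x * ?c x)"
      unfolding \<phi>_def by (intro test_function_mult_elem_smooth f fe f' cs)+
    have grad_\<phi>: "grad \<phi> x = ?s x *\<^sub>R grad f x + (k * (f x * ?c x)) *\<^sub>R e" for x
    proof -
      have "(\<Sum>b\<in>Basis. (f x * (k * (b \<bullet> e) * ?c x)) *\<^sub>R b) = (k * (f x * ?c x)) *\<^sub>R (\<Sum>b\<in>Basis. (e \<bullet> b) *\<^sub>R b)"
        by (simp add: scaleR_sum_right inner_commute algebra_simps)
      then show ?thesis
        unfolding \<phi>_def[abs_def] grad_def
        by (simp add: frechet_derivative_wave(1)[OF test_function_differentiable[OF f]] scaleR_left_distrib sum.distrib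
            scaleR_sum_right euclidean_representation mult.commute[of "?s x"])
    qed
    note sg = L2_norm_damped[OF grad_square_integrable[OF f] cont(2) abs_sin_le_one]
    note fc' = L2_norm_damped[OF test_function_square_integrable[OF f] cont(1) abs_cos_le_one]
    \<comment> \<open>The leading part of the gradient is k f times the cosine in direction e; what
      remains, the sine times the gradient of f, has norm at most G.\<close>
    have lower: "L2_norm M f / 2 * k - C \<le> norm_H10 \<Omega> \<phi>"
    proof -
      have "L2_norm M f / 2 * k \<le> k * L2_norm M (\<lambda>x. ?c x *\<^sub>R f x)"
        using mult_left_mono[OF \<alpha> k] by (simp add: mult.commute)
      also have "\<dots> = L2_norm M (\<lambda>x. k *\<^sub>R (?c x *\<^sub>R f x))"
        using k by (simp only: L2_norm_scaleR abs_of_nonneg)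
      also have "\<dots> = L2_norm M (\<lambda>x. grad \<phi> x + (-1) *\<^sub>R (?s x *\<^sub>R grad f x))"
        using e by (simp add: L2_norm_def grad_\<phi> abs_mult mult.commute)
      also have "\<dots> \<le> L2_norm M (grad \<phi>) + L2_norm M (\<lambda>x. (-1) *\<^sub>R (?s x *\<^sub>R grad f x))"
        by (intro L2_norm_add grad_square_integrable \<phi> square_integrable_scaleR sg)
      also have "\<dots> = norm_H10 \<Omega> \<phi> + L2_norm M (\<lambda>x. ?s x *\<^sub>R grad f x)"
        by (simp only: L2_norm_scaleR norm_H10_test_function[OF \<phi>] abs_neg_one mult_1)
      also have "\<dots> \<le> norm_H10 \<Omega> \<phi> + G" using sg(2) by (simp add: G_def)
      finally show ?thesis using C1(1) C2(1) by (simp add: C_def)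
    qed
    have "\<bar>k * L2_embed \<Omega> \<phi> v\<bar> \<le> C * norm_H10 \<Omega> v \<and>
        \<bar>grad_inner \<Omega> \<phi> v - k\<^sup>2 * L2_embed \<Omega> \<phi> v\<bar> \<le> C * norm_H10 \<Omega> v" if v: "v \<in> H10 \<Omega>" for v
    proof
      note n = norm_H10_nonneg[of v]
      have "\<bar>k * L2_embed \<Omega> \<phi> v\<bar> \<le> C1 * norm_H10 \<Omega> v"
        using C1(2)[OF v, of k \<alpha>] by (simp add: L2_embed_def \<phi>_def mult.assoc)
      also have "\<dots> \<le> C * norm_H10 \<Omega> v"
        using C1 C2 G by (intro mult_right_mono n) (simp add: C_def)
      finally show "\<bar>k * L2_embed \<Omega> \<phi> v\<bar> \<le> C * norm_H10 \<Omega> v" .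
      note vg = H1_weak_grad(2)[OF H10_H1[OF v]]
      have fs: "test_function \<Omega> (\<lambda>x. f x * ?s x)" using \<phi> by (simp only: \<phi>_def[abs_def])
      have "grad_inner \<Omega> \<phi> v = (\<integral>x. grad \<phi> x \<bullet> weak_grad \<Omega> v x \<partial>M)"
        by (rule grad_inner_eq[OF test_function_H1(1)[OF \<phi>] H10_H1[OF v] test_function_H1(2)[OF \<phi>] AE_I2[OF refl]
            grad_square_integrable[OF \<phi>] vg])
      also have "\<dots> = (\<integral>x. (?s x *\<^sub>R grad f x) \<bullet> weak_grad \<Omega> v x + k * (f x * ?c x * (weak_grad \<Omega> v x \<bullet> e)) \<partial>M)"
        by (simp add: grad_\<phi> inner_add_left inner_commute[of e] mult.assoc)
      also have "\<dots> = (\<integral>x. (?s x *\<^sub>R grad f x) \<bullet> weak_grad \<Omega> v x \<partial>M) + k * (\<integral>x. f x * ?c x * (weak_grad \<Omega> v x \<bullet> e) \<partial>M)"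
        using square_integrable_inner[OF sg(1) vg] H10_test_grad_product(1)[OF v fc e] by simp
      \<comment> \<open>Moving the derivative off v creates a term k f times the sine; together with
        the factor k in front it is the k^2 part that the defect subtracts.\<close>
      also have "(\<integral>x. f x * ?c x * (weak_grad \<Omega> v x \<bullet> e) \<partial>M) = - (\<integral>x. ?f' x * ?c x * v x - k * (f x * ?s x * v x) \<partial>M)"
        using H10_test_partial[OF v fc e]
        by (simp add: frechet_derivative_wave(2)[OF test_function_differentiable[OF f]] inner_Basis e
            left_diff_distrib mult.assoc mult.left_commute)
      also have "(\<integral>x. ?f' x * ?c x * v x - k * (f x * ?s x * v x) \<partial>M) = (\<integral>x. ?f' x * ?c x * v x \<partial>M) - k * L2_embed \<Omega> \<phi> v"
        using H10_test_product(1)[OF v f'c] H10_test_product(1)[OF v fs] by (simp add: L2_embed_def \<phi>_def)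
      finally have eq: "grad_inner \<Omega> \<phi> v - k\<^sup>2 * L2_embed \<Omega> \<phi> v =
          (\<integral>x. (?s x *\<^sub>R grad f x) \<bullet> weak_grad \<Omega> v x \<partial>M) - k * (\<integral>x. ?f' x * ?c x * v x \<partial>M)"
        by (simp add: power2_eq_square algebra_simps)
      have "\<bar>\<integral>x. (?s x *\<^sub>R grad f x) \<bullet> weak_grad \<Omega> v x \<partial>M\<bar> \<le> L2_norm M (\<lambda>x. ?s x *\<^sub>R grad f x) * norm_H10 \<Omega> v"
        unfolding norm_H10_eq by (rule L2_Cauchy_Schwarz[OF sg(1) vg])
      also have "\<dots> \<le> G * norm_H10 \<Omega> v"
        using sg(2) by (intro mult_right_mono n) (simp add: G_def)
      finally have 1: "\<bar>\<integral>x. (?s x *\<^sub>R grad f x) \<bullet> weak_grad \<Omega> v x \<partial>M\<bar> \<le> G * norm_H10 \<Omega> v" .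
      \<comment> \<open>A cosine is a sine with shifted phase, and the bound with C2 holds for every
        phase.\<close>
      have "sin (k * (x \<bullet> e) + (\<alpha> + pi / 2)) = ?c x" for x
        by (simp add: sin_add flip: add.assoc)
      then have 2: "\<bar>k * (\<integral>x. ?f' x * ?c x * v x \<partial>M)\<bar> \<le> C2 * norm_H10 \<Omega> v"
        using C2(2)[OF v, of k "\<alpha> + pi / 2"] by (simp add: mult.assoc)
      have "0 \<le> C1 * norm_H10 \<Omega> v" using C1(1) n by simp
      with 1 2 show "\<bar>grad_inner \<Omega> \<phi> v - k\<^sup>2 * L2_embed \<Omega> \<phi> v\<bar> \<le> C * norm_H10 \<Omega> v"
        unfolding eq C_def distrib_right by linarith
    qed
    then show "\<exists>\<phi>. test_function \<Omega> \<phi> \<and> L2_norm M f / 2 * k - C \<le> norm_H10 \<Omega> \<phi> \<and>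
       (\<forall>v\<in>H10 \<Omega>. \<bar>k * L2_embed \<Omega> \<phi> v\<bar> \<le> C * norm_H10 \<Omega> v \<and>
          \<bar>grad_inner \<Omega> \<phi> v - k\<^sup>2 * L2_embed \<Omega> \<phi> v\<bar> \<le> C * norm_H10 \<Omega> v)"
      using \<phi> lower by blast
  qed (use f_pos C1 C2 G in \<open>auto simp: C_def\<close>)
qed

text \<open>Used contrapositively: a trial function of positive norm is admissible in the infimum.
  The zero field is a weak gradient of any function that is zero almost everywhere.\<close>

lemma ae_zero_norm_H10:
  assumes "ae_zero \<Omega> T u" "u \<in> bochner_L2 T (H10 \<Omega>) (norm_H10 \<Omega>)"
  shows "norm_bochner_L2 T (norm_H10 \<Omega>) u = 0"
proof -
  have "AE t in lebesgue_on {0..T}. (norm_H10 \<Omega> (u t))\<^sup>2 = 0"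
    using assms(1)[unfolded ae_zero_def] AE_space
  proof eventually_elim
    case (elim t)
    then have H: "u t \<in> H1 \<Omega>"
      using bochner_L2_mem[OF assms(2)] by (auto simp: space_restrict_space intro: H10_H1)
    have "is_weak_gradient \<Omega> (u t) (\<lambda>_. 0)"
      unfolding is_weak_gradient_def
    proof (intro allI impI ballI)
      fix \<phi> and b :: 'a
      have "(\<integral>x. u t x * frechet_derivative \<phi> (at x) b \<partial>M) = 0"
        by (rule integral_eq_zero_AE) (use elim(1) in eventually_elim, simp)
      then show "(\<integral>x. u t x * frechet_derivative \<phi> (at x) b \<partial>M) = - (\<integral>x. 0 \<bullet> b * \<phi> x \<partial>M)" by simp
    qed
    moreover have z: "square_integrable M (\<lambda>_. 0 :: 'a)" by (simp add: square_integrable_def)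
    ultimately have "AE x in M. weak_grad \<Omega> (u t) x = 0"
      using H1I(2)[OF H1_weak_grad(1)[OF H]] by blast
    then have "norm_H10 \<Omega> (u t) = L2_norm M (\<lambda>_. 0 :: 'a)"
      unfolding norm_H10_eq using H1_weak_grad(2)[OF H] z
      by (intro L2_norm_cong_AE) (auto simp: square_integrable_def)
    then show ?case by (simp add: L2_norm_def)
  qed
  then show ?thesis by (simp add: norm_bochner_L2_def integral_eq_zero_AE)
qed

text \<open>Squaring is monotone only from nonnegative values, which matters in
  \<open>norm_data_le\<close>. The pointwise bound is what the resonant family provides for
  \<open>wave_operator\<close>, and it makes the supremum finite.\<close>

lemma norm_Hm1_nonneg_if_bound:
  assumes "\<And>v. v \<in> H10 \<Omega> \<Longrightarrow> \<bar>l v\<bar> \<le> K * norm_H10 \<Omega> v" "K \<ge> 0"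
  shows "0 \<le> norm_Hm1 \<Omega> l"
proof -
  have "bdd_above ((\<lambda>v. \<bar>l v\<bar>) ` {v \<in> H10 \<Omega>. norm_H10 \<Omega> v \<le> 1})"
  proof (rule bdd_aboveI2)
    fix v assume "v \<in> {v \<in> H10 \<Omega>. norm_H10 \<Omega> v \<le> 1}"
    then show "\<bar>l v\<bar> \<le> K"
      using assms(1)[of v] mult_left_le[of "norm_H10 \<Omega> v" K] assms(2) by simp
  qed
  from cSUP_upper[OF zero_in_unit_ball this] show ?thesis
    unfolding norm_Hm1_def by (rule order_trans[OF abs_ge_zero])
qed

lemma norm_data_le:
  assumes "AE t in lebesgue_on {0..T}. \<forall>v\<in>H10 \<Omega>. \<bar>f t v\<bar> \<le> K * norm_H10 \<Omega> v" "K \<ge> 0" "T > 0"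
  shows "norm_data \<Omega> T f \<le> K * sqrt T"
proof -
  interpret finite_measure "lebesgue_on {0..T}" by (rule finite_measure_Icc)
  have "(\<integral>t. (norm_Hm1 \<Omega> (f t))\<^sup>2 \<partial>lebesgue_on {0..T}) \<le> (\<integral>t. K\<^sup>2 \<partial>lebesgue_on {0..T})"
  \<comment> \<open>If the left integrand fails to be integrable, its integral is 0 by convention,
    which the nonnegative right side still dominates.\<close>
  proof (rule integral_mono_AE')
    show "AE t in lebesgue_on {0..T}. (norm_Hm1 \<Omega> (f t))\<^sup>2 \<le> K\<^sup>2"
      using assms(1)
    proof eventually_elim
      case (elim t)
      then show ?case
        using assms(2) by (intro power_mono norm_Hm1_le norm_Hm1_nonneg_if_bound[of "f t" K]) auto
    qed
  qed auto
  also have "\<dots> = K\<^sup>2 * T"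
    using assms(3) by (simp add: measure_restrict_space)
  finally show ?thesis
    using assms(2,3) real_sqrt_le_mono
    by (fastforce simp: norm_data_def norm_bochner_L2_def real_sqrt_mult)
qed

text \<open>Cauchy-Schwarz in time against the constant 1, whose norm is sqrt T.\<close>

lemma pairing_le:
  assumes f: "AE t in lebesgue_on {0..T}. \<forall>v\<in>H10 \<Omega>. \<bar>f t v\<bar> \<le> K * norm_H10 \<Omega> v" "K \<ge> 0" "T > 0"
    and v: "v \<in> test_space \<Omega> T"
  shows "(\<integral>t. f t (v t) \<partial>lebesgue_on {0..T}) \<le> K * sqrt T * norm_test \<Omega> T v"
proof -
  let ?I = "lebesgue_on {0..T}"
  interpret finite_measure ?I by (rule finite_measure_Icc)
  define h where "h t = norm_H10 \<Omega> (v t)" for t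
  have v': "v \<in> bochner_L2 T (H10 \<Omega>) (norm_H10 \<Omega>)" using v by (simp add: test_space_def)
  have h: "square_integrable ?I h"
    unfolding square_integrable_def
  proof
    show int: "integrable ?I (\<lambda>t. (norm (h t))\<^sup>2)" using v' by (simp add: bochner_L2_def h_def)
    \<comment> \<open>\<open>bochner_L2\<close> provides integrability of the square; measurability
      of h itself is recovered by the square root.\<close>
    have "(\<lambda>t. sqrt ((norm (h t))\<^sup>2)) \<in> borel_measurable ?I"
      by (rule measurable_compose[OF borel_measurable_integrable[OF int] borel_measurable_sqrt])
    moreover have "sqrt ((norm (h t))\<^sup>2) = h t" for t
      by (simp add: h_def norm_H10_nonneg)
    ultimately show "h \<in> borel_measurable ?I" by simp
  qed
  have one: "square_integrable ?I (\<lambda>_. 1 :: real)" by (simp add: square_integrable_def)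
  have "(\<integral>t. f t (v t) \<partial>?I) \<le> (\<integral>t. K * h t \<partial>?I)"
  proof (rule integral_mono_AE')
    show "integrable ?I (\<lambda>t. K * h t)"
      using square_integrable_integrable[OF finite_measure_Icc h] by simp
    show "AE t in ?I. f t (v t) \<le> K * h t"
      using f(1) AE_space
    proof eventually_elim
      case (elim t)
      then have "v t \<in> H10 \<Omega>" using bochner_L2_mem[OF v'] by (simp add: space_restrict_space)
      with elim(1) have "\<bar>f t (v t)\<bar> \<le> K * h t" unfolding h_def by blast
      then show ?case by linarith
    qed
    show "AE t in ?I. 0 \<le> K * h t" using f(2) by (simp add: h_def norm_H10_nonneg)
  qed
  also have "\<dots> \<le> K * (L2_norm ?I (\<lambda>_. 1 :: real) * L2_norm ?I h)"
    using L2_Cauchy_Schwarz[OF one h] f(2) by (auto intro!: mult_left_mono)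
  also have "L2_norm ?I (\<lambda>_. 1 :: real) = sqrt T"
    using f(3) by (simp add: L2_norm_def measure_restrict_space)
  also have "L2_norm ?I h = norm_test \<Omega> T v"
    by (simp add: L2_norm_def norm_test_def norm_bochner_L2_def h_def)
  finally show ?thesis by (simp add: mult.assoc)
qed

end

section \<open>Resonance\<close>

text \<open>The resonant solution of \<open>w'' + \<omega>\<^sup>2 w = 2 \<omega> cos (\<omega> t)\<close>.\<close>

lemma L2_norm_resonance:
  fixes T :: real
  assumes "T > 0" "n \<ge> 1" and \<omega>: "\<omega> = 2 * pi * real n / T"
  shows "T ^ 3 / 12 \<le> (L2_norm (lebesgue_on {0..T}) (\<lambda>t. t * sin (\<omega> * t)))\<^sup>2"
proof -
  have \<omega>_pos: "\<omega> > 0" using assms by simp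
  \<comment> \<open>An antiderivative of t^2 sin^2 (omega t), obtained from sin^2 (omega t) = (1 -
    cos (2 omega t)) / 2 by two integrations by parts.\<close>
  define F where "F t = t ^ 3 / 6 - t\<^sup>2 * sin (2 * \<omega> * t) / (4 * \<omega>) - t * cos (2 * \<omega> * t) / (4 * \<omega>\<^sup>2)
    + sin (2 * \<omega> * t) / (8 * \<omega> ^ 3)" for t
  have sq: "(sin (\<omega> * t))\<^sup>2 = (1 - cos (2 * \<omega> * t)) / 2" for t
    using cos_double_sin[of "\<omega> * t"] by (simp add: mult.assoc)
  have "(F has_real_derivative (t * sin (\<omega> * t))\<^sup>2) (at t)" for t
    unfolding F_def power_mult_distrib sq using \<omega>_pos
    by (auto intro!: derivative_eq_intros simp: power2_eq_square power3_eq_cube) (simp add: field_simps)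
  then have "((\<lambda>t. (t * sin (\<omega> * t))\<^sup>2) has_integral F T - F 0) {0..T}"
    using assms(1)
    by (intro fundamental_theorem_of_calculus)
       (auto simp: has_real_derivative_iff_has_vector_derivative intro: has_vector_derivative_at_within)
  then have "integral {0..T} (\<lambda>t. (t * sin (\<omega> * t))\<^sup>2) = F T - F 0" by (rule integral_unique)
  moreover have "(\<integral>t. (t * sin (\<omega> * t))\<^sup>2 \<partial>lebesgue_on {0..T}) = integral {0..T} (\<lambda>t. (t * sin (\<omega> * t))\<^sup>2)"
    by (intro lebesgue_integral_eq_integral continuous_imp_integrable_real continuous_intros) auto
  ultimately have "(L2_norm (lebesgue_on {0..T}) (\<lambda>t. t * sin (\<omega> * t)))\<^sup>2 = F T - F 0"
    by (simp add: L2_norm_squared)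
  \<comment> \<open>Since omega T is a multiple of 2 pi, both sine terms vanish at T and the cosine
    is 1.\<close>
  also have "F T - F 0 = T ^ 3 / 6 - T / (4 * \<omega>\<^sup>2)"
  proof -
    have "2 * \<omega> * T = 2 * pi * real (2 * n)" using assms(1) by (simp add: \<omega>)
    then have "cos (2 * \<omega> * T) = 1" "sin (2 * \<omega> * T) = 0"
      using cos_2npi[of "2 * n"] sin_2npi[of "2 * n"] by (simp_all only: mult.assoc mult.left_commute mult.commute)
    then show ?thesis by (simp add: F_def)
  qed
  finally have "(L2_norm (lebesgue_on {0..T}) (\<lambda>t. t * sin (\<omega> * t)))\<^sup>2 = T ^ 3 / 6 - T / (4 * \<omega>\<^sup>2)" .
  \<comment> \<open>The correction is at most half of T^3 / 6 once omega T >= 2, which n >= 1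
    ensures.\<close>
  moreover have "T / (4 * \<omega>\<^sup>2) \<le> T ^ 3 / 12"
  proof -
    have "2 * 1 * 1 \<le> 2 * pi * real n"
      using assms(2) pi_gt3 by (intro mult_mono) auto
    then have "2 \<le> \<omega> * T" using assms(1) by (simp add: \<omega>)
    then have "2\<^sup>2 \<le> (\<omega> * T)\<^sup>2" by (intro power_mono) auto
    then have "3 \<le> \<omega>\<^sup>2 * T\<^sup>2" by (simp add: power_mult_distrib)
    then have "T * 3 \<le> T * (\<omega>\<^sup>2 * T\<^sup>2)" using assms(1) by (intro mult_left_mono) auto
    then show ?thesis using \<omega>_pos by (simp add: divide_simps power2_eq_square power3_eq_cube algebra_simps)
  qed
  ultimately show ?thesis by linarith
qed

context bounded_open
begin

text \<open>K is fixed before R: the trial norm is unbounded while the operator stays bounded. Both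
  claims of the theorem are read off from this family.\<close>

lemma resonant_family:
  assumes "\<Omega> \<noteq> {}" "T > 0" "c > 0"
  obtains K where "K \<ge> 0"
    "\<And>R. \<exists>u\<in>trial_space \<Omega> T. R \<le> norm_bochner_L2 T (norm_H10 \<Omega>) u \<and>
      (AE t in lebesgue_on {0..T}. \<forall>v\<in>H10 \<Omega>. \<bar>wave_operator \<Omega> T c u t v\<bar> \<le> K * norm_H10 \<Omega> v)"
proof -
  obtain a C where a: "a > 0" and C: "C \<ge> 0" and
    *: "\<And>k. k \<ge> 0 \<Longrightarrow> \<exists>\<phi>. test_function \<Omega> \<phi> \<and> a * k - C \<le> norm_H10 \<Omega> \<phi> \<and>
       (\<forall>v\<in>H10 \<Omega>. \<bar>k * L2_embed \<Omega> \<phi> v\<bar> \<le> C * norm_H10 \<Omega> v \<and>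
          \<bar>grad_inner \<Omega> \<phi> v - k\<^sup>2 * L2_embed \<Omega> \<phi> v\<bar> \<le> C * norm_H10 \<Omega> v)"
    using modulated_test_functions[OF assms(1)] by blast
  define \<delta> where "\<delta> = sqrt (T ^ 3 / 12)"
  have \<delta>: "\<delta> > 0" using assms(2) by (simp add: \<delta>_def)
  show thesis
  \<comment> \<open>2 / c comes from the forcing (2 k / c) cos (omega t), T from |w t| <= T; C
    bounds the two spatial functionals.\<close>
  proof (rule that[of "(2 / c + T) * C"])
    show "0 \<le> (2 / c + T) * C" using assms C by simp
    fix R
    \<comment> \<open>Chosen so that \<delta> (a k - C) >= |R|, where \<delta> bounds the norm of w
      from below.\<close>
    obtain n where n: "(\<bar>R\<bar> / \<delta> + C) / (a * (2 * pi / (T * c))) \<le> real n"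
      using real_arch_simple by blast
    \<comment> \<open>\<open>Suc n\<close> keeps k positive and meets the requirement n >= 1 of
      \<open>L2_norm_resonance\<close>.\<close>
    define k where "k = 2 * pi * real (Suc n) / T / c"
    define \<omega> where "\<omega> = 2 * pi * real (Suc n) / T"
    have k: "k > 0" "\<omega> = c * k" using assms by (auto simp: k_def \<omega>_def)
    have "\<bar>R\<bar> / \<delta> + C \<le> a * (2 * pi / (T * c)) * real n"
      using n a assms pos_divide_le_eq[of "a * (2 * pi / (T * c))"] by (simp only: mult.commute[of _ "real n"]) simp
    also have "\<dots> \<le> a * (2 * pi / (T * c)) * real (Suc n)"
      using a assms by (intro mult_left_mono) auto
    also have "\<dots> = a * k" by (simp add: k_def)
    finally have R: "\<bar>R\<bar> / \<delta> \<le> a * k - C" by simp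
    obtain \<phi> where est: "test_function \<Omega> \<phi>" "a * k - C \<le> norm_H10 \<Omega> \<phi>"
      "\<And>v. v \<in> H10 \<Omega> \<Longrightarrow> \<bar>k * L2_embed \<Omega> \<phi> v\<bar> \<le> C * norm_H10 \<Omega> v"
      "\<And>v. v \<in> H10 \<Omega> \<Longrightarrow> \<bar>grad_inner \<Omega> \<phi> v - k\<^sup>2 * L2_embed \<Omega> \<phi> v\<bar> \<le> C * norm_H10 \<Omega> v"
      using *[of k] k by auto
    define w where "w t = t * sin (\<omega> * t)" for t
    define w' where "w' t = sin (\<omega> * t) + t * (\<omega> * cos (\<omega> * t))" for t
    define w'' where "w'' t = 2 * \<omega> * cos (\<omega> * t) - \<omega>\<^sup>2 * w t" for t
    interpret separated \<Omega> T w w' w'' \<phi>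
    proof
      show "(w has_real_derivative w' t) (at t)" for t
        unfolding w_def w'_def by (auto intro!: derivative_eq_intros)
      show "(w' has_real_derivative w'' t) (at t)" for t
        unfolding w'_def w''_def w_def by (auto intro!: derivative_eq_intros simp: power2_eq_square algebra_simps)
      show "continuous_on UNIV w''"
        unfolding w''_def w_def by (intro continuous_intros)
    qed (use assms est in \<open>auto simp: w_def w'_def\<close>)
    let ?u = "\<lambda>t. w t *\<^sub>R \<phi>"
    have "R \<le> norm_bochner_L2 T (norm_H10 \<Omega>) ?u"
    proof -
      have "\<delta>\<^sup>2 \<le> (L2_norm (lebesgue_on {0..T}) w)\<^sup>2"
        using L2_norm_resonance[OF assms(2), of "Suc n" \<omega>] assms(2)
        by (simp add: \<delta>_def w_def[abs_def] \<omega>_def)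
      then have "\<delta> \<le> L2_norm (lebesgue_on {0..T}) w" using L2_norm_nonneg by (rule power2_le_imp_le)
      then have "\<delta> * (\<bar>R\<bar> / \<delta>) \<le> L2_norm (lebesgue_on {0..T}) w * norm_H10 \<Omega> \<phi>"
        using est(2) R \<delta> by (intro mult_mono L2_norm_nonneg) auto
      then show ?thesis using \<delta> by (simp add: norm_tensor_H10_L2)
    qed
    moreover have "AE t in lebesgue_on {0..T}. \<forall>v\<in>H10 \<Omega>. \<bar>wave_operator \<Omega> T c ?u t v\<bar> \<le> (2 / c + T) * C * norm_H10 \<Omega> v"
      using dtt_tensor_eq AE_space
    proof eventually_elim
      case (elim t)
      then have t: "0 \<le> t" "t \<le> T" by (auto simp: space_restrict_space)
      show ?case
      proof
        fix v assume v: "v \<in> H10 \<Omega>"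
        let ?L = "L2_embed \<Omega> \<phi> v" and ?G = "grad_inner \<Omega> \<phi> v" and ?n = "norm_H10 \<Omega> v"
        have "wave_operator \<Omega> T c ?u t v = 1 / c\<^sup>2 * (w'' t * ?L) + w t * ?G"
          using elim(1) v grad_inner_scaleR_left[OF test_function_H1(1)[OF est(1)] H10_H1[OF v], of "w t"]
          by (simp add: wave_operator_def weak_laplacian_def scaleR_fun_def[of _ "dtt _ _ _ _"] l_def)
        \<comment> \<open>As omega = c k, the part - omega^2 w / c^2 is exactly - k^2 w and joins
          the gradient term to form the defect.\<close>
        also have "\<dots> = 2 / c * cos (\<omega> * t) * (k * ?L) + w t * (?G - k\<^sup>2 * ?L)"
          using assms(3) by (simp add: w''_def k(2) divide_simps power2_eq_square) (simp add: algebra_simps)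
        finally have eq: "wave_operator \<Omega> T c ?u t v = 2 / c * cos (\<omega> * t) * (k * ?L) + w t * (?G - k\<^sup>2 * ?L)" .
        have "\<bar>2 / c * cos (\<omega> * t)\<bar> * \<bar>k * ?L\<bar> \<le> (2 / c) * (C * ?n)"
          using est(3)[OF v] assms(3) by (intro mult_mono) (auto simp: abs_mult divide_simps)
        moreover have "\<bar>w t\<bar> * \<bar>?G - k\<^sup>2 * ?L\<bar> \<le> T * (C * ?n)"
        proof (intro mult_mono est(4)[OF v])
          have "\<bar>t\<bar> * \<bar>sin (\<omega> * t)\<bar> \<le> T * 1" using t by (intro mult_mono) auto
          then show "\<bar>w t\<bar> \<le> T" by (simp add: w_def abs_mult)
        qed (use assms in auto)
        moreover have "\<bar>wave_operator \<Omega> T c ?u t v\<bar>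
            \<le> \<bar>2 / c * cos (\<omega> * t)\<bar> * \<bar>k * ?L\<bar> + \<bar>w t\<bar> * \<bar>?G - k\<^sup>2 * ?L\<bar>"
          unfolding eq abs_mult[symmetric] by (rule abs_triangle_ineq)
        moreover have "(2 / c + T) * C * ?n = (2 / c) * (C * ?n) + T * (C * ?n)"
          by (simp add: algebra_simps)
        ultimately show "\<bar>wave_operator \<Omega> T c ?u t v\<bar> \<le> (2 / c + T) * C * ?n" by linarith
      qed
    qed
    ultimately show "\<exists>u\<in>trial_space \<Omega> T. R \<le> norm_bochner_L2 T (norm_H10 \<Omega>) u \<and>
        (AE t in lebesgue_on {0..T}. \<forall>v\<in>H10 \<Omega>. \<bar>wave_operator \<Omega> T c u t v\<bar> \<le> (2 / c + T) * C * norm_H10 \<Omega> v)"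
      using tensor_trial_space by blast
  qed
qed

section \<open>Symmetry under a change of sign and nonnegativity of the supremum\<close>

lemma test_space_minus:
  assumes "v \<in> test_space \<Omega> T"
  shows "(\<lambda>t. (-1) *\<^sub>R v t) \<in> test_space \<Omega> T"
proof -
  have v: "v t \<in> H10 \<Omega>" if "t \<in> {0..T}" for t
    using assms that by (auto simp: test_space_def dest: bochner_L2_mem)
  obtain s where s: "\<And>i. simple_function (lebesgue_on {0..T}) (s i)" "\<And>i. s i \<in> {0..T} \<rightarrow> H10 \<Omega>"
    "AE t in lebesgue_on {0..T}. (\<lambda>i. norm_H10 \<Omega> (v t - s i t)) \<longlonglongrightarrow> 0"
    using assms by (auto simp: test_space_def bochner_L2_def strongly_measurable_def)
  have N: "norm_H10 \<Omega> ((-1) *\<^sub>R v t) = norm_H10 \<Omega> (v t)" if "t \<in> {0..T}" for t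
    using H1_scaleR(3)[OF H10_H1[OF v[OF that]], of "-1"] by simp
  have "AE t in lebesgue_on {0..T}. (\<lambda>i. norm_H10 \<Omega> ((-1) *\<^sub>R v t - (-1) *\<^sub>R s i t)) \<longlonglongrightarrow> 0"
    using s(3) AE_space
  proof eventually_elim
    case (elim t)
    have "norm_H10 \<Omega> ((-1) *\<^sub>R v t - (-1) *\<^sub>R s i t) = norm_H10 \<Omega> (v t - s i t)" for i
    proof -
      have "v t - s i t \<in> H1 \<Omega>"
        using H1_linear(1)[OF H10_H1[OF v[of t]] H10_H1[OF funcset_mem[OF s(2)[of i], of t]], of 1 "-1"] elim(2)
        by (simp add: space_restrict_space fun_diff_def)
      from H1_scaleR(3)[OF this, of "-1"] show ?thesis
        by (simp only: scaleR_diff_right abs_neg_one mult_1)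
    qed
    with elim(1) show ?case by simp
  qed
  then have "strongly_measurable (lebesgue_on {0..T}) (H10 \<Omega>) (norm_H10 \<Omega>) (\<lambda>t. (-1) *\<^sub>R v t)"
    unfolding strongly_measurable_def using v s
    by (intro conjI exI[of _ "\<lambda>i t. (-1) *\<^sub>R s i t"])
       (auto simp only: space_restrict_space intro!: H10_scaleR simple_function_compose1[of _ _ "\<lambda>x. (-1) *\<^sub>R x"])
  moreover have "integrable (lebesgue_on {0..T}) (\<lambda>t. (norm_H10 \<Omega> ((-1) *\<^sub>R v t))\<^sup>2)"
    using assms N
    by (subst Bochner_Integration.integrable_cong[OF refl, of _ _ "\<lambda>t. (norm_H10 \<Omega> (v t))\<^sup>2"])
       (auto simp: test_space_def bochner_L2_def space_restrict_space)
  ultimately show ?thesis by (simp add: test_space_def bochner_L2_def)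
qed

lemma wave_form_minus:
  assumes u: "u \<in> trial_space \<Omega> T" and v: "v \<in> test_space \<Omega> T"
  shows "wave_form \<Omega> T c u (\<lambda>t. (-1) *\<^sub>R v t) = - wave_form \<Omega> T c u v"
proof -
  have "1 / c\<^sup>2 * dtt \<Omega> T u t ((-1) *\<^sub>R v t) + grad_inner \<Omega> (u t) ((-1) *\<^sub>R v t)
      = - (1 / c\<^sup>2 * dtt \<Omega> T u t (v t) + grad_inner \<Omega> (u t) (v t))" if t: "t \<in> {0..T}" for t
  proof -
    have H: "v t \<in> H10 \<Omega>" "u t \<in> H10 \<Omega>"
      using u v t by (auto simp: trial_space_def test_space_def dest: bochner_L2_mem)
    have "dtt \<Omega> T u t ((-1) *\<^sub>R v t) = - dtt \<Omega> T u t (v t)"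
      using Hm1_scale[OF trial_space_dtt[OF u t] H(1), of "-1"] by simp
    moreover have "grad_inner \<Omega> (u t) ((-1) *\<^sub>R v t) = - grad_inner \<Omega> (u t) (v t)"
      using grad_inner_scaleR_left[OF H(1)[THEN H10_H1] H(2)[THEN H10_H1], of "-1"]
      by (simp add: grad_inner_commute[of "u t"])
    ultimately show ?thesis by simp
  qed
  then have "wave_form \<Omega> T c u (\<lambda>t. (-1) *\<^sub>R v t)
      = (\<integral>t. - (1 / c\<^sup>2 * dtt \<Omega> T u t (v t) + grad_inner \<Omega> (u t) (v t)) \<partial>lebesgue_on {0..T})"
    unfolding wave_form_def
    by (intro Bochner_Integration.integral_cong) (simp_all only: space_restrict_space space_completion space_lborel space_borel Int_UNIV_right)
  \<comment> \<open>Pulling out the sign is valid for every integrand: a non-integrable one has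
    integral 0 on both sides.\<close>
  then show ?thesis
    by (simp only: wave_form_def Bochner_Integration.integral_minus)
qed

lemma norm_test_minus:
  assumes "v \<in> test_space \<Omega> T"
  shows "norm_test \<Omega> T (\<lambda>t. (-1) *\<^sub>R v t) = norm_test \<Omega> T v"
proof -
  have "norm_H10 \<Omega> ((-1) *\<^sub>R v t) = norm_H10 \<Omega> (v t)" if "t \<in> {0..T}" for t
    using H1_scaleR(3)[OF H10_H1[of "v t"], of "-1"] assms that
    by (simp add: test_space_def bochner_L2_mem)
  then show ?thesis
    unfolding norm_test_def norm_bochner_L2_def
    by (intro arg_cong[where f = sqrt] Bochner_Integration.integral_cong)
       (simp_all only: space_restrict_space space_completion space_lborel space_borel Int_UNIV_right)
qed

lemma ae_zero_minus: "ae_zero \<Omega> T (\<lambda>t. (-1) *\<^sub>R v t) \<longleftrightarrow> ae_zero \<Omega> T v"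
  by (simp add: ae_zero_def scaleR_fun_def)

lemma norm_bochner_L2_le_norm_trial: "norm_bochner_L2 T (norm_H10 \<Omega>) u \<le> norm_trial \<Omega> T c u"
  unfolding norm_trial_def by (rule real_le_rsqrt) simp

lemma inf_sup_nonneg:
  assumes ne: "\<exists>v\<in>test_space \<Omega> T. \<not> ae_zero \<Omega> T v" and u: "u \<in> trial_space \<Omega> T"
  shows "0 \<le> (SUP v \<in> {v \<in> test_space \<Omega> T. \<not> ae_zero \<Omega> T v}.
    ereal (wave_form \<Omega> T c u v / (norm_trial \<Omega> T c u * norm_test \<Omega> T v)))"
proof -
  obtain v where v: "v \<in> test_space \<Omega> T" "\<not> ae_zero \<Omega> T v" using ne by blast
  define q where "q v = wave_form \<Omega> T c u v / (norm_trial \<Omega> T c u * norm_test \<Omega> T v)" for v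
  have "q (\<lambda>t. (-1) *\<^sub>R v t) = - q v"
    unfolding q_def wave_form_minus[OF u v(1)] norm_test_minus[OF v(1)] by simp
  then have "0 \<le> q v \<or> 0 \<le> q (\<lambda>t. (-1) *\<^sub>R v t)" by linarith
  then show ?thesis
  proof
    assume "0 \<le> q v"
    then show ?thesis using v by (intro SUP_upper2[of v]) (auto simp: q_def)
  next
    assume "0 \<le> q (\<lambda>t. (-1) *\<^sub>R v t)"
    then show ?thesis using v test_space_minus[OF v(1)] unfolding q_def
      by (intro SUP_upper2[of "\<lambda>t. (-1) *\<^sub>R v t"]) (simp_all only: ae_zero_minus mem_Collect_eq simp_thms ereal_less_eq zero_ereal_def)
  qed
qed

end

theorem corollary3p3:
  fixes \<Omega> :: "'a::euclidean_space set" and T c :: real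
  assumes "lipschitz_domain \<Omega>" and "T > 0" and "c > 0"
  shows "(INF u \<in> {u \<in> trial_space \<Omega> T. \<not> ae_zero \<Omega> T u}.
            SUP v \<in> {v \<in> test_space \<Omega> T. \<not> ae_zero \<Omega> T v}.
              ereal (wave_form \<Omega> T c u v / (norm_trial \<Omega> T c u * norm_test \<Omega> T v))) = 0
       \<and> \<not> (\<exists>C1 C2. 0 < C1 \<and> C1 \<le> C2 \<and>
            (\<forall>u \<in> trial_space \<Omega> T.
               C1 * norm_data \<Omega> T (wave_operator \<Omega> T c u) \<le> norm_trial \<Omega> T c u \<and>
               norm_trial \<Omega> T c u \<le> C2 * norm_data \<Omega> T (wave_operator \<Omega> T c u)))"
proof -
  interpret bounded_open \<Omega>
    using assms(1) by unfold_locales (auto simp: lipschitz_domain_def)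
  have "\<Omega> \<noteq> {}" using assms(1) by (simp add: lipschitz_domain_def)
  then obtain K where K: "K \<ge> 0" and fam:
    "\<And>R. \<exists>u\<in>trial_space \<Omega> T. R \<le> norm_bochner_L2 T (norm_H10 \<Omega>) u \<and>
      (AE t in lebesgue_on {0..T}. \<forall>v\<in>H10 \<Omega>. \<bar>wave_operator \<Omega> T c u t v\<bar> \<le> K * norm_H10 \<Omega> v)"
    using resonant_family[OF _ assms(2,3)] by blast
  have L2: "u \<in> bochner_L2 T (H10 \<Omega>) (norm_H10 \<Omega>)" if "u \<in> trial_space \<Omega> T" for u
    using that by (simp add: trial_space_def)
  have nz: "\<not> ae_zero \<Omega> T u" if "u \<in> trial_space \<Omega> T" "0 < norm_bochner_L2 T (norm_H10 \<Omega>) u" for u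
    using ae_zero_norm_H10[OF _ L2[OF that(1)]] that(2) by auto
  \<comment> \<open>The supremum over an empty set would be minus infinity in \<open>ereal\<close>;
    a member of the resonant family is itself a nonzero test function.\<close>
  have "\<exists>v\<in>test_space \<Omega> T. \<not> ae_zero \<Omega> T v"
    using fam[of 1] nz L2 by (force simp: test_space_def)
  note nonneg = inf_sup_nonneg[OF this]
  let ?S = "\<lambda>u. SUP v \<in> {v \<in> test_space \<Omega> T. \<not> ae_zero \<Omega> T v}.
      ereal (wave_form \<Omega> T c u v / (norm_trial \<Omega> T c u * norm_test \<Omega> T v))"
  have "(INF u \<in> {u \<in> trial_space \<Omega> T. \<not> ae_zero \<Omega> T u}. ?S u) = 0"
  proof (rule antisym)
    show "0 \<le> (INF u \<in> {u \<in> trial_space \<Omega> T. \<not> ae_zero \<Omega> T u}. ?S u)"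
      by (rule INF_greatest) (use nonneg in blast)
    show "(INF u \<in> {u \<in> trial_space \<Omega> T. \<not> ae_zero \<Omega> T u}. ?S u) \<le> 0"
    proof (rule ereal_le_epsilon2)
      fix \<epsilon> :: real assume \<epsilon>: "\<epsilon> > 0"
      \<comment> \<open>The entry 1 makes u nonzero and its trial norm positive; the other entry
        makes the quotient at most \<epsilon>.\<close>
      obtain u where u: "u \<in> trial_space \<Omega> T" "max 1 (K * sqrt T / \<epsilon>) \<le> norm_bochner_L2 T (norm_H10 \<Omega>) u"
        "AE t in lebesgue_on {0..T}. \<forall>v\<in>H10 \<Omega>. \<bar>wave_operator \<Omega> T c u t v\<bar> \<le> K * norm_H10 \<Omega> v"
        using fam by blast
      have N: "1 \<le> norm_trial \<Omega> T c u" "K * sqrt T / \<epsilon> \<le> norm_trial \<Omega> T c u"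
        using u(2) norm_bochner_L2_le_norm_trial[of T u c] by auto
      have "?S u \<le> ereal \<epsilon>"
      proof (rule SUP_least)
        fix v assume "v \<in> {v \<in> test_space \<Omega> T. \<not> ae_zero \<Omega> T v}"
        then have "wave_form \<Omega> T c u v \<le> K * sqrt T * norm_test \<Omega> T v"
          unfolding wave_form_eq_pairing by (intro pairing_le u(3) K assms(2)) auto
        moreover have nt: "0 \<le> norm_test \<Omega> T v" by (simp add: norm_test_def norm_bochner_L2_def)
        moreover have "K * sqrt T \<le> \<epsilon> * norm_trial \<Omega> T c u"
          using N(2) \<epsilon> by (simp add: pos_divide_le_eq mult.commute)
        ultimately have "wave_form \<Omega> T c u v \<le> \<epsilon> * (norm_trial \<Omega> T c u * norm_test \<Omega> T v)"
          using mult_right_mono[of "K * sqrt T" "\<epsilon> * norm_trial \<Omega> T c u" "norm_test \<Omega> T v"] by (simp add: mult.assoc)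
        \<comment> \<open>Should the test norm be 0, the quotient is 0 by the convention on
          division.\<close>
        then have "wave_form \<Omega> T c u v / (norm_trial \<Omega> T c u * norm_test \<Omega> T v) \<le> \<epsilon>"
          using nt N(1) \<epsilon> by (cases "norm_test \<Omega> T v = 0") (simp_all add: pos_divide_le_eq)
        then show "ereal (wave_form \<Omega> T c u v / (norm_trial \<Omega> T c u * norm_test \<Omega> T v)) \<le> ereal \<epsilon>" by simp
      qed
      moreover have "u \<in> {u \<in> trial_space \<Omega> T. \<not> ae_zero \<Omega> T u}"
        using u(1,2) nz[of u] by auto
      ultimately show "(INF u \<in> {u \<in> trial_space \<Omega> T. \<not> ae_zero \<Omega> T u}. ?S u) \<le> 0 + ereal \<epsilon>"
        by (simp add: INF_lower2)
    qed
  qed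
  moreover have "\<not> (\<exists>C1 C2. 0 < C1 \<and> C1 \<le> C2 \<and>
      (\<forall>u \<in> trial_space \<Omega> T. C1 * norm_data \<Omega> T (wave_operator \<Omega> T c u) \<le> norm_trial \<Omega> T c u \<and>
         norm_trial \<Omega> T c u \<le> C2 * norm_data \<Omega> T (wave_operator \<Omega> T c u)))"
  proof
    assume "\<exists>C1 C2. 0 < C1 \<and> C1 \<le> C2 \<and>
      (\<forall>u \<in> trial_space \<Omega> T. C1 * norm_data \<Omega> T (wave_operator \<Omega> T c u) \<le> norm_trial \<Omega> T c u \<and>
         norm_trial \<Omega> T c u \<le> C2 * norm_data \<Omega> T (wave_operator \<Omega> T c u))"
    then obtain C2 where C2: "0 < C2"
      "\<And>u. u \<in> trial_space \<Omega> T \<Longrightarrow> norm_trial \<Omega> T c u \<le> C2 * norm_data \<Omega> T (wave_operator \<Omega> T c u)"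
      by (meson less_le_trans)
    \<comment> \<open>The summand 1 makes the final comparison strict, hence contradictory.\<close>
    obtain u where u: "u \<in> trial_space \<Omega> T" "C2 * (K * sqrt T) + 1 \<le> norm_bochner_L2 T (norm_H10 \<Omega>) u"
      "AE t in lebesgue_on {0..T}. \<forall>v\<in>H10 \<Omega>. \<bar>wave_operator \<Omega> T c u t v\<bar> \<le> K * norm_H10 \<Omega> v"
      using fam by blast
    have "C2 * norm_data \<Omega> T (wave_operator \<Omega> T c u) \<le> C2 * (K * sqrt T)"
      using norm_data_le[OF u(3) K assms(2)] C2(1) by (intro mult_left_mono) auto
    with C2(2)[OF u(1)] have "norm_trial \<Omega> T c u \<le> C2 * (K * sqrt T)" by (rule order_trans)
    then show False
      using u(2) norm_bochner_L2_le_norm_trial[of T u c] by simp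
  qed
  ultimately show ?thesis by blast
qed

end
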